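(* Every non-parabolic rotational surface of constant mean curvature $H$ (with $H\ge 0$) satisfying $H^2>1$ in $\mathbb{H}^3\subset\mathbb{R}^{3,1}$ is given, with respect to a suitable orthonormal basis $(e_0,e_1,e_2,e_3)$ of $\mathbb{R}^{3,1}$ with $e_0$ timelike, by one of the following parametrizations: (elliptic rotations, $\kappa_1=1$) $$(\theta,t)\mapsto\Big(\sqrt{1+r^2(t)}\cosh\psi(t),\ \sqrt{1+r^2(t)}\sinh\psi(t),\ r(t)\cos\theta,\ r(t)\sin\theta\Big),$$ (hyperbolic rotations, $\kappa_1=-1$) $$(\theta,t)\mapsto\Big(r(t)\cosh\theta,\ r(t)\sinh\theta,\ \sqrt{r^2(t)-1}\cos\psi(t),\ \sqrt{r^2(t)-1}\sin\psi(t)\Big),$$ with $$r(t)=\sqrt{C_1}\,\operatorname{dn}_p(\Xi t),\qquad p^2=\frac{C_1-C_2}{C_1}\in[0,1],$$ $$\psi(t)=Ht-\frac{C+\kappa_1H}{C_1+\kappa_1}\,\frac1\Xi\,\Pi_p\!\left(\frac{C_1-C_2}{C_1+\kappa_1};\,\Xi t\right),$$ where $\Xi=\sqrt{(H^2-1)C_1}$, and $C\in\mathbb{R}$ is a constant such that the polynomial $$p_C(x)=(H^2-1)x^2-(\kappa_1+2HC)x+C^2$$ has real non-negative roots, denoted $C_1\ge C_2\ge 0$.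
   Context: $\mathbb{R}^{3,1}$ is Minkowski space with inner product $-x_0y_0+x_1y_1+x_2y_2+x_3y_3$ in an orthonormal basis, and $\mathbb{H}^3=\{x:(x,x)=-1,\ x_0>0\}$ is hyperbolic space of curvature $-1$. Mean curvature is $H=\frac{\kappa_1+\kappa_2}{2}$ for principal curvatures $\kappa_1,\kappa_2$ (not to be confused with the sign $\kappa_1\in\{\pm1\}$ in the claim, which encodes the type of rotation); the orientation of the unit normal is always chosen such that $H\ge0$. A surface in $\mathbb{H}^3$ is rotational if it is invariant under a 1-parameter group of isometries that acts as the identity on the orthogonal complement of a 2-plane $\Pi_1\subset\mathbb{R}^{3,1}$; the rotation is elliptic, parabolic or hyperbolic if $\Pi_1$ has signature $(++)$, $(+0)$ or $(+-)$, respectively. $\operatorname{sn}_p,\operatorname{cn}_p,\operatorname{dn}_p$ denote the Jacobi elliptic functions with modulus $p$, and $\Pi_p(k;s)=\int_0^s\frac{du}{1-k\,\operatorname{sn}_p^2(u)}$ is the incomplete elliptic integral of the third kind.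
   Formalization: Elliptic case: points on the rotation axis (poles of spheres, where r=0 is never attained) are excluded. Hyperbolic case with C=H: where the profile crosses the axis r=1, (e_2,e_3) is replaced by its negative, and psi is read as Ht since the integral diverges with zero coefficient. *)

theory Defs
  imports "HOL-Analysis.Analysis"
begin

section \<open>Minkowski space and hyperbolic space\<close>

type_synonym mink_space = "real \<times> (real ^ 3)"

definition mink :: "mink_space \<Rightarrow> mink_space \<Rightarrow> real" where
  "mink x y = - (fst x * fst y) + snd x \<bullet> snd y"

definition hyp3 :: "mink_space set" where
  "hyp3 = {x. mink x x = -1 \<and> fst x > 0}"

text \<open>Only the values \<^term>\<open>e 0\<close>, ..., \<^term>\<open>e 3\<close> matter; such a family is automatically a basis.\<close>

definition orthonormal_basis :: "(nat \<Rightarrow> mink_space) \<Rightarrow> bool" where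
  "orthonormal_basis e \<longleftrightarrow>
     (\<forall>i<4. \<forall>j<4. mink (e i) (e j) = (if i \<noteq> j then 0 else if i = 0 then -1 else 1))"

text \<open>Signature of a 2-plane, read off from an orthogonal basis normalised to squares in
  \<open>{-1, 0, 1}\<close>.\<close>

definition has_signature :: "mink_space set \<Rightarrow> real \<Rightarrow> real \<Rightarrow> bool" where
  "has_signature V s1 s2 \<longleftrightarrow>
     (\<exists>a b. a \<noteq> b \<and> independent {a, b} \<and> span {a, b} = V \<and>
            mink a a = s1 \<and> mink b b = s2 \<and> mink a b = 0)"

definition elliptic_plane :: "mink_space set \<Rightarrow> bool" where
  "elliptic_plane V \<longleftrightarrow> has_signature V 1 1"

definition parabolic_plane :: "mink_space set \<Rightarrow> bool" where
  "parabolic_plane V \<longleftrightarrow> has_signature V 1 0"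

definition hyperbolic_plane :: "mink_space set \<Rightarrow> bool" where
  "hyperbolic_plane V \<longleftrightarrow> has_signature V 1 (-1)"

section \<open>Immersed surfaces and their mean curvature\<close>

text \<open>Functions of class \<open>C\<^sup>k\<close> on an open set: all iterated directional derivatives up to
  order \<open>k\<close> exist and are continuous.\<close>

primrec Ck_on :: "nat \<Rightarrow> 'a::euclidean_space set \<Rightarrow> ('a \<Rightarrow> 'b::real_normed_vector) \<Rightarrow> bool" where
  "Ck_on 0 U f = continuous_on U f"
| "Ck_on (Suc k) U f =
     (f differentiable_on U \<and> (\<forall>a. Ck_on k U (\<lambda>z. frechet_derivative f (at z) a)))"

definition immersion_on :: "(real \<times> real) set \<Rightarrow> (real \<times> real \<Rightarrow> mink_space) \<Rightarrow> bool" where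
  "immersion_on U f \<longleftrightarrow> Ck_on 2 U f \<and> (\<forall>z\<in>U. inj (frechet_derivative f (at z)))"

text \<open>An immersed surface is a map \<^term>\<open>x\<close> from a connected Hausdorff space \<^term>\<open>M\<close> that has,
  around every point, a topological chart in which \<^term>\<open>x\<close> is an immersion. No
  differentiable structure on \<^term>\<open>M\<close> is needed: any two such charts have \<open>C\<^sup>2\<close> transition
  maps, since \<^term>\<open>x\<close> is an immersion in both. Self-intersections are allowed.\<close>

definition local_param ::
  "'m::t2_space set \<Rightarrow> ('m \<Rightarrow> mink_space) \<Rightarrow> (real \<times> real) set \<Rightarrow> (real \<times> real \<Rightarrow> 'm) \<Rightarrow> bool" where
  "local_param M x U q \<longleftrightarrow>
     open U \<and> openin (top_of_set M) (q ` U) \<and> (\<exists>g. homeomorphism U (q ` U) q g) \<and>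
     immersion_on U (x \<circ> q)"

definition immersed_surface :: "'m::t2_space set \<Rightarrow> ('m \<Rightarrow> mink_space) \<Rightarrow> bool" where
  "immersed_surface M x \<longleftrightarrow>
     M \<noteq> {} \<and> connected M \<and> x ` M \<subseteq> hyp3 \<and>
     (\<forall>m\<in>M. \<exists>U q. local_param M x U q \<and> m \<in> q ` U)"

definition unit_normal :: "(real \<times> real \<Rightarrow> mink_space) \<Rightarrow> real \<times> real \<Rightarrow> mink_space \<Rightarrow> bool" where
  "unit_normal f z n \<longleftrightarrow>
     mink n n = 1 \<and> mink n (f z) = 0 \<and> (\<forall>a. mink n (frechet_derivative f (at z) a) = 0)"

definition fund1 :: "(real \<times> real \<Rightarrow> mink_space) \<Rightarrow> real \<times> real \<Rightarrow> real \<times> real \<Rightarrow> real \<times> real \<Rightarrow> real" where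
  "fund1 f z a b = mink (frechet_derivative f (at z) a) (frechet_derivative f (at z) b)"

text \<open>The ambient second derivative may be used in place of the covariant derivative of
  hyperbolic space: they differ by a multiple of \<^term>\<open>f z\<close>, which is orthogonal to \<^term>\<open>n\<close>.\<close>

definition fund2 ::
  "(real \<times> real \<Rightarrow> mink_space) \<Rightarrow> mink_space \<Rightarrow> real \<times> real \<Rightarrow> real \<times> real \<Rightarrow> real \<times> real \<Rightarrow> real" where
  "fund2 f n z a b =
     mink (frechet_derivative (\<lambda>w. frechet_derivative f (at w) a) (at z) b) n"

text \<open>\<^term>\<open>k1\<close> and \<^term>\<open>k2\<close> are the principal curvatures, listed with multiplicity:
  the second fundamental form is diagonal in the orthonormal tangent frame of principal
  directions \<^term>\<open>a\<close>, \<^term>\<open>b\<close>.\<close>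

definition principal_curvatures ::
  "(real \<times> real \<Rightarrow> mink_space) \<Rightarrow> mink_space \<Rightarrow> real \<times> real \<Rightarrow> real \<Rightarrow> real \<Rightarrow> bool" where
  "principal_curvatures f n z k1 k2 \<longleftrightarrow>
     (\<exists>a b. fund1 f z a a = 1 \<and> fund1 f z b b = 1 \<and> fund1 f z a b = 0 \<and>
            fund2 f n z a a = k1 \<and> fund2 f n z b b = k2 \<and> fund2 f n z a b = 0)"

text \<open>Constant mean curvature \<^term>\<open>H\<close> for the choice of unit normal that makes it equal to
  \<^term>\<open>H\<close>. For \<open>H > 0\<close> that normal is unique at each point and hence continuous.\<close>

definition cmc_surface :: "'m::t2_space set \<Rightarrow> ('m \<Rightarrow> mink_space) \<Rightarrow> real \<Rightarrow> bool" where
  "cmc_surface M x H \<longleftrightarrow>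
     (\<forall>U q. local_param M x U q \<longrightarrow>
        (\<forall>z\<in>U. \<exists>n k1 k2. unit_normal (x \<circ> q) z n \<and>
           principal_curvatures (x \<circ> q) n z k1 k2 \<and> H = (k1 + k2) / 2))"

section \<open>Rotational surfaces\<close>

text \<open>A nontrivial 1-parameter group of isometries acting as the identity on the orthogonal
  complement of \<^term>\<open>V\<close>.\<close>

definition rotation_group :: "mink_space set \<Rightarrow> (real \<Rightarrow> mink_space \<Rightarrow> mink_space) \<Rightarrow> bool" where
  "rotation_group V R \<longleftrightarrow>
     (\<forall>s. linear (R s)) \<and> (\<forall>s v w. mink (R s v) (R s w) = mink v w) \<and>
     R 0 = id \<and> (\<forall>s t. R (s + t) = R s \<circ> R t) \<and>
     (\<forall>v. continuous_on UNIV (\<lambda>s. R s v)) \<and> (\<exists>s. R s \<noteq> id) \<and>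
     (\<forall>s v. (\<forall>w\<in>V. mink v w = 0) \<longrightarrow> R s v = v)"

text \<open>Invariance of an immersed surface: the group acts on \<^term>\<open>M\<close> in such a way that
  \<^term>\<open>x\<close> is equivariant. For a subset of hyperbolic space (\<open>x\<close> the identity) this just says
  that the subset is mapped to itself.\<close>

definition rotational_surface :: "mink_space set \<Rightarrow> 'm::t2_space set \<Rightarrow> ('m \<Rightarrow> mink_space) \<Rightarrow> bool" where
  "rotational_surface V M x \<longleftrightarrow>
     subspace V \<and> dim V = 2 \<and>
     (\<exists>R \<phi>. rotation_group V R \<and>
        (\<forall>s. \<forall>m\<in>M. \<phi> s m \<in> M \<and> x (\<phi> s m) = R s (x m)) \<and>
        (\<forall>m\<in>M. \<phi> 0 m = m) \<and> (\<forall>s t. \<forall>m\<in>M. \<phi> (s + t) m = \<phi> s (\<phi> t m)) \<and>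
        continuous_on (UNIV \<times> M) (\<lambda>(s, m). \<phi> s m))"

section \<open>Jacobi elliptic functions\<close>

text \<open>The integrals are oriented (\<open>LBINT\<close> from \<open>0\<close> to a possibly negative bound). Everything is
  meant for moduli \<open>0 \<le> p \<le> 1\<close>. For \<open>p = 1\<close> the integral of the first kind diverges at
  \<open>\<plusminus>pi/2\<close>, so the amplitude is then its inverse on the open interval between these points.\<close>

definition ellint_F :: "real \<Rightarrow> real \<Rightarrow> real" where
  "ellint_F p \<phi> = (LBINT \<alpha>=ereal 0..ereal \<phi>. 1 / sqrt (1 - p\<^sup>2 * (sin \<alpha>)\<^sup>2))"

definition jacobi_am :: "real \<Rightarrow> real \<Rightarrow> real" where
  "jacobi_am p u = (THE \<phi>. (p = 1 \<longrightarrow> \<bar>\<phi>\<bar> < pi / 2) \<and> ellint_F p \<phi> = u)"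

definition jacobi_sn :: "real \<Rightarrow> real \<Rightarrow> real" where
  "jacobi_sn p u = sin (jacobi_am p u)"

definition jacobi_dn :: "real \<Rightarrow> real \<Rightarrow> real" where
  "jacobi_dn p u = sqrt (1 - p\<^sup>2 * (jacobi_sn p u)\<^sup>2)"

definition ellint_Pi :: "real \<Rightarrow> real \<Rightarrow> real \<Rightarrow> real" where
  "ellint_Pi p k s = (LBINT u=ereal 0..ereal s. 1 / (1 - k * (jacobi_sn p u)\<^sup>2))"

section \<open>The explicit parametrizations\<close>

definition cmc_poly :: "real \<Rightarrow> real \<Rightarrow> real \<Rightarrow> real poly" where
  "cmc_poly \<kappa> H C = [: C\<^sup>2, - (\<kappa> + 2 * H * C), H\<^sup>2 - 1 :]"

definition cmc_Xi :: "real \<Rightarrow> real \<Rightarrow> real" where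
  "cmc_Xi H C1 = sqrt ((H\<^sup>2 - 1) * C1)"

definition cmc_r :: "real \<Rightarrow> real \<Rightarrow> real \<Rightarrow> real \<Rightarrow> real" where
  "cmc_r H C1 p t = sqrt C1 * jacobi_dn p (cmc_Xi H C1 * t)"

text \<open>For \<open>\<kappa> = -1\<close>, \<open>C = H\<close> one has \<open>C2 = 1\<close>; the integral then diverges, but its
  coefficient is \<open>0\<close>, so the formula reads \<open>H * t\<close>.\<close>

definition cmc_psi :: "real \<Rightarrow> real \<Rightarrow> real \<Rightarrow> real \<Rightarrow> real \<Rightarrow> real \<Rightarrow> real \<Rightarrow> real" where
  "cmc_psi \<kappa> H C C1 C2 p t =
     H * t - (C + \<kappa> * H) / (C1 + \<kappa>) * (1 / cmc_Xi H C1) *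
       ellint_Pi p ((C1 - C2) / (C1 + \<kappa>)) (cmc_Xi H C1 * t)"

definition elliptic_rot ::
  "(nat \<Rightarrow> mink_space) \<Rightarrow> (real \<Rightarrow> real) \<Rightarrow> (real \<Rightarrow> real) \<Rightarrow> real \<Rightarrow> real \<Rightarrow> mink_space" where
  "elliptic_rot e r \<psi> \<theta> t =
     (sqrt (1 + (r t)\<^sup>2) * cosh (\<psi> t)) *\<^sub>R e 0 + (sqrt (1 + (r t)\<^sup>2) * sinh (\<psi> t)) *\<^sub>R e 1 +
     (r t * cos \<theta>) *\<^sub>R e 2 + (r t * sin \<theta>) *\<^sub>R e 3"

definition hyperbolic_rot ::
  "(nat \<Rightarrow> mink_space) \<Rightarrow> (real \<Rightarrow> real) \<Rightarrow> (real \<Rightarrow> real) \<Rightarrow> real \<Rightarrow> real \<Rightarrow> mink_space" where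
  "hyperbolic_rot e r \<psi> \<theta> t =
     (r t * cosh \<theta>) *\<^sub>R e 0 + (r t * sinh \<theta>) *\<^sub>R e 1 +
     (sqrt ((r t)\<^sup>2 - 1) * cos (\<psi> t)) *\<^sub>R e 2 + (sqrt ((r t)\<^sup>2 - 1) * sin (\<psi> t)) *\<^sub>R e 3"

text \<open>The orthonormal basis \<open>(e 0, e 1, \<epsilon> * e 2, \<epsilon> * e 3)\<close> for a sign \<open>\<epsilon>\<close>.\<close>

definition flip23 :: "real \<Rightarrow> (nat \<Rightarrow> mink_space) \<Rightarrow> nat \<Rightarrow> mink_space" where
  "flip23 \<epsilon> e i = (if i = 2 \<or> i = 3 then \<epsilon> *\<^sub>R e i else e i)"

text \<open>The part \<open>N\<close> of the surface \<open>x : M \<rightarrow> hyp3\<close> is given by the parametrization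
  \<open>(\<theta>, t) \<mapsto> P \<theta> t\<close> with \<open>t\<close> in \<open>J\<close>: some local homeomorphism \<open>q\<close> from \<open>UNIV \<times> J\<close> onto \<open>N\<close>
  satisfies \<open>x \<circ> q = P\<close>, and \<open>P\<close> is an immersion.\<close>

definition parametrized_by ::
  "'m::t2_space set \<Rightarrow> ('m \<Rightarrow> mink_space) \<Rightarrow> 'm set \<Rightarrow> real set \<Rightarrow>
   (real \<Rightarrow> real \<Rightarrow> mink_space) \<Rightarrow> bool" where
  "parametrized_by M x N J P \<longleftrightarrow>
     (\<exists>q. q ` (UNIV \<times> J) = N \<and>
        (\<forall>z\<in>UNIV \<times> J. \<exists>U. z \<in> U \<and> U \<subseteq> UNIV \<times> J \<and> local_param M x U q) \<and>
        (\<forall>\<theta>. \<forall>t\<in>J. x (q (\<theta>, t)) = P \<theta> t))"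

text \<open>In both cases the geodesic \<open>hyp3 \<inter> span {e 0, e 1}\<close> is the axis of the rotation, where the
  coordinates \<open>(r, \<theta>, \<psi>)\<close> degenerate (\<open>r = 0\<close>, respectively \<open>r = 1\<close>).

  An elliptic rotation fixes the axis pointwise, and a point of the surface on it (a pole of a
  round sphere) has \<open>r = 0\<close>, which is not attained by \<open>\<surd>C1 * dn\<close>. The formula therefore
  describes the surface without such points.\<close>

definition elliptic_representation ::
  "mink_space set \<Rightarrow> 'm::t2_space set \<Rightarrow> ('m \<Rightarrow> mink_space) \<Rightarrow>
   (real \<Rightarrow> real) \<Rightarrow> (real \<Rightarrow> real) \<Rightarrow> bool" where
  "elliptic_representation V M x r \<psi> \<longleftrightarrow>
     (\<exists>e J. orthonormal_basis e \<and> V = span {e 2, e 3} \<and>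
        open J \<and> is_interval J \<and> J \<noteq> {} \<and>
        parametrized_by M x {m \<in> M. x m \<notin> span {e 0, e 1}} J (elliptic_rot e r \<psi>))"

text \<open>A hyperbolic rotation translates the axis along itself, so a surface meeting the axis
  contains it (this occurs only for \<open>C = H\<close>). When the profile curve passes through \<open>r = 1\<close>, the
  smooth function whose absolute value is \<open>\<surd>(r\<^sup>2 - 1)\<close> changes sign, and from there on the
  formula holds with \<open>e 2\<close>, \<open>e 3\<close> negated. By continuity \<open>\<epsilon>\<close> is constant on intervals
  where \<open>r \<noteq> 1\<close>, and if the axis is not met at all no sign is needed.\<close>

definition hyperbolic_representation ::
  "mink_space set \<Rightarrow> 'm::t2_space set \<Rightarrow> ('m \<Rightarrow> mink_space) \<Rightarrow>
   (real \<Rightarrow> real) \<Rightarrow> (real \<Rightarrow> real) \<Rightarrow> bool" where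
  "hyperbolic_representation V M x r \<psi> \<longleftrightarrow>
     (\<exists>e J \<epsilon>. orthonormal_basis e \<and> V = span {e 0, e 1} \<and>
        open J \<and> is_interval J \<and> J \<noteq> {} \<and>
        (\<forall>t. \<epsilon> t = 1 \<or> \<epsilon> t = -1) \<and> ((\<forall>t\<in>J. r t \<noteq> 1) \<longrightarrow> (\<forall>t\<in>J. \<epsilon> t = 1)) \<and>
        parametrized_by M x M J (\<lambda>\<theta> t. hyperbolic_rot (flip23 (\<epsilon> t) e) r \<psi> \<theta> t))"

end

theory Submission
  imports Defs
begin

text \<open>Off the axis the surface is swept out by a profile curve \<open>(r, a, b)\<close> in a half-space. In the
  parameter with \<open>\<bar>F\<^sub>t\<bar> = r\<close> the patch is conformal, so constant mean curvature means
  \<open>\<Delta>F = 2 r\<^sup>2 F + 2 H r\<^sup>2 n\<close>, an ordinary differential equation for \<open>(a, b)\<close> with first integral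
  \<open>C = H r\<^sup>2 - (a b' - b a')\<close>. Then \<open>u = r\<^sup>2\<close> satisfies \<open>u'\<^sup>2 = - 4 u p\<^sub>C(u)\<close>, which is solved by
  \<open>C1 dn\<^sup>2\<close>, and the angle in the fixed plane satisfies \<open>\<psi>' = (H u - C) / (u + \<kappa>)\<close>. So every
  initial value is taken by an explicit solution defined on the whole real line, and by uniqueness
  the surface agrees with it near any point off the axis. Lifting this solution to \<open>M\<close> over a
  maximal interval sweeps out a set that is open and closed in the complement of the axis points;
  these are isolated, so the complement is connected and the lift covers it.\<close>

section \<open>Differentiable maps and charts\<close>

text \<open>Three obstacles shape the proof. \<open>cmc_surface\<close> supplies the normal point by
  point, so the profile equation first holds up to a sign that may depend on the parameter; the sign
  is written as a quotient of continuous functions, hence constant, and absorbed into the direction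
  of the curve. Two arcs through one point of \<open>M\<close> must then be shown to run the same
  way before they can be joined. Since \<open>x\<close> may have self-intersections, lifts to
  \<open>M\<close> are followed, compared through local injectivity of \<open>x\<close>. For
  \<kappa> = -1 the polynomial has the value (H - C)^2 at 1; as r >= 1, this forces C2 >= 1, with
  equality exactly for C = H, and then sqrt(r^2 - 1) is replaced by a smooth function that may
  change sign. The constant C reflects the symmetry of the equation under rotations of (a, b). It is
  read off from the data at one point and selects the explicit solution. Conformality at that point
  is u'^2 = -4 u p_C(u), so p_C(u) <= 0, which makes the roots real with u between them.\<close>

lemma Ck_on_2I:
  fixes f :: "real \<times> real \<Rightarrow> 'b::real_normed_vector"
  assumes "open U"
    and f: "\<And>z. z \<in> U \<Longrightarrow> (f has_derivative (\<lambda>h. fst h *\<^sub>R f1 z + snd h *\<^sub>R f2 z)) (at z)"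
    and f1: "\<And>z. z \<in> U \<Longrightarrow> (f1 has_derivative (\<lambda>h. fst h *\<^sub>R f11 z + snd h *\<^sub>R f12 z)) (at z)"
    and f2: "\<And>z. z \<in> U \<Longrightarrow> (f2 has_derivative (\<lambda>h. fst h *\<^sub>R f21 z + snd h *\<^sub>R f22 z)) (at z)"
    and cont: "continuous_on U f11" "continuous_on U f12" "continuous_on U f21" "continuous_on U f22"
  shows "Ck_on 2 U f"
    and "\<And>z a. z \<in> U \<Longrightarrow> frechet_derivative f (at z) a = fst a *\<^sub>R f1 z + snd a *\<^sub>R f2 z"
    and "\<And>z a b. z \<in> U \<Longrightarrow> frechet_derivative (\<lambda>w. frechet_derivative f (at w) a) (at z) b =
      fst a *\<^sub>R (fst b *\<^sub>R f11 z + snd b *\<^sub>R f12 z) + snd a *\<^sub>R (fst b *\<^sub>R f21 z + snd b *\<^sub>R f22 z)"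
proof -
  show D1: "frechet_derivative f (at z) a = fst a *\<^sub>R f1 z + snd a *\<^sub>R f2 z" if "z \<in> U" for z a
    using fun_cong[OF frechet_derivative_at[OF f[OF that]], of a] by simp
  have H2: "((\<lambda>w. frechet_derivative f (at w) a) has_derivative
      (\<lambda>b. fst a *\<^sub>R (fst b *\<^sub>R f11 z + snd b *\<^sub>R f12 z) + snd a *\<^sub>R (fst b *\<^sub>R f21 z + snd b *\<^sub>R f22 z)))
      (at z)" if "z \<in> U" for z a
  proof (rule has_derivative_transform_within_open[OF _ \<open>open U\<close> that])
    show "((\<lambda>w. fst a *\<^sub>R f1 w + snd a *\<^sub>R f2 w) has_derivative
      (\<lambda>b. fst a *\<^sub>R (fst b *\<^sub>R f11 z + snd b *\<^sub>R f12 z) + snd a *\<^sub>R (fst b *\<^sub>R f21 z + snd b *\<^sub>R f22 z)))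
      (at z)"
      using f1[OF that] f2[OF that] by (auto intro!: derivative_eq_intros)
  qed (simp add: D1)
  show D2: "frechet_derivative (\<lambda>w. frechet_derivative f (at w) a) (at z) b =
      fst a *\<^sub>R (fst b *\<^sub>R f11 z + snd b *\<^sub>R f12 z) + snd a *\<^sub>R (fst b *\<^sub>R f21 z + snd b *\<^sub>R f22 z)"
    if "z \<in> U" for z a b
    using fun_cong[OF frechet_derivative_at[OF H2[OF that]], of a b] by simp
  have "f differentiable_on U"
    unfolding differentiable_on_def differentiable_def using has_derivative_at_withinI[OF f] by blast
  moreover have "(\<lambda>w. frechet_derivative f (at w) a) differentiable_on U" for a
    unfolding differentiable_on_def differentiable_def using has_derivative_at_withinI[OF H2] by blast
  moreover have "continuous_on U (\<lambda>z. frechet_derivative (\<lambda>w. frechet_derivative f (at w) a) (at z) b)" for a b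
    by (subst continuous_on_cong[OF refl D2]) (auto intro!: continuous_intros cont)
  ultimately show "Ck_on 2 U f"
    by (simp add: numeral_2_eq_2)
qed

lemma Ck_on_2D:
  fixes f :: "real \<times> real \<Rightarrow> 'b::real_normed_vector"
  assumes "open U" "Ck_on 2 U f"
  shows "\<And>z. z \<in> U \<Longrightarrow> (f has_derivative frechet_derivative f (at z)) (at z)"
    and "\<And>z a. z \<in> U \<Longrightarrow> ((\<lambda>w. frechet_derivative f (at w) a) has_derivative
          frechet_derivative (\<lambda>w. frechet_derivative f (at w) a) (at z)) (at z)"
    and "\<And>a. continuous_on U (\<lambda>w. frechet_derivative f (at w) a)"
    and "\<And>a b. continuous_on U (\<lambda>z. frechet_derivative (\<lambda>w. frechet_derivative f (at w) a) (at z) b)"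
proof -
  have d: "f differentiable_on U" "\<And>a. (\<lambda>w. frechet_derivative f (at w) a) differentiable_on U"
    "\<And>a b. continuous_on U (\<lambda>z. frechet_derivative (\<lambda>w. frechet_derivative f (at w) a) (at z) b)"
    using assms(2) unfolding numeral_2_eq_2 Ck_on.simps by blast+
  show "\<And>z. z \<in> U \<Longrightarrow> (f has_derivative frechet_derivative f (at z)) (at z)"
    using d(1) assms(1) by (simp add: differentiable_on_eq_differentiable_at frechet_derivative_works)
  show "\<And>z a. z \<in> U \<Longrightarrow> ((\<lambda>w. frechet_derivative f (at w) a) has_derivative
          frechet_derivative (\<lambda>w. frechet_derivative f (at w) a) (at z)) (at z)"
    using d(2) assms(1) by (simp add: differentiable_on_eq_differentiable_at frechet_derivative_works)
  show "\<And>a. continuous_on U (\<lambda>w. frechet_derivative f (at w) a)"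
    using d(2) differentiable_imp_continuous_on by blast
  show "\<And>a b. continuous_on U (\<lambda>z. frechet_derivative (\<lambda>w. frechet_derivative f (at w) a) (at z) b)"
    by (rule d(3))
qed

lemma linear_prod_expand:
  fixes f :: "real \<times> real \<Rightarrow> 'b::real_vector"
  assumes "linear f"
  shows "f h = fst h *\<^sub>R f (1, 0) + snd h *\<^sub>R f (0, 1)"
proof -
  have "h = fst h *\<^sub>R (1, 0) + snd h *\<^sub>R (0, 1)" by (simp add: prod_eq_iff)
  then have "f h = f (fst h *\<^sub>R (1, 0) + snd h *\<^sub>R (0, 1))" by (rule arg_cong)
  then show ?thesis
    by (simp only: linear_add[OF assms] linear_scale[OF assms])
qed

text \<open>\<open>Ck_on\<close> gives continuity of each directional derivative. The two coordinate
  directions bound the operator norm of a difference of derivatives, and this yields the continuity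
  that \<open>has_derivative_locally_injective\<close> asks for, with a left inverse of the
  injective derivative at \<open>z\<close>.\<close>

lemma immersion_locally_inj:
  assumes "open U" "immersion_on U f" "z \<in> U"
  obtains r where "r > 0" "ball z r \<subseteq> U" "inj_on f (ball z r)"
proof -
  let ?D = "\<lambda>z. frechet_derivative f (at z)"
  note C = Ck_on_2D[OF \<open>open U\<close>, of f]
  have ck: "Ck_on 2 U f" and "inj (?D z)"
    using assms by (auto simp: immersion_on_def)
  have lin: "linear (?D w)" if "w \<in> U" for w
    using C(1)[OF ck that] has_derivative_linear by blast
  obtain L where L: "linear L" "L \<circ> ?D z = id"
    using linear_injective_left_inverse[OF lin[OF \<open>z \<in> U\<close>] \<open>inj (?D z)\<close>] by blast
  have small: "\<exists>d>0. \<forall>w. dist z w < d \<longrightarrow> onorm (\<lambda>v. ?D w v - ?D z v) < e" if "e > 0" for e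
  proof -
    have "isCont (\<lambda>w. ?D w a) z" for a
      using C(3)[OF ck] assms by (metis continuous_on_eq_continuous_at)
    then have "((\<lambda>w. norm (?D w (1,0) - ?D z (1,0)) + norm (?D w (0,1) - ?D z (0,1))) \<longlongrightarrow> 0) (at z)"
      by (auto intro!: tendsto_eq_intros simp: isCont_def)
    then have "\<forall>\<^sub>F w in at z. norm (?D w (1,0) - ?D z (1,0)) + norm (?D w (0,1) - ?D z (0,1)) < e"
      using that by (simp add: order_tendstoD(2))
    moreover have "\<forall>\<^sub>F w in at z. w \<in> U"
      using assms eventually_at_in_open' by blast
    ultimately have "\<forall>\<^sub>F w in at z. w \<in> U \<and> norm (?D w (1,0) - ?D z (1,0)) + norm (?D w (0,1) - ?D z (0,1)) < e"
      by eventually_elim auto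
    then obtain d where "d > 0" and d: "\<And>w. w \<noteq> z \<Longrightarrow> dist w z < d \<Longrightarrow>
        w \<in> U \<and> norm (?D w (1,0) - ?D z (1,0)) + norm (?D w (0,1) - ?D z (0,1)) < e"
      unfolding eventually_at by blast
    have "onorm (\<lambda>v. ?D w v - ?D z v) < e" if "dist z w < d" for w
    proof (cases "w = z")
      case True
      then show ?thesis using \<open>e > 0\<close> by (simp add: onorm_zero)
    next
      case False
      then have w: "w \<in> U" "norm (?D w (1,0) - ?D z (1,0)) + norm (?D w (0,1) - ?D z (0,1)) < e"
        using d that by (auto simp: dist_commute)
      have "onorm (\<lambda>v. ?D w v - ?D z v) \<le> norm (?D w (1,0) - ?D z (1,0)) + norm (?D w (0,1) - ?D z (0,1))"
      proof (rule onorm_le)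
        fix v :: "real \<times> real"
        have "?D w v - ?D z v = fst v *\<^sub>R (?D w (1,0) - ?D z (1,0)) + snd v *\<^sub>R (?D w (0,1) - ?D z (0,1))"
          using linear_prod_expand[OF lin[OF w(1)], of v] linear_prod_expand[OF lin[OF \<open>z \<in> U\<close>], of v]
          by (simp add: algebra_simps)
        then have "norm (?D w v - ?D z v) \<le>
            \<bar>fst v\<bar> * norm (?D w (1,0) - ?D z (1,0)) + \<bar>snd v\<bar> * norm (?D w (0,1) - ?D z (0,1))"
          by (metis norm_scaleR norm_triangle_ineq)
        also have "\<dots> \<le> norm v * norm (?D w (1,0) - ?D z (1,0)) + norm v * norm (?D w (0,1) - ?D z (0,1))"
          using norm_fst_le[of "fst v" "snd v"] norm_snd_le[of "snd v" "fst v"] by (intro add_mono mult_right_mono) auto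
        finally show "norm (?D w v - ?D z v) \<le>
            (norm (?D w (1,0) - ?D z (1,0)) + norm (?D w (0,1) - ?D z (0,1))) * norm v"
          by (simp add: algebra_simps)
      qed
      then show ?thesis using w by simp
    qed
    then show ?thesis using \<open>d > 0\<close> by blast
  qed
  show ?thesis
  proof (rule has_derivative_locally_injective[where f' = ?D and f = f, OF \<open>z \<in> U\<close> \<open>open U\<close> _ L(2)])
    show "bounded_linear L" using L(1) linear_conv_bounded_linear by blast
  qed (use C(1)[OF ck] small that in auto)
qed

text \<open>Applying the left inverse \<open>L\<close> to the expansion of \<open>f\<close> along
  \<zeta> gives \<zeta> h - \<zeta> t up to an error that is small relative to \<zeta> h - \<zeta> t
  itself. Absorbing this error makes \<zeta> Lipschitz at \<open>t\<close>, and inserting the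
  Lipschitz bound a second time gives the derivative. The lemma differentiates curves that are known
  only as continuous curves in a chart or as a change of parameter.\<close>

lemma lift_has_vector_derivative:
  fixes f :: "'a::real_normed_vector \<Rightarrow> 'b::real_normed_vector" and \<zeta> :: "real \<Rightarrow> 'a"
  assumes f: "(f has_derivative D) (at (\<zeta> t))"
    and L: "bounded_linear L" "\<And>v. L (D v) = v"
    and c: "isCont \<zeta> t"
    and d: "((\<lambda>h. f (\<zeta> h)) has_vector_derivative w) (at t)"
  shows "(\<zeta> has_vector_derivative L w) (at t)"
proof -
  interpret L: bounded_linear L by fact
  obtain K where K: "K > 0" "\<And>v. norm (L v) \<le> norm v * K" using L.pos_bounded by blast
  define R where "R y = L (f y - f (\<zeta> t)) - (y - \<zeta> t)" for y
  have R: "norm (R y) \<le> K * norm (f y - f (\<zeta> t) - D (y - \<zeta> t))" for y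
  proof -
    have "R y = L (f y - f (\<zeta> t) - D (y - \<zeta> t))"
      unfolding R_def by (simp add: L.diff L(2))
    then show ?thesis using K(2)[of "f y - f (\<zeta> t) - D (y - \<zeta> t)"] by (simp add: mult.commute)
  qed
  have small: "\<forall>\<^sub>F h in at t. norm (R (\<zeta> h)) \<le> e * norm (\<zeta> h - \<zeta> t)" if "e > 0" for e
  proof -
    have "e / K > 0" using that K by simp
    then obtain \<delta> where \<delta>: "\<delta> > 0" "\<And>y. norm (y - \<zeta> t) < \<delta> \<Longrightarrow>
        norm (f y - f (\<zeta> t) - D (y - \<zeta> t)) \<le> e / K * norm (y - \<zeta> t)"
      using f unfolding has_derivative_at_alt by blast
    have "\<forall>\<^sub>F h in at t. dist (\<zeta> h) (\<zeta> t) < \<delta>"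
      using c \<delta>(1) by (simp add: isCont_def tendsto_iff)
    then show ?thesis
    proof eventually_elim
      case (elim h)
      have "norm (R (\<zeta> h)) \<le> K * norm (f (\<zeta> h) - f (\<zeta> t) - D (\<zeta> h - \<zeta> t))" by (rule R)
      also have "\<dots> \<le> K * (e / K * norm (\<zeta> h - \<zeta> t))"
        using \<delta>(2)[of "\<zeta> h"] elim K(1) by (intro mult_left_mono) (auto simp: dist_norm)
      finally show ?case using K(1) by simp
    qed
  qed
  have Lf: "((\<lambda>h. L (f (\<zeta> h))) has_derivative (\<lambda>h. h *\<^sub>R L w)) (at t)"
    using L.has_vector_derivative[OF d] by (simp add: has_vector_derivative_def)
  show ?thesis
    unfolding has_vector_derivative_def has_derivative_at_alt
  proof (intro conjI allI impI)
    show "bounded_linear (\<lambda>h. h *\<^sub>R L w)" by (rule bounded_linear_scaleR_left)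
    fix e :: real assume "e > 0"
    \<comment> \<open>\<open>e1\<close> <= 1 serves the Lipschitz bound and \<open>e1\<close> <= e /
      2 the final estimate. \<open>e2\<close> <= 1 / 2 allows the remainder to be absorbed, and its
      second bound turns the remainder into at most e / 2 times \<open>norm (h - t)\<close>.\<close>
    define e1 where "e1 = min (e / 2) 1"
    define e2 where "e2 = min (1 / 2) (e / (4 * (norm (L w) + 1)))"
    have pos: "norm (L w) + 1 > 0" by (simp add: add_nonneg_pos)
    have e2h: "e2 \<le> 1 / 2" and e1h: "e1 \<le> e / 2" by (simp_all only: e1_def e2_def min.cobounded1)
    have e12: "e1 > 0" "e2 > 0" using \<open>e > 0\<close> pos by (auto simp: e1_def e2_def)
    obtain d1 where d1: "d1 > 0" "\<And>h. norm (h - t) < d1 \<Longrightarrow>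
        norm (L (f (\<zeta> h)) - L (f (\<zeta> t)) - (h - t) *\<^sub>R L w) \<le> e1 * norm (h - t)"
      using Lf e12(1) unfolding has_derivative_at_alt by blast
    obtain d2 where d2: "d2 > 0" "\<And>h. h \<noteq> t \<Longrightarrow> dist h t < d2 \<Longrightarrow>
        norm (R (\<zeta> h)) \<le> e2 * norm (\<zeta> h - \<zeta> t)"
      using small[OF e12(2)] unfolding eventually_at by blast
    have "norm (\<zeta> h - \<zeta> t - (h - t) *\<^sub>R L w) \<le> e * norm (h - t)" if h: "norm (h - t) < min d1 d2" for h
    proof (cases "h = t")
      case False
      define A where "A = L (f (\<zeta> h)) - L (f (\<zeta> t))"
      have A: "norm (A - (h - t) *\<^sub>R L w) \<le> e1 * norm (h - t)"
        using d1(2)[of h] h by (simp add: A_def)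
      have Aeq: "A = \<zeta> h - \<zeta> t + R (\<zeta> h)" by (simp add: A_def R_def L.diff)
      have Rb: "norm (R (\<zeta> h)) \<le> e2 * norm (\<zeta> h - \<zeta> t)"
        using d2(2)[of h] h False by (simp add: dist_norm)
      also have "\<dots> \<le> 1 / 2 * norm (\<zeta> h - \<zeta> t)" by (rule mult_right_mono[OF e2h norm_ge_zero])
      finally have "norm (\<zeta> h - \<zeta> t) \<le> 2 * norm A"
        using norm_triangle_ineq2[of "\<zeta> h - \<zeta> t" "- R (\<zeta> h)"] by (simp add: Aeq)
      also have "norm A \<le> norm (A - (h - t) *\<^sub>R L w) + norm ((h - t) *\<^sub>R L w)"
        using norm_triangle_ineq[of "A - (h - t) *\<^sub>R L w" "(h - t) *\<^sub>R L w"] by simp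
      also have "\<dots> \<le> 1 * norm (h - t) + norm (L w) * norm (h - t)"
        using A mult_right_mono[of e1 1 "norm (h - t)"] by (simp add: e1_def mult.commute)
      finally have \<zeta>b: "norm (\<zeta> h - \<zeta> t) \<le> 2 * ((norm (L w) + 1) * norm (h - t))"
        by (simp add: algebra_simps)
      have "norm (R (\<zeta> h)) \<le> e2 * (2 * ((norm (L w) + 1) * norm (h - t)))"
        using Rb \<zeta>b e12(2) by (meson mult_left_mono order_trans less_imp_le)
      also have "\<dots> \<le> e / (4 * (norm (L w) + 1)) * (2 * ((norm (L w) + 1) * norm (h - t)))"
        using pos by (intro mult_right_mono) (auto simp: e2_def)
      also have "\<dots> = e / 2 * norm (h - t)" using pos by (simp add: field_simps)
      finally have R2: "norm (R (\<zeta> h)) \<le> e / 2 * norm (h - t)" .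
      have "\<zeta> h - \<zeta> t - (h - t) *\<^sub>R L w = (A - (h - t) *\<^sub>R L w) - R (\<zeta> h)"
        by (simp add: Aeq)
      then have "norm (\<zeta> h - \<zeta> t - (h - t) *\<^sub>R L w) \<le> norm (A - (h - t) *\<^sub>R L w) + norm (R (\<zeta> h))"
        by (metis norm_triangle_ineq4)
      also have "\<dots> \<le> e / 2 * norm (h - t) + e / 2 * norm (h - t)"
        using A R2 mult_right_mono[OF e1h, of "norm (h - t)"] by (intro add_mono) (auto intro: order_trans)
      finally show ?thesis by (simp add: algebra_simps)
    qed simp
    then show "\<exists>d>0. \<forall>y. norm (y - t) < d \<longrightarrow> norm (\<zeta> y - \<zeta> t - (y - t) *\<^sub>R L w) \<le> e * norm (y - t)"
      using d1(1) d2(1) by (intro exI[of _ "min d1 d2"]) simp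
  qed
qed

section \<open>Lifts to an immersed surface\<close>

lemma immersed_surface_chart:
  assumes "immersed_surface M x" "m \<in> M"
  obtains U q g where "local_param M x U q" "m \<in> q ` U" "homeomorphism U (q ` U) q g" "open U"
    "immersion_on U (x \<circ> q)" "openin (top_of_set M) (q ` U)"
  using assms unfolding immersed_surface_def local_param_def by metis

lemma immersed_surface_locally_inj:
  assumes "immersed_surface M x" "m \<in> M"
  obtains N where "openin (top_of_set M) N" "m \<in> N" "inj_on x N"
proof -
  obtain U q g where c: "local_param M x U q" "m \<in> q ` U" "homeomorphism U (q ` U) q g" "open U"
    "immersion_on U (x \<circ> q)" "openin (top_of_set M) (q ` U)"
    by (rule immersed_surface_chart[OF assms])
  then obtain z where z: "z \<in> U" "m = q z" by blast
  obtain r where r: "r > 0" "ball z r \<subseteq> U" "inj_on (x \<circ> q) (ball z r)"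
    by (rule immersion_locally_inj[OF c(4,5) z(1)])
  show ?thesis
  proof
    have "openin (top_of_set U) (ball z r)" using r(2) by (simp add: open_subset)
    then show "openin (top_of_set M) (q ` ball z r)"
      using homeomorphism_imp_open_map[OF c(3)] c(6) openin_trans by blast
    show "m \<in> q ` ball z r" using z r(1) by simp
    show "inj_on x (q ` ball z r)" using r(3) by (rule inj_on_imageI)
  qed
qed

lemma immersion_on_subset:
  assumes "immersion_on U f" "W \<subseteq> U"
  shows "immersion_on W f"
proof -
  have "Ck_on k W g" if "Ck_on k U g" for k and g :: "real \<times> real \<Rightarrow> mink_space"
    using that
  proof (induction k arbitrary: g)
    case 0
    then show ?case using assms(2) by (auto intro: continuous_on_subset)
  next
    case (Suc k)
    then show ?case using assms(2) by (auto intro: differentiable_on_subset)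
  qed
  then show ?thesis using assms unfolding immersion_on_def by blast
qed

text \<open>Since \<open>x \<circ> Q\<close> is locally injective, so is \<open>Q\<close>. Read in a
  chart of \<open>M\<close> it is a continuous injection between open subsets of the plane, and
  invariance of domain makes it a homeomorphism onto an open set. In this way the maps swept out by
  a profile curve become charts to which \<open>cmc_surface\<close> applies.\<close>

lemma local_param_of_lift:
  fixes M :: "'m::t2_space set"
  assumes M: "immersed_surface M x" and W: "open W" and Q: "continuous_on W Q" "Q ` W \<subseteq> M"
    and im: "immersion_on W (x \<circ> Q)" and z: "z \<in> W"
  obtains U where "z \<in> U" "U \<subseteq> W" "local_param M x U Q"
proof -
  have "Q z \<in> M" using Q z by blast
  then obtain U1 q g where c: "local_param M x U1 q" "Q z \<in> q ` U1" "homeomorphism U1 (q ` U1) q g" "open U1"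
    "immersion_on U1 (x \<circ> q)" "openin (top_of_set M) (q ` U1)"
    using immersed_surface_chart[OF M] by metis
  have "openin (top_of_set W) (W \<inter> Q -` (q ` U1))"
    using continuous_openin_preimage[OF Q(1) _ c(6)] Q(2) by blast
  then have oW: "open (W \<inter> Q -` (q ` U1))" using W openin_open_trans by blast
  have im2: "immersion_on (W \<inter> Q -` (q ` U1)) (x \<circ> Q)"
    using im by (rule immersion_on_subset) blast
  obtain r where r: "r > 0" "ball z r \<subseteq> W \<inter> Q -` (q ` U1)" "inj_on (x \<circ> Q) (ball z r)"
    by (rule immersion_locally_inj[OF oW im2]) (use z c(2) in auto)
  define B where "B = ball z r"
  have B: "open B" "z \<in> B" "B \<subseteq> W" "Q ` B \<subseteq> q ` U1" "inj_on Q B"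
    using r inj_on_imageI2[of x Q] by (auto simp: B_def)
  have gq: "\<And>u. u \<in> U1 \<Longrightarrow> g (q u) = u" "\<And>y. y \<in> q ` U1 \<Longrightarrow> q (g y) = y" "g ` q ` U1 = U1"
    "continuous_on (q ` U1) g"
    using c(3) by (auto simp: homeomorphism_def)
  have gi: "inj_on g (q ` U1)" by (metis gq(2) inj_on_inverseI)
  define h where "h = g \<circ> Q"
  have hc: "continuous_on B h"
    unfolding h_def using Q(1) B gq(4) by (meson continuous_on_compose continuous_on_subset)
  have hi: "inj_on h B"
    unfolding h_def using B gi by (meson comp_inj_on inj_on_subset)
  obtain hi' where H: "homeomorphism B (h ` B) h hi'"
    using invariance_of_domain_homeomorphism[OF B(1) hc _ hi] by auto
  have oh: "open (h ` B)" using invariance_of_domain[OF hc B(1) hi] .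
  have hU: "h ` B \<subseteq> U1" using B(4) gq(3) by (auto simp: h_def)
  have qh: "q (h v) = Q v" if "v \<in> B" for v
    using that B(4) gq(2) by (auto simp: h_def)
  have "homeomorphism (h ` B) (q ` h ` B) q g"
    using homeomorphism_of_subsets[OF c(3) hU _ refl] hU by blast
  then have "homeomorphism B (q ` h ` B) (q \<circ> h) (hi' \<circ> g)"
    using homeomorphism_compose[OF H] by blast
  moreover have QB: "q ` h ` B = Q ` B" using qh by (simp add: image_image cong: image_cong)
  ultimately have hom: "homeomorphism B (Q ` B) Q (hi' \<circ> g)"
    using qh by (auto simp: homeomorphism_def)
  have "openin (top_of_set U1) (h ` B)" using oh hU by (simp add: open_subset)
  then have "openin (top_of_set M) (q ` h ` B)"
    using homeomorphism_imp_open_map[OF c(3)] c(6) openin_trans by blast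
  then have "openin (top_of_set M) (Q ` B)"
    by (simp only: QB)
  moreover have "immersion_on B (x \<circ> Q)"
    using im B(3) by (rule immersion_on_subset)
  ultimately have "local_param M x B Q"
    using B(1) hom unfolding local_param_def by blast
  then show ?thesis using that B by blast
qed

text \<open>The set where the two lifts agree is closed because \<open>M\<close> is Hausdorff, and
  open because \<open>x\<close> is injective near a common point.\<close>

lemma lift_unique:
  fixes M :: "'m::t2_space set" and J :: "'a::topological_space set"
  assumes M: "immersed_surface M x" and J: "connected J"
    and c: "continuous_on J \<gamma>1" "continuous_on J \<gamma>2"
    and im: "\<gamma>1 ` J \<subseteq> M" "\<gamma>2 ` J \<subseteq> M"
    and eq: "\<And>t. t \<in> J \<Longrightarrow> x (\<gamma>1 t) = x (\<gamma>2 t)"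
    and t0: "t0 \<in> J" "\<gamma>1 t0 = \<gamma>2 t0" and t: "t \<in> J"
  shows "\<gamma>1 t = \<gamma>2 t"
proof -
  define E where "E = {t \<in> J. \<gamma>1 t = \<gamma>2 t}"
  have im1: "\<gamma>1 \<in> J \<rightarrow> M" and im2: "\<gamma>2 \<in> J \<rightarrow> M" using im by auto
  have "closedin (top_of_set J) E"
    unfolding closedin_def
  proof (intro conjI)
    show "E \<subseteq> topspace (top_of_set J)" by (auto simp: E_def)
    show "openin (top_of_set J) (topspace (top_of_set J) - E)"
    proof (subst openin_subopen, intro ballI)
      fix s assume s: "s \<in> topspace (top_of_set J) - E"
      then have "\<gamma>1 s \<noteq> \<gamma>2 s" "s \<in> J" by (auto simp: E_def)
      then obtain A B where AB: "open A" "open B" "\<gamma>1 s \<in> A" "\<gamma>2 s \<in> B" "A \<inter> B = {}"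
        using hausdorff[of "\<gamma>1 s" "\<gamma>2 s"] by auto
      have "openin (top_of_set J) ((J \<inter> \<gamma>1 -` A) \<inter> (J \<inter> \<gamma>2 -` B))"
        using c AB by (intro openin_Int continuous_openin_preimage_gen)
      then show "\<exists>T. openin (top_of_set J) T \<and> s \<in> T \<and> T \<subseteq> topspace (top_of_set J) - E"
        using AB \<open>s \<in> J\<close>
        by (intro exI[of _ "(J \<inter> \<gamma>1 -` A) \<inter> (J \<inter> \<gamma>2 -` B)"] conjI) (auto simp: E_def)
    qed
  qed
  moreover have "openin (top_of_set J) E"
  proof (subst openin_subopen, intro ballI)
    fix s assume s: "s \<in> E"
    then have s': "s \<in> J" "\<gamma>1 s = \<gamma>2 s" by (auto simp: E_def)
    have "\<gamma>1 s \<in> M" using im(1) s'(1) by blast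
    then obtain N where N: "openin (top_of_set M) N" "\<gamma>1 s \<in> N" "inj_on x N"
      by (rule immersed_surface_locally_inj[OF M])
    have "openin (top_of_set J) ((J \<inter> \<gamma>1 -` N) \<inter> (J \<inter> \<gamma>2 -` N))"
      by (rule openin_Int[OF continuous_openin_preimage[OF c(1) im1 N(1)]
            continuous_openin_preimage[OF c(2) im2 N(1)]])
    moreover have "s \<in> (J \<inter> \<gamma>1 -` N) \<inter> (J \<inter> \<gamma>2 -` N)" using N s' by simp
    moreover have "(J \<inter> \<gamma>1 -` N) \<inter> (J \<inter> \<gamma>2 -` N) \<subseteq> E"
    proof
      fix r assume "r \<in> (J \<inter> \<gamma>1 -` N) \<inter> (J \<inter> \<gamma>2 -` N)"
      then have r: "r \<in> J" "\<gamma>1 r \<in> N" "\<gamma>2 r \<in> N" by auto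
      then show "r \<in> E" using inj_onD[OF N(3) eq[OF r(1)] r(2,3)] by (simp add: E_def)
    qed
    ultimately show "\<exists>T. openin (top_of_set J) T \<and> s \<in> T \<and> T \<subseteq> E" by blast
  qed
  ultimately have "E = {} \<or> E = J" using J unfolding connected_clopen by blast
  moreover have "t0 \<in> E" using t0 by (simp add: E_def)
  ultimately have "t \<in> E" using t by blast
  then show ?thesis by (simp add: E_def)
qed

section \<open>Jacobi elliptic functions\<close>

lemma interval_integral_has_real_derivative:
  fixes f :: "real \<Rightarrow> real"
  assumes "continuous_on {-r..r} f" "\<bar>x\<bar> < r"
  shows "((\<lambda>u. LBINT y=ereal 0..ereal u. f y) has_real_derivative f x) (at x)"
proof -
  have "((\<lambda>u. LBINT y=ereal 0..ereal u. f y) has_vector_derivative f x) (at x within {-r..r})"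
    by (rule interval_integral_FTC2) (use assms in auto)
  moreover have "at x within {-r..r} = at x" using assms(2) by (intro at_within_Icc_at) auto
  ultimately show ?thesis by (simp add: has_real_derivative_iff_has_vector_derivative)
qed

text \<open>The values that the amplitude may take. It matches the side condition in
  \<open>jacobi_am\<close>, so that the radicand of the integral of the first kind is positive on it
  for \<open>p = 1\<close> as well.\<close>

definition am_range :: "real \<Rightarrow> real set" where
  "am_range p = {\<phi>. p = 1 \<longrightarrow> \<bar>\<phi>\<bar> < pi / 2}"

definition jacobi_cn :: "real \<Rightarrow> real \<Rightarrow> real" where
  "jacobi_cn p u = cos (jacobi_am p u)"

lemma ellint_radicand_pos:
  assumes "0 \<le> p" "p \<le> 1" "\<phi> \<in> am_range p"
  shows "1 - p\<^sup>2 * (sin \<phi>)\<^sup>2 > 0"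
proof (cases "p = 1")
  case True
  then have "cos \<phi> > 0" using assms(3) by (intro cos_gt_zero_pi) (auto simp: am_range_def)
  then show ?thesis using True by (simp add: sin_squared_eq)
next
  case False
  then have "p\<^sup>2 < 1" using assms by (simp add: power_less_one_iff abs_square_less_1)
  moreover have "p\<^sup>2 * (sin \<phi>)\<^sup>2 \<le> p\<^sup>2 * 1" by (intro mult_left_mono) (auto simp: abs_square_le_1)
  ultimately show ?thesis by simp
qed

lemma ellint_F_deriv:
  assumes "0 \<le> p" "p \<le> 1" "\<phi> \<in> am_range p"
  shows "(ellint_F p has_real_derivative 1 / sqrt (1 - p\<^sup>2 * (sin \<phi>)\<^sup>2)) (at \<phi>)"
proof -
  \<comment> \<open>For \<open>p = 1\<close> the midpoint between the absolute value of \<phi> and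
    pi / 2 keeps the whole closed interval away from the singularity.\<close>
  define r where "r = (if p = 1 then (\<bar>\<phi>\<bar> + pi / 2) / 2 else \<bar>\<phi>\<bar> + 1)"
  have r: "\<bar>\<phi>\<bar> < r" "p = 1 \<Longrightarrow> r < pi / 2" using assms(3) by (auto simp: r_def am_range_def)
  then have rs: "{-r..r} \<subseteq> am_range p" by (auto simp: am_range_def)
  have "1 - p\<^sup>2 * (sin \<alpha>)\<^sup>2 > 0" if "\<alpha> \<in> {-r..r}" for \<alpha>
    using ellint_radicand_pos assms(1,2) rs that by blast
  then have "continuous_on {-r..r} (\<lambda>\<alpha>. 1 / sqrt (1 - p\<^sup>2 * (sin \<alpha>)\<^sup>2))"
    by (intro continuous_intros) force
  from interval_integral_has_real_derivative[OF this r(1)] show ?thesis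
    unfolding ellint_F_def[abs_def] .
qed

lemma ellint_F_0: "ellint_F p 0 = 0"
  by (simp add: ellint_F_def)

text \<open>For modulus 1 the integrand is 1 / cos, and its primitive is the inverse Gudermannian
  function. The closed form supplies surjectivity in the degenerate case.\<close>

lemma ellint_F_1:
  assumes "\<bar>\<phi>\<bar> < pi / 2"
  shows "ellint_F 1 \<phi> = arsinh (tan \<phi>)"
proof -
  let ?h = "\<lambda>\<phi>. ellint_F 1 \<phi> - arsinh (tan \<phi>)"
  have d: "(?h has_real_derivative 0) (at \<alpha>)" if "\<bar>\<alpha>\<bar> < pi / 2" for \<alpha>
  proof -
    have c: "cos \<alpha> > 0" using that by (intro cos_gt_zero_pi) auto
    have "(tan has_real_derivative inverse ((cos \<alpha>)\<^sup>2)) (at \<alpha>)" using c by (intro DERIV_tan) simp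
    from arsinh_real_has_field_derivative[THEN DERIV_chain2, OF this]
    have "((\<lambda>\<phi>. arsinh (tan \<phi>)) has_real_derivative
        1 / sqrt ((tan \<alpha>)\<^sup>2 + 1) * inverse ((cos \<alpha>)\<^sup>2)) (at \<alpha>)" by simp
    moreover have "(tan \<alpha>)\<^sup>2 + 1 = (1 / cos \<alpha>)\<^sup>2"
      using c sin_cos_squared_add[of \<alpha>] by (simp add: tan_def field_simps)
    then have "sqrt ((tan \<alpha>)\<^sup>2 + 1) = 1 / cos \<alpha>" using c by (simp only: real_sqrt_abs) simp
    then have "1 / sqrt ((tan \<alpha>)\<^sup>2 + 1) * inverse ((cos \<alpha>)\<^sup>2) = 1 / cos \<alpha>"
      using c by (simp add: field_simps power2_eq_square)
    moreover have "sqrt (1 - 1\<^sup>2 * (sin \<alpha>)\<^sup>2) = cos \<alpha>" using c by (simp add: sin_squared_eq)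
    ultimately show ?thesis
      using ellint_F_deriv[of 1 \<alpha>] that DERIV_diff by (fastforce simp: am_range_def)
  qed
  have "?h \<phi> = ?h 0"
  proof (rule DERIV_isconst3[where a = "-(pi/2)" and b = "pi/2" and f = ?h])
    show "(?h has_real_derivative 0) (at y)" if "y \<in> {-(pi/2)<..<pi/2}" for y
      using d[of y] that by auto
  qed (use assms in auto)
  then show ?thesis by (simp add: ellint_F_0)
qed

lemma ellint_F_strict_mono:
  assumes p: "0 \<le> p" "p \<le> 1" and "\<alpha> \<in> am_range p" "\<beta> \<in> am_range p" "\<alpha> < \<beta>"
  shows "ellint_F p \<alpha> < ellint_F p \<beta>"
proof (rule DERIV_pos_imp_increasing[OF \<open>\<alpha> < \<beta>\<close>])
  fix y assume "\<alpha> \<le> y" "y \<le> \<beta>"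
  then have "y \<in> am_range p" using assms by (auto simp: am_range_def)
  then show "\<exists>d. (ellint_F p has_real_derivative d) (at y) \<and> d > 0"
    using ellint_F_deriv[OF p] ellint_radicand_pos[OF p] by (intro exI conjI) auto
qed

text \<open>For \<open>p = 1\<close> the preimage of \<open>u\<close> is its Gudermannian
  arctan(sinh u). Otherwise the integrand is at least 1, so the integral grows at least as fast as
  the identity and the intermediate value theorem applies between 0 and \<open>u\<close>.\<close>

lemma ellint_F_surj:
  assumes p: "0 \<le> p" "p \<le> 1"
  obtains \<phi> where "\<phi> \<in> am_range p" "ellint_F p \<phi> = u"
proof (cases "p = 1")
  case True
  have "\<bar>arctan (sinh u)\<bar> < pi / 2" using arctan_bounded[of "sinh u"] by auto
  then show ?thesis
    using that[of "arctan (sinh u)"] True by (simp add: am_range_def ellint_F_1 tan_arctan arsinh_sinh_real)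
next
  case False
  then have R: "am_range p = UNIV" by (simp add: am_range_def)
  have c: "isCont (ellint_F p) y" for y
    using ellint_F_deriv[OF p, of y] R DERIV_isCont by auto
  let ?g = "\<lambda>\<phi>. ellint_F p \<phi> - \<phi>"
  have mono: "?g a \<le> ?g b" if "a \<le> b" for a b
  proof (rule DERIV_nonneg_imp_nondecreasing[OF that])
    fix y
    have "sqrt (1 - p\<^sup>2 * (sin y)\<^sup>2) \<le> 1" by (simp add: real_le_lsqrt)
    moreover have "0 < sqrt (1 - p\<^sup>2 * (sin y)\<^sup>2)"
      using ellint_radicand_pos[OF p, of y] R by simp
    ultimately have "1 / sqrt (1 - p\<^sup>2 * (sin y)\<^sup>2) - 1 \<ge> 0" by (simp add: field_simps)
    then show "\<exists>d. (?g has_real_derivative d) (at y) \<and> d \<ge> 0"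
      using DERIV_diff[OF ellint_F_deriv[OF p, of y] DERIV_ident] R by auto
  qed
  show ?thesis
  proof (cases "u \<ge> 0")
    case True
    have "\<exists>\<phi>\<ge>0. \<phi> \<le> u \<and> ellint_F p \<phi> = u"
      by (rule IVT) (use True mono[of 0 u] c in \<open>auto simp: ellint_F_0\<close>)
    then show ?thesis using that R by auto
  next
    case False
    have "\<exists>\<phi>\<ge>u. \<phi> \<le> 0 \<and> ellint_F p \<phi> = u"
      by (rule IVT) (use False mono[of u 0] c in \<open>auto simp: ellint_F_0\<close>)
    then show ?thesis using that R by auto
  qed
qed

lemma jacobi_am_unique:
  assumes p: "0 \<le> p" "p \<le> 1" and "\<phi> \<in> am_range p" "ellint_F p \<phi> = u"
  shows "jacobi_am p u = \<phi>"
  unfolding jacobi_am_def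
proof (rule the_equality)
  fix \<alpha> assume "(p = 1 \<longrightarrow> \<bar>\<alpha>\<bar> < pi / 2) \<and> ellint_F p \<alpha> = u"
  then show "\<alpha> = \<phi>"
    using ellint_F_strict_mono[OF p, of \<alpha> \<phi>] ellint_F_strict_mono[OF p, of \<phi> \<alpha>] assms(3,4)
    by (cases \<alpha> \<phi> rule: linorder_cases) (auto simp: am_range_def)
qed (use assms in \<open>auto simp: am_range_def\<close>)

lemma jacobi_am_works:
  assumes p: "0 \<le> p" "p \<le> 1"
  shows "jacobi_am p u \<in> am_range p" "ellint_F p (jacobi_am p u) = u"
proof -
  obtain \<phi> where \<phi>: "\<phi> \<in> am_range p" "ellint_F p \<phi> = u" by (rule ellint_F_surj[OF p])
  have "jacobi_am p u = \<phi>" by (rule jacobi_am_unique[OF p \<phi>])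
  with \<phi> show "jacobi_am p u \<in> am_range p" "ellint_F p (jacobi_am p u) = u" by simp_all
qed

lemma jacobi_dn_squared:
  assumes p: "0 \<le> p" "p \<le> 1"
  shows "jacobi_dn p u > 0" "(jacobi_dn p u)\<^sup>2 = 1 - p\<^sup>2 * (jacobi_sn p u)\<^sup>2"
  using ellint_radicand_pos[OF p jacobi_am_works(1)[OF p, of u]]
  by (simp_all add: jacobi_dn_def jacobi_sn_def)

lemma jacobi_sn_cn_squared: "(jacobi_sn p u)\<^sup>2 + (jacobi_cn p u)\<^sup>2 = 1"
  by (simp add: jacobi_sn_def jacobi_cn_def)

lemma jacobi_am_deriv:
  assumes p: "0 \<le> p" "p \<le> 1"
  shows "(jacobi_am p has_real_derivative jacobi_dn p u) (at u)"
proof -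
  note W = jacobi_am_works[OF p]
  let ?\<phi> = "jacobi_am p u"
  define r where "r = (if p = 1 then (pi / 2 - \<bar>?\<phi>\<bar>) / 2 else 1)"
  have r: "r > 0" "\<And>z. ?\<phi> - r \<le> z \<Longrightarrow> z \<le> ?\<phi> + r \<Longrightarrow> z \<in> am_range p"
    using W(1)[of u] by (auto simp: r_def am_range_def abs_le_iff abs_less_iff field_simps)
  have "isCont (jacobi_am p) (ellint_F p ?\<phi>)"
  proof (rule isCont_inverse_function2[of "?\<phi> - r" ?\<phi> "?\<phi> + r"])
    show "?\<phi> - r < ?\<phi>" "?\<phi> < ?\<phi> + r" using r(1) by auto
    show "jacobi_am p (ellint_F p z) = z" if "?\<phi> - r \<le> z" "z \<le> ?\<phi> + r" for z
      using jacobi_am_unique[OF p r(2)[OF that] refl] .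
    show "isCont (ellint_F p) z" if "?\<phi> - r \<le> z" "z \<le> ?\<phi> + r" for z
      using ellint_F_deriv[OF p r(2)[OF that]] by (rule DERIV_isCont)
  qed
  then have c: "isCont (jacobi_am p) u" by (simp add: W(2))
  have "(jacobi_am p has_real_derivative inverse (1 / sqrt (1 - p\<^sup>2 * (sin ?\<phi>)\<^sup>2))) (at u)"
  proof (rule DERIV_inverse_function[OF ellint_F_deriv[OF p W(1)] _ _ _ _ c])
    show "1 / sqrt (1 - p\<^sup>2 * (sin ?\<phi>)\<^sup>2) \<noteq> 0"
      using ellint_radicand_pos[OF p W(1)[of u]] by simp
    show "u - 1 < u" "u < u + 1" by auto
  qed (rule W(2))
  then show ?thesis by (simp add: jacobi_dn_def jacobi_sn_def)
qed

lemma jacobi_sn_deriv: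
  assumes p: "0 \<le> p" "p \<le> 1"
  shows "(jacobi_sn p has_real_derivative jacobi_cn p u * jacobi_dn p u) (at u)"
  unfolding jacobi_sn_def[abs_def] jacobi_cn_def
  by (rule DERIV_fun_sin[OF jacobi_am_deriv[OF p]])

lemma jacobi_cn_deriv:
  assumes p: "0 \<le> p" "p \<le> 1"
  shows "(jacobi_cn p has_real_derivative - jacobi_sn p u * jacobi_dn p u) (at u)"
  using DERIV_fun_cos[OF jacobi_am_deriv[OF p]]
  unfolding jacobi_sn_def jacobi_cn_def[abs_def] by (simp add: mult.commute)

lemma jacobi_dn_deriv:
  assumes p: "0 \<le> p" "p \<le> 1"
  shows "(jacobi_dn p has_real_derivative - p\<^sup>2 * jacobi_sn p u * jacobi_cn p u) (at u)"
proof -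
  have pos: "1 - p\<^sup>2 * (jacobi_sn p u)\<^sup>2 > 0" and s: "sqrt (1 - p\<^sup>2 * (jacobi_sn p u)\<^sup>2) = jacobi_dn p u"
    "jacobi_dn p u > 0"
    using jacobi_dn_squared[OF p, of u] by (auto simp: jacobi_dn_def)
  have "((\<lambda>u. 1 - p\<^sup>2 * (jacobi_sn p u)\<^sup>2) has_real_derivative
      - p\<^sup>2 * (2 * jacobi_sn p u * (jacobi_cn p u * jacobi_dn p u))) (at u)"
    by (auto intro!: derivative_eq_intros jacobi_sn_deriv[OF p])
  from DERIV_chain2[OF DERIV_real_sqrt[OF pos] this]
  have "((\<lambda>u. sqrt (1 - p\<^sup>2 * (jacobi_sn p u)\<^sup>2)) has_real_derivative
      - p\<^sup>2 * jacobi_sn p u * jacobi_cn p u) (at u)"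
    using s by (simp add: field_simps)
  then show ?thesis by (simp add: jacobi_dn_def[abs_def])
qed

text \<open>A point of the unit circle is (sin, cos) of some amplitude, and \<open>u\<close> is the
  integral of the first kind up to it. For \<open>p = 1\<close> the function cn is positive, so only
  an open half circle is reached.\<close>

lemma jacobi_sn_cn_surj:
  assumes p: "0 \<le> p" "p \<le> 1" and "y\<^sup>2 + z\<^sup>2 = 1" "p = 1 \<Longrightarrow> z > 0"
  obtains u where "jacobi_sn p u = y" "jacobi_cn p u = z"
proof -
  have "\<exists>\<phi>\<in>am_range p. sin \<phi> = y \<and> cos \<phi> = z"
  proof (cases "p = 1")
    case True
    then have z: "z > 0" using assms(4) by simp
    have "z\<^sup>2 > 0" using z by simp
    then have "y\<^sup>2 < 1" using assms(3) by linarith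
    then have y: "\<bar>y\<bar> < 1" by (simp add: abs_square_less_1)
    have "sqrt (1 - y\<^sup>2) = z" using z assms(3) by (intro real_sqrt_unique) auto
    then have "cos (arcsin y) = z" using y by (simp add: cos_arcsin abs_less_iff)
    moreover have "\<bar>arcsin y\<bar> < pi / 2" using arcsin_lt_bounded[of y] y by (auto simp: abs_less_iff)
    ultimately show ?thesis using y True by (intro bexI[of _ "arcsin y"]) (auto simp: am_range_def)
  next
    case False
    obtain t where "z = cos t" "y = sin t" using sincos_total_2pi[of z y] assms(3) by (auto simp: add.commute)
    then show ?thesis using False by (auto simp: am_range_def)
  qed
  then obtain \<phi> where \<phi>: "\<phi> \<in> am_range p" "sin \<phi> = y" "cos \<phi> = z" by blast
  then show ?thesis
    using that[of "ellint_F p \<phi>"] jacobi_am_unique[OF p \<phi>(1) refl]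
    by (simp add: jacobi_sn_def jacobi_cn_def)
qed

lemma ellint_Pi_deriv:
  assumes p: "0 \<le> p" "p \<le> 1" and "\<And>u. 1 - k * (jacobi_sn p u)\<^sup>2 > 0"
  shows "(ellint_Pi p k has_real_derivative 1 / (1 - k * (jacobi_sn p s)\<^sup>2)) (at s)"
proof -
  have "isCont (jacobi_sn p) u" for u using jacobi_sn_deriv[OF p] DERIV_isCont by blast
  then have "continuous_on {- (\<bar>s\<bar> + 1)..\<bar>s\<bar> + 1} (jacobi_sn p)"
    by (intro continuous_at_imp_continuous_on) auto
  then have "continuous_on {- (\<bar>s\<bar> + 1)..\<bar>s\<bar> + 1} (\<lambda>u. 1 / (1 - k * (jacobi_sn p u)\<^sup>2))"
    by (intro continuous_intros) (use assms(3) in \<open>auto simp: less_imp_neq[symmetric]\<close>)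
  from interval_integral_has_real_derivative[OF this, of s] show ?thesis
    unfolding ellint_Pi_def[abs_def] by simp
qed

section \<open>Uniqueness for ordinary differential equations\<close>

text \<open>Lipschitz on every ball around 0. The class is closed under sums and products, so
  polynomial vector fields belong to it by their syntax, and one constant serves along any compact
  piece of a trajectory.\<close>

definition locally_lipschitz :: "('a::real_normed_vector \<Rightarrow> 'b::real_normed_vector) \<Rightarrow> bool" where
  "locally_lipschitz f \<longleftrightarrow>
     (\<forall>R. \<exists>L\<ge>0. \<forall>x y. norm x \<le> R \<longrightarrow> norm y \<le> R \<longrightarrow> norm (f x - f y) \<le> L * norm (x - y))"

lemma locally_lipschitzE:
  assumes "locally_lipschitz f"
  obtains L where "L \<ge> 0" "\<And>x y. norm x \<le> R \<Longrightarrow> norm y \<le> R \<Longrightarrow> norm (f x - f y) \<le> L * norm (x - y)"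
proof -
  have "\<exists>L\<ge>0. \<forall>x y. norm x \<le> R \<longrightarrow> norm y \<le> R \<longrightarrow> norm (f x - f y) \<le> L * norm (x - y)"
    using assms unfolding locally_lipschitz_def by (rule spec)
  then show ?thesis using that by auto
qed

lemma locally_lipschitz_const: "locally_lipschitz (\<lambda>x. c)"
  unfolding locally_lipschitz_def by (intro allI exI[of _ 0]) simp

lemma locally_lipschitz_bounded_linear:
  assumes "bounded_linear f" shows "locally_lipschitz f"
proof -
  interpret bounded_linear f by fact
  obtain K where K: "K \<ge> 0" "\<And>x. norm (f x) \<le> norm x * K" using nonneg_bounded by blast
  show ?thesis
    unfolding locally_lipschitz_def
  proof (intro allI exI[of _ K] conjI impI)
    fix x y show "norm (f x - f y) \<le> K * norm (x - y)"
      using K(2)[of "x - y"] by (simp add: diff mult.commute)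
  qed (rule K(1))
qed

lemma locally_lipschitz_add:
  fixes f g :: "'a::real_normed_vector \<Rightarrow> 'b::real_normed_vector"
  assumes "locally_lipschitz f" "locally_lipschitz g"
  shows "locally_lipschitz (\<lambda>x. f x + g x)"
  unfolding locally_lipschitz_def
proof
  fix R
  obtain L where L: "L \<ge> 0" "\<And>x y. norm x \<le> R \<Longrightarrow> norm y \<le> R \<Longrightarrow> norm (f x - f y) \<le> L * norm (x - y)"
    using locally_lipschitzE[OF assms(1), where R = R] by blast
  obtain K where K: "K \<ge> 0" "\<And>x y. norm x \<le> R \<Longrightarrow> norm y \<le> R \<Longrightarrow> norm (g x - g y) \<le> K * norm (x - y)"
    using locally_lipschitzE[OF assms(2), where R = R] by blast
  show "\<exists>L\<ge>0. \<forall>x y. norm x \<le> R \<longrightarrow> norm y \<le> R \<longrightarrow>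
      norm (f x + g x - (f y + g y)) \<le> L * norm (x - y)"
  proof (intro exI[of _ "L + K"] conjI allI impI)
    fix x y :: 'a assume "norm x \<le> R" "norm y \<le> R"
    then have "norm (f x - f y) + norm (g x - g y) \<le> (L + K) * norm (x - y)"
      using L(2)[of x y] K(2)[of x y] by (simp add: algebra_simps)
    then show "norm (f x + g x - (f y + g y)) \<le> (L + K) * norm (x - y)"
      using norm_diff_triangle_ineq[of "f x" "g x" "f y" "g y"] by linarith
  qed (use L K in simp)
qed

lemma locally_lipschitz_mult:
  fixes f g :: "'a::real_normed_vector \<Rightarrow> real"
  assumes "locally_lipschitz f" "locally_lipschitz g"
  shows "locally_lipschitz (\<lambda>x. f x * g x)"
  unfolding locally_lipschitz_def
proof
  fix R :: real
  obtain L where L: "L \<ge> 0" "\<And>x y. norm x \<le> R \<Longrightarrow> norm y \<le> R \<Longrightarrow> norm (f x - f y) \<le> L * norm (x - y)"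
    using locally_lipschitzE[OF assms(1), where R = R] by blast
  obtain K where K: "K \<ge> 0" "\<And>x y. norm x \<le> R \<Longrightarrow> norm y \<le> R \<Longrightarrow> norm (g x - g y) \<le> K * norm (x - y)"
    using locally_lipschitzE[OF assms(2), where R = R] by blast
  \<comment> \<open>\<open>A\<close> and \<open>B\<close> bound \<open>f\<close> and
    \<open>g\<close> on the ball of radius \<open>R\<close> by comparison with the values at 0. The
    absolute value of \<open>R\<close> keeps them nonnegative when \<open>R\<close> is negative and
    the ball is empty.\<close>
  define A where "A = \<bar>f 0\<bar> + L * \<bar>R\<bar>"
  define B where "B = \<bar>g 0\<bar> + K * \<bar>R\<bar>"
  have AB: "A \<ge> 0" "B \<ge> 0" using L K by (auto simp: A_def B_def)
  show "\<exists>L\<ge>0. \<forall>x y. norm x \<le> R \<longrightarrow> norm y \<le> R \<longrightarrow>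
      norm (f x * g x - f y * g y) \<le> L * norm (x - y)"
  proof (intro exI[of _ "A * K + B * L"] conjI allI impI)
    fix x y :: 'a assume xy: "norm x \<le> R" "norm y \<le> R"
    then have R: "R \<ge> 0" using norm_ge_zero order_trans by blast
    have "norm (f x - f 0) \<le> L * norm (x - 0)" using L(2)[of x 0] xy R by simp
    also have "\<dots> \<le> L * R" using xy L by (simp add: mult_left_mono)
    finally have fx: "\<bar>f x\<bar> \<le> A" using R by (simp add: A_def)
    have "norm (g y - g 0) \<le> K * norm (y - 0)" using K(2)[of y 0] xy R by simp
    also have "\<dots> \<le> K * R" using xy K by (simp add: mult_left_mono)
    finally have gy: "\<bar>g y\<bar> \<le> B" using R by (simp add: B_def)
    have "f x * g x - f y * g y = f x * (g x - g y) + g y * (f x - f y)" by (simp add: algebra_simps)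
    then have "\<bar>f x * g x - f y * g y\<bar> \<le> \<bar>f x\<bar> * \<bar>g x - g y\<bar> + \<bar>g y\<bar> * \<bar>f x - f y\<bar>"
      by (metis abs_mult abs_triangle_ineq)
    also have "\<dots> \<le> A * (K * norm (x - y)) + B * (L * norm (x - y))"
      using fx gy L(2)[OF xy] K(2)[OF xy] AB by (intro add_mono mult_mono) auto
    finally show "norm (f x * g x - f y * g y) \<le> (A * K + B * L) * norm (x - y)"
      by (simp add: algebra_simps)
  qed (use L K AB in simp)
qed

lemma locally_lipschitz_Pair:
  assumes "locally_lipschitz f" "locally_lipschitz g"
  shows "locally_lipschitz (\<lambda>x. (f x, g x))"
proof -
  have "locally_lipschitz (\<lambda>x. (f x, 0))" if "locally_lipschitz f" for f :: "'a \<Rightarrow> 'd::real_normed_vector"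
    using that unfolding locally_lipschitz_def by (simp add: norm_Pair)
  moreover have "locally_lipschitz (\<lambda>x. (0, f x))" if "locally_lipschitz f" for f :: "'a \<Rightarrow> 'd::real_normed_vector"
    using that unfolding locally_lipschitz_def by (simp add: norm_Pair)
  ultimately have "locally_lipschitz (\<lambda>x. (f x, 0) + (0, g x))"
    using assms by (intro locally_lipschitz_add)
  then show ?thesis by simp
qed

text \<open>Gronwall for the squared distance \<open>g\<close>: its derivative is bounded by 2 L g,
  where L is a Lipschitz constant on a ball containing both trajectories over the segment from
  \<open>t0\<close> to \<open>t\<close>. Multiplying \<open>g\<close> by exp(-2 L s) forward in
  time, or by exp(2 L s) backward, makes it monotone, and it vanishes at \<open>t0\<close>.\<close>

lemma ode_unique:
  fixes f :: "'a::real_inner \<Rightarrow> 'a"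
  assumes f: "locally_lipschitz f" and J: "is_interval J"
    and y: "\<And>s. s \<in> J \<Longrightarrow> (y has_vector_derivative f (y s)) (at s)"
    and z: "\<And>s. s \<in> J \<Longrightarrow> (z has_vector_derivative f (z s)) (at s)"
    and t0: "t0 \<in> J" "y t0 = z t0" and t: "t \<in> J"
  shows "y t = z t"
proof -
  have SJ: "closed_segment t0 t \<subseteq> J" using J t0 t by (simp add: is_interval_convex_1 closed_segment_subset)
  have cont: "continuous_on (closed_segment t0 t) y" "continuous_on (closed_segment t0 t) z"
    using y z SJ by (meson continuous_at_imp_continuous_on has_vector_derivative_continuous subsetD)+
  obtain R1 R2 where "\<And>s. s \<in> closed_segment t0 t \<Longrightarrow> norm (y s) \<le> R1"
      "\<And>s. s \<in> closed_segment t0 t \<Longrightarrow> norm (z s) \<le> R2"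
    using compact_imp_bounded[OF compact_continuous_image[OF cont(1)]]
      compact_imp_bounded[OF compact_continuous_image[OF cont(2)]]
    unfolding bounded_iff by auto
  then have R: "norm (y s) \<le> max R1 R2" "norm (z s) \<le> max R1 R2" if "s \<in> closed_segment t0 t" for s
    using that by (auto simp: le_max_iff_disj)
  obtain L where L: "L \<ge> 0" "\<And>x y. norm x \<le> max R1 R2 \<Longrightarrow> norm y \<le> max R1 R2 \<Longrightarrow>
      norm (f x - f y) \<le> L * norm (x - y)"
    using locally_lipschitzE[OF f, where R = "max R1 R2"] by blast
  define g where "g s = (y s - z s) \<bullet> (y s - z s)" for s
  define g' where "g' s = 2 * ((y s - z s) \<bullet> (f (y s) - f (z s)))" for s
  have dg: "(g has_real_derivative g' s) (at s)" if "s \<in> J" for s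
  proof -
    have "((\<lambda>s. y s - z s) has_vector_derivative f (y s) - f (z s)) (at s)"
      using y z that by (intro has_vector_derivative_diff)
    from bounded_bilinear.has_vector_derivative[OF bounded_bilinear_inner this this]
    show ?thesis by (simp add: g_def[abs_def] g'_def has_real_derivative_iff_has_vector_derivative inner_commute)
  qed
  have g': "\<bar>g' s\<bar> \<le> 2 * L * g s" if "s \<in> closed_segment t0 t" for s
  proof -
    have "\<bar>(y s - z s) \<bullet> (f (y s) - f (z s))\<bar> \<le> norm (y s - z s) * norm (f (y s) - f (z s))"
      by (rule Cauchy_Schwarz_ineq2)
    also have "\<dots> \<le> norm (y s - z s) * (L * norm (y s - z s))"
      using L(2)[OF R[OF that]] by (intro mult_left_mono) auto
    finally show ?thesis by (simp add: g'_def g_def dot_square_norm power2_eq_square algebra_simps)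
  qed
  have dexp: "((\<lambda>s. exp (c * s) * g s) has_real_derivative exp (c * s) * (c * g s + g' s)) (at s)"
    if "s \<in> J" for c s
    by (auto intro!: derivative_eq_intros dg[OF that] simp: algebra_simps)
  have "g t \<le> 0"
  proof (cases "t0 \<le> t")
    case True
    have "exp (- (2 * L) * t) * g t \<le> exp (- (2 * L) * t0) * g t0"
    proof (rule DERIV_nonpos_imp_nonincreasing[OF True])
      fix s assume "t0 \<le> s" "s \<le> t"
      then have s: "s \<in> closed_segment t0 t" by (simp add: closed_segment_eq_real_ivl)
      then have "- (2 * L) * g s + g' s \<le> 0" using g'[OF s] by simp
      then show "\<exists>d. ((\<lambda>s. exp (- (2 * L) * s) * g s) has_real_derivative d) (at s) \<and> d \<le> 0"
        using dexp[of s "- (2 * L)"] s SJ by (meson mult_nonneg_nonpos exp_ge_zero subsetD)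
    qed
    then show ?thesis using t0 by (simp add: g_def mult_le_0_iff)
  next
    case False
    then have tt: "t \<le> t0" by simp
    have "exp (2 * L * t) * g t \<le> exp (2 * L * t0) * g t0"
    proof (rule DERIV_nonneg_imp_nondecreasing[OF tt])
      fix s assume "t \<le> s" "s \<le> t0"
      then have s: "s \<in> closed_segment t0 t" by (simp add: closed_segment_eq_real_ivl)
      then have "2 * L * g s + g' s \<ge> 0" using g'[OF s] by simp
      then show "\<exists>d. ((\<lambda>s. exp (2 * L * s) * g s) has_real_derivative d) (at s) \<and> d \<ge> 0"
        using dexp[of s "2 * L"] s SJ by (meson mult_nonneg_nonneg exp_ge_zero subsetD)
    qed
    then show ?thesis using t0 by (simp add: g_def mult_le_0_iff)
  qed
  then show ?thesis
    unfolding g_def using inner_ge_zero[of "y t - z t"] inner_eq_zero_iff[of "y t - z t"] by (metis antisym right_minus_eq)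
qed

section \<open>Minkowski space\<close>

lemma bounded_bilinear_mink: "bounded_bilinear mink"
proof
  fix a a' b b' :: mink_space and r :: real
  show "mink (a + a') b = mink a b + mink a' b" "mink a (b + b') = mink a b + mink a b'"
    "mink (r *\<^sub>R a) b = r *\<^sub>R mink a b" "mink a (r *\<^sub>R b) = r *\<^sub>R mink a b"
    by (simp_all add: mink_def algebra_simps)
  show "\<exists>K. \<forall>a b. norm (mink a b) \<le> norm a * norm b * K"
  proof (intro exI allI)
    fix a b :: mink_space
    have "\<bar>fst a * fst b\<bar> \<le> norm a * norm b"
      using norm_fst_le[of "fst a" "snd a"] norm_fst_le[of "fst b" "snd b"]
      by (auto simp: abs_mult intro!: mult_mono)
    moreover have "norm (snd a) * norm (snd b) \<le> norm a * norm b"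
      using norm_snd_le[of "snd a" "fst a"] norm_snd_le[of "snd b" "fst b"] by (auto intro!: mult_mono)
    then have "\<bar>snd a \<bullet> snd b\<bar> \<le> norm a * norm b" using Cauchy_Schwarz_ineq2 order_trans by blast
    ultimately show "norm (mink a b) \<le> norm a * norm b * 2" by (simp add: mink_def)
  qed
qed

interpretation mink: bounded_bilinear mink
  by (rule bounded_bilinear_mink)

lemma mink_commute: "mink x y = mink y x"
  by (simp add: mink_def inner_commute mult.commute)

lemmas mink_simps = mink.add_left mink.add_right mink.diff_left mink.diff_right
  mink.scaleR_left mink.scaleR_right mink.minus_left mink.minus_right mink.zero_left mink.zero_right

text \<open>Orthogonality says that the spatial product equals x0 v0, and Cauchy-Schwarz gives (x0
  v0)^2 <= |X|^2 |W|^2 < x0^2 |W|^2.\<close>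

lemma mink_pos_of_orth_timelike:
  assumes x: "mink x x < 0" and v: "mink x v = 0" "v \<noteq> 0"
  shows "mink v v > 0"
proof -
  obtain x0 X where X: "x = (x0, X)" by (cases x)
  obtain v0 W where W: "v = (v0, W)" by (cases v)
  have 1: "X \<bullet> X < x0 * x0" "X \<bullet> W = x0 * v0" using x v(1) by (auto simp: mink_def X W)
  have cs: "(X \<bullet> W) * (X \<bullet> W) \<le> (X \<bullet> X) * (W \<bullet> W)"
    using Cauchy_Schwarz_ineq[of X W] by (simp add: power2_eq_square)
  have x0: "x0 * x0 > 0" using 1(1) inner_ge_zero[of X] by linarith
  have "W \<noteq> 0" using 1(2) v(2) x0 by (auto simp: W zero_prod_def)
  then have WW: "W \<bullet> W > 0" by simp
  have "(x0 * x0) * (v0 * v0) \<le> (X \<bullet> X) * (W \<bullet> W)" using cs 1(2) by (simp add: algebra_simps)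
  also have "\<dots> < (x0 * x0) * (W \<bullet> W)" using 1(1) WW by (intro mult_strict_right_mono)
  finally have "v0 * v0 < W \<bullet> W" using x0 by (simp only: mult_less_cancel_left_pos)
  then show ?thesis by (simp add: mink_def W)
qed

text \<open>The combination n0 a - a0 n is again null and has no time component, so it
  vanishes.\<close>

lemma null_orthogonal_dependent:
  assumes "mink n n = 0" "mink a a = 0" "mink n a = 0" "n \<noteq> 0"
  shows "a \<in> span {n}"
proof -
  obtain n0 N where N: "n = (n0, N)" by (cases n)
  obtain a0 A where A: "a = (a0, A)" by (cases a)
  have "n0 \<noteq> 0" using assms(1,4) by (auto simp: mink_def N zero_prod_def)
  have "mink (n0 *\<^sub>R a - a0 *\<^sub>R n) (n0 *\<^sub>R a - a0 *\<^sub>R n) = 0"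
    using assms by (simp add: mink_simps mink_commute[of a n])
  then have "n0 *\<^sub>R A - a0 *\<^sub>R N = 0" by (simp add: mink_def A N)
  then have "n0 *\<^sub>R a = a0 *\<^sub>R n" by (simp add: A N)
  then have "(1 / n0) *\<^sub>R (n0 *\<^sub>R a) = (1 / n0) *\<^sub>R (a0 *\<^sub>R n)" by simp
  then have "a = (a0 / n0) *\<^sub>R n" using \<open>n0 \<noteq> 0\<close> by simp
  then show ?thesis by (simp add: span_scale span_base)
qed

lemma future_timelike_mink_neg:
  assumes "mink x x < 0" "fst x > 0" "mink y y < 0" "fst y > 0"
  shows "mink x y < 0"
proof -
  obtain x0 X where X: "x = (x0, X)" by (cases x)
  obtain y0 Y where Y: "y = (y0, Y)" by (cases y)
  have "norm X < x0" "norm Y < y0"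
    using assms by (auto simp: mink_def X Y dot_square_norm power2_eq_square intro: power2_less_imp_less)
  then have "norm X * norm Y < x0 * y0"
    by (intro mult_strict_mono') auto
  then show ?thesis
    using norm_cauchy_schwarz[of X Y] by (simp add: mink_def X Y)
qed

section \<open>Trigonometric and hyperbolic functions in one notation\<close>

text \<open>Hyperbolic for \<open>k = 1\<close>, circular otherwise. The plane of the rotation and
  its complement have opposite types, so orbits are written with \<open>gcos (-k)\<close> and the
  angle of the profile curve with \<open>gcos k\<close>.\<close>

definition gcos :: "real \<Rightarrow> real \<Rightarrow> real" where
  "gcos k s = (if k = 1 then cosh s else cos s)"

definition gsin :: "real \<Rightarrow> real \<Rightarrow> real" where
  "gsin k s = (if k = 1 then sinh s else sin s)"

lemma gcos_gsin_0 [simp]: "gcos k 0 = 1" "gsin k 0 = 0"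
  by (simp_all add: gcos_def gsin_def)

lemma gcos_gsin_minus [simp]: "gcos k (- s) = gcos k s" "gsin k (- s) = - gsin k s"
  by (simp_all add: gcos_def gsin_def)

lemma gcos_deriv: "k = 1 \<or> k = -1 \<Longrightarrow> (gcos k has_real_derivative k * gsin k s) (at s)"
  by (auto simp: gcos_def[abs_def] gsin_def intro!: derivative_eq_intros)

lemma gsin_deriv: "(gsin k has_real_derivative gcos k s) (at s)"
  by (auto simp: gcos_def gsin_def[abs_def] intro!: derivative_eq_intros)

lemma gcos_gsin_squared: "k = 1 \<or> k = -1 \<Longrightarrow> (gcos k s)\<^sup>2 - k * (gsin k s)\<^sup>2 = 1"
  by (auto simp: gcos_def gsin_def hyperbolic_pythagoras)

lemma gcos_add: "k = 1 \<or> k = -1 \<Longrightarrow> gcos k (s + t) = gcos k s * gcos k t + k * gsin k s * gsin k t"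
  by (auto simp: gcos_def gsin_def cosh_add cos_add)

lemma gsin_add: "gsin k (s + t) = gsin k s * gcos k t + gcos k s * gsin k t"
  by (auto simp: gcos_def gsin_def sinh_add sin_add)

section \<open>Orthonormal frames adapted to the rotation\<close>

text \<open>The plane of the rotation is spanned by \<open>u1\<close>, \<open>u2\<close>. The case \<open>k = 1\<close> is elliptic and
  \<open>w1\<close> is timelike; the case \<open>k = -1\<close> is hyperbolic and \<open>u1\<close> is timelike.\<close>

locale mink_frame =
  fixes k :: real and u1 u2 w1 w2 :: mink_space
  assumes k: "k = 1 \<or> k = -1"
    and gram: "mink u1 u1 = k" "mink u2 u2 = 1" "mink w1 w1 = - k" "mink w2 w2 = 1"
      "mink u1 u2 = 0" "mink u1 w1 = 0" "mink u1 w2 = 0" "mink u2 w1 = 0" "mink u2 w2 = 0" "mink w1 w2 = 0"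
    and future: "fst (if k = 1 then w1 else u1) > 0"
begin

definition fr :: "real \<Rightarrow> real \<Rightarrow> real \<Rightarrow> real \<Rightarrow> mink_space" where
  "fr p q a b = p *\<^sub>R u1 + q *\<^sub>R u2 + a *\<^sub>R w1 + b *\<^sub>R w2"

lemma kk [simp]: "k * k = 1" "k * (k * c) = c" "k\<^sup>2 = 1" "k \<noteq> 0"
  using k by auto

lemma gram': "mink u2 u1 = 0" "mink w1 u1 = 0" "mink w2 u1 = 0" "mink w1 u2 = 0" "mink w2 u2 = 0" "mink w2 w1 = 0"
  using gram by (simp_all add: mink_commute)

lemma mink_fr: "mink (fr p q a b) (fr p' q' a' b') = k * p * p' + q * q' - k * a * a' + b * b'"
  by (simp add: fr_def mink_simps gram gram' algebra_simps)

lemma fr_ops: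
  "fr p q a b + fr p' q' a' b' = fr (p + p') (q + q') (a + a') (b + b')"
  "fr p q a b - fr p' q' a' b' = fr (p - p') (q - q') (a - a') (b - b')"
  "c *\<^sub>R fr p q a b = fr (c * p) (c * q) (c * a) (c * b)"
  "fr 0 0 0 0 = 0"
  by (simp_all add: fr_def algebra_simps)

lemma fr_coords:
  "mink (fr p q a b) u1 = k * p" "mink (fr p q a b) u2 = q"
  "mink (fr p q a b) w1 = - k * a" "mink (fr p q a b) w2 = b"
  by (simp_all add: fr_def mink_simps gram gram' algebra_simps)

lemma fr_eq_iff: "fr p q a b = fr p' q' a' b' \<longleftrightarrow> p = p' \<and> q = q' \<and> a = a' \<and> b = b'"
proof
  assume "fr p q a b = fr p' q' a' b'"
  then have "mink (fr p q a b) e = mink (fr p' q' a' b') e" for e by simp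
  from this[of u1] this[of u2] this[of w1] this[of w2]
  show "p = p' \<and> q = q' \<and> a = a' \<and> b = b'" by (simp add: fr_coords)
qed simp

lemma fr_surj: obtains p q a b where "v = fr p q a b"
proof -
  \<comment> \<open>Standard coordinates are reinterpreted as frame coordinates. This map is
    injective because the Gram matrix recovers the coordinates, hence surjective by
    dimension.\<close>
  define G :: "mink_space \<Rightarrow> mink_space" where "G v = fr (fst v) (snd v $ 1) (snd v $ 2) (snd v $ 3)" for v
  have "linear G" by (rule linearI) (simp_all add: G_def fr_ops)
  moreover have "inj G"
  proof (rule injI)
    fix x y assume "G x = G y"
    then have "fst x = fst y \<and> snd x $ 1 = snd y $ 1 \<and> snd x $ 2 = snd y $ 2 \<and> snd x $ 3 = snd y $ 3"
      by (simp only: G_def fr_eq_iff)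
    then show "x = y" by (simp add: prod_eq_iff vec_eq_iff forall_3)
  qed
  ultimately have "surj G" by (rule linear_injective_imp_surjective) simp
  then obtain z where "v = G z" by (metis surjD)
  then show ?thesis using that by (simp add: G_def)
qed

lemma fr_mem_span_u: "fr p q a b \<in> span {u1, u2} \<longleftrightarrow> a = 0 \<and> b = 0"
proof
  assume "fr p q a b \<in> span {u1, u2}"
  then obtain c d where "fr p q a b - c *\<^sub>R u1 = d *\<^sub>R u2"
    by (auto simp: span_insert span_empty)
  then have "fr p q a b = fr c d 0 0" by (simp add: fr_def algebra_simps)
  then show "a = 0 \<and> b = 0" by (simp add: fr_eq_iff)
next
  assume "a = 0 \<and> b = 0"
  then show "fr p q a b \<in> span {u1, u2}" by (auto simp: fr_def intro!: span_add span_scale intro: span_base)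
qed

lemma fr_mem_span_w: "fr p q a b \<in> span {w1, w2} \<longleftrightarrow> p = 0 \<and> q = 0"
proof
  assume "fr p q a b \<in> span {w1, w2}"
  then obtain c d where "fr p q a b - c *\<^sub>R w1 = d *\<^sub>R w2"
    by (auto simp: span_insert span_empty)
  then have "fr p q a b = fr 0 0 c d" by (simp add: fr_def algebra_simps)
  then show "p = 0 \<and> q = 0" by (simp add: fr_eq_iff)
next
  assume "p = 0 \<and> q = 0"
  then show "fr p q a b \<in> span {w1, w2}" by (auto simp: fr_def intro!: span_add span_scale intro: span_base)
qed

text \<open>Two future timelike vectors have negative product, which fixes the sign of the
  coordinate along the timelike frame vector.\<close>

lemma fr_hyp3:
  assumes "fr p q a b \<in> hyp3"
  shows "k * p\<^sup>2 + q\<^sup>2 - k * a\<^sup>2 + b\<^sup>2 = -1" and "k = 1 \<Longrightarrow> a > 0" and "k = -1 \<Longrightarrow> p > 0"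
proof -
  have h: "mink (fr p q a b) (fr p q a b) = -1" "fst (fr p q a b) > 0" using assms by (auto simp: hyp3_def)
  show "k * p\<^sup>2 + q\<^sup>2 - k * a\<^sup>2 + b\<^sup>2 = -1" using h(1) by (simp add: mink_fr power2_eq_square algebra_simps)
  show "a > 0" if "k = 1"
    using future_timelike_mink_neg[of "fr p q a b" w1] h future gram that by (simp add: fr_coords)
  show "p > 0" if "k = -1"
    using future_timelike_mink_neg[of "fr p q a b" u1] h future gram that by (simp add: fr_coords)
qed

end

section \<open>Planes that admit an orthonormal frame\<close>

lemma exists_outside_span:
  fixes V :: "'a::euclidean_space set"
  assumes "finite S" "card S < dim V"
  obtains y where "y \<in> V" "y \<notin> span S"
proof -
  have "\<not> V \<subseteq> span S"
  proof
    assume "V \<subseteq> span S"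
    then have "dim V \<le> card S" using assms(1) by (rule dim_le_card)
    then show False using assms(2) by simp
  qed
  then show ?thesis using that by blast
qed

lemma mink_gram_schmidt:
  assumes S: "finite S" "\<And>e. e \<in> S \<Longrightarrow> mink e e \<noteq> 0"
    "\<And>e f. e \<in> S \<Longrightarrow> f \<in> S \<Longrightarrow> e \<noteq> f \<Longrightarrow> mink e f = 0"
    and y: "y \<notin> span S"
  obtains z where "z \<noteq> 0" "\<And>f. f \<in> S \<Longrightarrow> mink z f = 0" "y - z \<in> span S"
proof -
  define P where "P = (\<Sum>e\<in>S. (mink y e / mink e e) *\<^sub>R e)"
  have P: "P \<in> span S" unfolding P_def by (intro span_sum span_scale span_base)
  have "mink P f = mink y f" if "f \<in> S" for f
  proof -
    have "mink P f = (\<Sum>e\<in>S. (mink y e / mink e e) * mink e f)"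
      by (simp add: P_def mink.sum_left mink.scaleR_left)
    also have "\<dots> = (\<Sum>e\<in>S. if e = f then mink y f else 0)"
      using S that by (intro sum.cong) auto
    finally show ?thesis using S(1) that by simp
  qed
  then show ?thesis using that[of "y - P"] P y by (auto simp: mink.diff_left)
qed

lemma mink_normalize_spacelike:
  assumes "mink v v > 0"
  obtains c where "c \<noteq> 0" "mink (c *\<^sub>R v) (c *\<^sub>R v) = 1"
  using that[of "1 / sqrt (mink v v)"] assms by (simp add: mink_simps)

lemma mink_normalize_timelike:
  assumes "mink v v < 0"
  obtains c where "c \<noteq> 0" "mink (c *\<^sub>R v) (c *\<^sub>R v) = -1" "fst (c *\<^sub>R v) > 0"
proof -
  have f: "fst v \<noteq> 0"
  proof
    assume "fst v = 0"
    then have "mink v v = snd v \<bullet> snd v" by (simp add: mink_def)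
    then show False using assms inner_ge_zero[of "snd v"] by linarith
  qed
  define c where "c = sgn (fst v) / sqrt (- mink v v)"
  have "c * fst v = \<bar>fst v\<bar> / sqrt (- mink v v)" by (simp add: c_def abs_sgn)
  moreover have "c * c * mink v v = -1"
  proof -
    have "sqrt (- mink v v) * sqrt (- mink v v) = - mink v v" using assms by simp
    moreover have "sgn (fst v) * sgn (fst v) = 1" using f by (simp add: sgn_if)
    ultimately show ?thesis using assms by (simp add: c_def)
  qed
  ultimately show ?thesis using that[of c] assms f by (auto simp: mink_simps c_def sgn_if)
qed

lemma orthogonal_pair_spans_plane:
  assumes V: "subspace V" "dim V = 2" and ab: "a \<in> V" "b \<in> V"
    and o: "mink a a \<noteq> 0" "b \<noteq> 0" "mink a b = 0"
  shows "a \<noteq> b" "independent {a, b}" "span {a, b} = V"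
proof -
  show "a \<noteq> b" using o by auto
  have "a \<notin> span {b}" using o by (auto simp: span_insert mink_simps mink_commute)
  then show ind: "independent {a, b}" using o(2) by (simp add: independent_insert)
  show "span {a, b} = V"
  proof
    show "span {a, b} \<subseteq> V" using ab V(1) by (intro span_minimal) auto
    show "V \<subseteq> span {a, b}"
      by (rule card_ge_dim_independent[OF _ ind]) (use ab V(2) \<open>a \<noteq> b\<close> in auto)
  qed
qed

text \<open>Everything orthogonal to a timelike vector is spacelike, so once \<open>S\<close>
  contains one, Gram-Schmidt outside its span can be normalized to square 1.\<close>

lemma spacelike_complement:
  assumes "finite S" "card S < 4" "\<And>e. e \<in> S \<Longrightarrow> mink e e \<noteq> 0"
    "\<And>e f. e \<in> S \<Longrightarrow> f \<in> S \<Longrightarrow> e \<noteq> f \<Longrightarrow> mink e f = 0" "\<exists>e\<in>S. mink e e < 0"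
  obtains z where "mink z z = 1" "\<And>f. f \<in> S \<Longrightarrow> mink z f = 0"
proof -
  have "dim (UNIV :: mink_space set) = 4" by simp
  then obtain y :: mink_space where "y \<notin> span S" using exists_outside_span[of S UNIV] assms(1,2) by auto
  then obtain z where z: "z \<noteq> 0" "\<And>f. f \<in> S \<Longrightarrow> mink z f = 0" "y - z \<in> span S"
    using mink_gram_schmidt[OF assms(1,3,4), of y] by auto
  obtain e where "e \<in> S" "mink e e < 0" using assms(5) by blast
  then have "mink z z > 0"
    using mink_pos_of_orth_timelike[of e z] z(1,2) by (simp add: mink_commute)
  then obtain c where "mink (c *\<^sub>R z) (c *\<^sub>R z) = 1" by (rule mink_normalize_spacelike)
  then show ?thesis using that[of "c *\<^sub>R z"] z(2) by (simp add: mink_simps)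
qed

lemma nonparabolic_plane_frame:
  assumes V: "subspace V" "dim V = 2" and np: "\<not> parabolic_plane V"
  obtains k u1 u2 w1 w2 where "mink_frame k u1 u2 w1 w2" "V = span {u1, u2}"
    "k = 1 \<Longrightarrow> elliptic_plane V" "k = -1 \<Longrightarrow> hyperbolic_plane V"
proof (cases "\<exists>v\<in>V. mink v v < 0")
  case True
  then obtain v where v0: "v \<in> V" "mink v v < 0" by blast
  obtain c where "c \<noteq> 0" "mink (c *\<^sub>R v) (c *\<^sub>R v) = -1" "fst (c *\<^sub>R v) > 0"
    by (rule mink_normalize_timelike[OF v0(2)])
  note v = v0 this
  define u1 where "u1 = c *\<^sub>R v"
  have u1: "u1 \<in> V" "mink u1 u1 = -1" "fst u1 > 0"
    using v V(1) unfolding u1_def by (auto intro: subspace_scale)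
  obtain y where y: "y \<in> V" "y \<notin> span {u1}" by (rule exists_outside_span[of "{u1}" V]) (use V(2) in auto)
  obtain z where z: "z \<noteq> 0" "mink z u1 = 0" "y - z \<in> span {u1}"
    by (rule mink_gram_schmidt[of "{u1}" y]) (use u1 y(2) in auto)
  have "y - z \<in> V" using span_minimal[of "{u1}" V] z(3) u1(1) V(1) by blast
  then have zV: "z \<in> V" using y(1) V(1) subspace_diff[of V y "y - z"] by simp
  have "mink z z > 0" using mink_pos_of_orth_timelike[of u1 z] u1 z by (simp add: mink_commute)
  then obtain d where d: "d \<noteq> 0" "mink (d *\<^sub>R z) (d *\<^sub>R z) = 1" by (rule mink_normalize_spacelike)
  define u2 where "u2 = d *\<^sub>R z"
  have u2: "u2 \<in> V" "mink u2 u2 = 1" "mink u2 u1 = 0"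
    using zV V(1) d z(2) unfolding u2_def by (auto intro: subspace_scale simp: mink.scaleR_left)
  obtain w1 where w1: "mink w1 w1 = 1" "mink w1 u1 = 0" "mink w1 u2 = 0"
  proof (rule spacelike_complement[of "{u1, u2}"])
    show "card {u1, u2} < 4" by (simp add: card_insert_if)
  qed (use u1 u2 in \<open>auto simp: mink_commute\<close>)
  obtain w2 where w2: "mink w2 w2 = 1" "mink w2 u1 = 0" "mink w2 u2 = 0" "mink w2 w1 = 0"
  proof (rule spacelike_complement[of "{u1, u2, w1}"])
    show "card {u1, u2, w1} < 4" by (simp add: card_insert_if)
  qed (use u1 u2 w1 in \<open>auto simp: mink_commute\<close>)
  have "mink_frame (-1) u1 u2 w1 w2"
    by unfold_locales (use u1 u2 w1 w2 in \<open>auto simp: mink_commute\<close>)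
  moreover have u10: "u1 \<noteq> 0" using u1(2) by (auto simp: mink.zero_left)
  moreover have b: "u2 \<noteq> u1" "independent {u2, u1}" "span {u2, u1} = V"
    using orthogonal_pair_spans_plane[OF V u2(1) u1(1) _ u10 u2(3)] u2(2) by simp_all
  moreover have "hyperbolic_plane V"
    unfolding hyperbolic_plane_def has_signature_def using b u1 u2 by blast
  ultimately show ?thesis by (intro that[of "-1" u1 u2 w1 w2]) (simp_all add: insert_commute)
next
  case False
  then have nn: "\<And>v. v \<in> V \<Longrightarrow> mink v v \<ge> 0" by (meson not_less)
  show ?thesis
  proof (cases "\<exists>n\<in>V. n \<noteq> 0 \<and> mink n n = 0")
    case True
    then obtain n where n: "n \<in> V" "n \<noteq> 0" "mink n n = 0" by blast
    have orth: "mink v n = 0" if v: "v \<in> V" for v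
    proof (rule ccontr)
      assume nz: "mink v n \<noteq> 0"
      \<comment> \<open>The value of \<open>t\<close> for which v + t n has square -1, contradicting
        nonnegativity on \<open>V\<close>.\<close>
      define t where "t = - (mink v v + 1) / (2 * mink v n)"
      have "v + t *\<^sub>R n \<in> V" using v n V(1) by (intro subspace_add subspace_scale)
      then have "0 \<le> mink (v + t *\<^sub>R n) (v + t *\<^sub>R n)" by (rule nn)
      also have "\<dots> = mink v v + 2 * t * mink v n"
        using n by (simp add: mink_simps mink_commute algebra_simps)
      also have "\<dots> = -1" using nz by (simp add: t_def field_simps)
      finally show False by simp
    qed
    obtain a where a: "a \<in> V" "a \<notin> span {n}" by (rule exists_outside_span[of "{n}" V]) (use V(2) in auto)
    have "mink a a \<noteq> 0"
      using null_orthogonal_dependent[of n a] a n orth[OF a(1)] by (auto simp: mink_commute)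
    then have "mink a a > 0" using nn[OF a(1)] by simp
    then obtain c where c: "c \<noteq> 0" "mink (c *\<^sub>R a) (c *\<^sub>R a) = 1" by (rule mink_normalize_spacelike)
    have ca: "c *\<^sub>R a \<in> V" using a V(1) by (intro subspace_scale)
    have "c *\<^sub>R a \<noteq> n" "independent {c *\<^sub>R a, n}" "span {c *\<^sub>R a, n} = V"
      using orthogonal_pair_spans_plane[OF V ca n(1) _ n(2) orth[OF ca]] c(2) by simp_all
    then have "parabolic_plane V"
      unfolding parabolic_plane_def has_signature_def using c n orth[OF ca] by blast
    then show ?thesis using np by contradiction
  next
    case False
    then have pos: "\<And>v. v \<in> V \<Longrightarrow> v \<noteq> 0 \<Longrightarrow> mink v v > 0" using nn by (metis order_le_less)
    obtain v where v: "v \<in> V" "v \<notin> span {}" by (rule exists_outside_span[of "{}" V]) (use V(2) in auto)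
    then have "mink v v > 0" using pos span_zero by blast
    then obtain c where c: "c \<noteq> 0" "mink (c *\<^sub>R v) (c *\<^sub>R v) = 1" by (rule mink_normalize_spacelike)
    define u1 where "u1 = c *\<^sub>R v"
    have u1: "u1 \<in> V" "mink u1 u1 = 1"
      using v c V(1) unfolding u1_def by (auto intro: subspace_scale)
    obtain y where y: "y \<in> V" "y \<notin> span {u1}" by (rule exists_outside_span[of "{u1}" V]) (use V(2) in auto)
    obtain z where z: "z \<noteq> 0" "mink z u1 = 0" "y - z \<in> span {u1}"
      by (rule mink_gram_schmidt[of "{u1}" y]) (use u1 y(2) in auto)
    have "y - z \<in> V" using span_minimal[of "{u1}" V] z(3) u1(1) V(1) by blast
    then have zV: "z \<in> V" using y(1) V(1) subspace_diff[of V y "y - z"] by simp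
    obtain d where d: "d \<noteq> 0" "mink (d *\<^sub>R z) (d *\<^sub>R z) = 1"
      by (rule mink_normalize_spacelike[OF pos[OF zV z(1)]])
    define u2 where "u2 = d *\<^sub>R z"
    have u2: "u2 \<in> V" "mink u2 u2 = 1" "mink u2 u1 = 0"
      using zV V(1) d z(2) unfolding u2_def by (auto intro: subspace_scale simp: mink.scaleR_left)
    \<comment> \<open>A timelike vector is projected off \<open>V\<close>. Removing its components
      along the spacelike plane only lowers the square, so the rest is still timelike.\<close>
    define y0 :: mink_space where "y0 = (1, 0)"
    define y1 where "y1 = y0 - mink y0 u1 *\<^sub>R u1 - mink y0 u2 *\<^sub>R u2"
    have y0: "mink y0 y0 = -1" by (simp add: y0_def mink_def)
    have y1: "mink y1 u1 = 0" "mink y1 u2 = 0"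
      using u1 u2 by (simp_all add: y1_def mink_simps mink_commute[of u1 u2])
    have "mink y1 y1 = mink y1 y0" using y1 by (simp add: y1_def mink_simps)
    also have "\<dots> = -1 - (mink y0 u1)\<^sup>2 - (mink y0 u2)\<^sup>2"
      using y0 by (simp add: y1_def mink_simps mink_commute[of u1 y0] mink_commute[of u2 y0] power2_eq_square)
    also have "\<dots> < 0" using zero_le_power2[of "mink y0 u1"] zero_le_power2[of "mink y0 u2"] by linarith
    finally obtain e where e: "e \<noteq> 0" "mink (e *\<^sub>R y1) (e *\<^sub>R y1) = -1" "fst (e *\<^sub>R y1) > 0"
      by (rule mink_normalize_timelike)
    define w1 where "w1 = e *\<^sub>R y1"
    have w1: "mink w1 w1 = -1" "fst w1 > 0" "mink w1 u1 = 0" "mink w1 u2 = 0"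
      using e y1 unfolding w1_def by (auto simp: mink.scaleR_left)
    obtain w2 where w2: "mink w2 w2 = 1" "mink w2 u1 = 0" "mink w2 u2 = 0" "mink w2 w1 = 0"
    proof (rule spacelike_complement[of "{u1, u2, w1}"])
      show "card {u1, u2, w1} < 4" by (simp add: card_insert_if)
    qed (use u1 u2 w1 in \<open>auto simp: mink_commute\<close>)
    have "mink_frame 1 u1 u2 w1 w2"
      by unfold_locales (use u1 u2 w1 w2 in \<open>auto simp: mink_commute\<close>)
    moreover have u12: "mink u1 u2 = 0" using u2(3) by (simp add: mink_commute)
    moreover have u20: "u2 \<noteq> 0" using u2(2) by (auto simp: mink.zero_left)
    moreover have b: "u1 \<noteq> u2" "independent {u1, u2}" "span {u1, u2} = V"
      using orthogonal_pair_spans_plane[OF V u1(1) u2(1) _ u20 u12] u1(2) by simp_all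
    moreover have "elliptic_plane V"
      unfolding elliptic_plane_def has_signature_def using b u1 u2 u12 by blast
    ultimately show ?thesis by (intro that[of 1 u1 u2 w1 w2]) simp_all
  qed
qed

section \<open>One-parameter groups of rotations\<close>

text \<open>Convolving with an interval makes a continuous solution of the addition formulas
  differentiable.\<close>

lemma gcos_gsin_unique:
  fixes c d :: "real \<Rightarrow> real"
  assumes k: "k = 1 \<or> k = -1" and cont: "continuous_on UNIV c" "continuous_on UNIV d"
    and z: "c 0 = 1" "d 0 = 0"
    and addc: "\<And>s t. c (s + t) = c s * c t - k * d s * d t"
    and addd: "\<And>s t. d (s + t) = d s * c t + c s * d t"
    and sq: "\<And>s. (c s)\<^sup>2 + k * (d s)\<^sup>2 = 1"
  obtains \<omega> where "\<And>s. c s = gcos (-k) (\<omega> * s)" "\<And>s. d s = gsin (-k) (\<omega> * s)"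
proof -
  define Ci where "Ci x = (LBINT y=ereal 0..ereal x. c y)" for x
  define Di where "Di x = (LBINT y=ereal 0..ereal x. d y)" for x
  have kk: "k * k = 1" "k * (k * y) = y" for y using k by auto
  have dC: "(Ci has_real_derivative c x) (at x)" for x
    unfolding Ci_def[abs_def]
    by (rule interval_integral_has_real_derivative[of "\<bar>x\<bar> + 1"]) (auto intro: continuous_on_subset[OF cont(1)])
  have dD: "(Di has_real_derivative d x) (at x)" for x
    unfolding Di_def[abs_def]
    by (rule interval_integral_has_real_derivative[of "\<bar>x\<bar> + 1"]) (auto intro: continuous_on_subset[OF cont(2)])
  have C0: "Ci 0 = 0" "Di 0 = 0" by (simp_all add: Ci_def Di_def)
  have dCs: "((\<lambda>x. Ci (s + x)) has_real_derivative c (s + x)) (at x)" for s x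
    using DERIV_at_within_shift[of Ci "c (s + x)" s x UNIV] dC[of "s + x"] by simp
  have dDs: "((\<lambda>x. Di (s + x)) has_real_derivative d (s + x)) (at x)" for s x
    using DERIV_at_within_shift[of Di "d (s + x)" s x UNIV] dD[of "s + x"] by simp
  have CI: "Ci (s + x) - Ci s = c s * Ci x - k * d s * Di x" for s x
  proof -
    have "((\<lambda>x. Ci (s + x) - (c s * Ci x - k * d s * Di x)) has_real_derivative 0) (at x)" for x
      by (rule derivative_eq_intros dCs dC dD refl)+ (simp add: addc)
    from DERIV_isconst_all[of _ x 0, OF allI[OF this]] show ?thesis by (simp add: C0)
  qed
  have DI: "Di (s + x) - Di s = d s * Ci x + c s * Di x" for s x
  proof -
    have "((\<lambda>x. Di (s + x) - (d s * Ci x + c s * Di x)) has_real_derivative 0) (at x)" for x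
      by (rule derivative_eq_intros dDs dC dD refl)+ (simp add: addd)
    from DERIV_isconst_all[of _ x 0, OF allI[OF this]] show ?thesis by (simp add: C0)
  qed
  \<comment> \<open>Integrated over an interval of length \<delta>, the addition formulas are a
    linear system for (c s, d s) with determinant (Ci \<delta>)^2 + k (Di \<delta>)^2. It is nonzero
    for a suitable small \<delta> because Ci x / x tends to 1 and Di x / x to 0. Solving the system
    writes \<open>c\<close> and \<open>d\<close> through the differentiable functions
    \<open>Ci\<close> and \<open>Di\<close>.\<close>
  obtain \<delta> where \<delta>: "(Ci \<delta>)\<^sup>2 + k * (Di \<delta>)\<^sup>2 \<noteq> 0"
  proof -
    have "((\<lambda>x. Ci x / x) \<longlongrightarrow> 1) (at 0)" "((\<lambda>x. Di x / x) \<longlongrightarrow> 0) (at 0)"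
      using dC[of 0] dD[of 0] z by (simp_all add: DERIV_def C0)
    then have "((\<lambda>x. (Ci x / x)\<^sup>2 + k * (Di x / x)\<^sup>2) \<longlongrightarrow> 1\<^sup>2 + k * 0\<^sup>2) (at 0)"
      by (intro tendsto_intros)
    then have "\<forall>\<^sub>F x in at 0. (Ci x / x)\<^sup>2 + k * (Di x / x)\<^sup>2 > 0"
      by (rule order_tendstoD) simp
    then obtain x where "(Ci x / x)\<^sup>2 + k * (Di x / x)\<^sup>2 > 0"
      using eventually_happens[of _ "at (0::real)"] by auto
    moreover have "(Ci x / x)\<^sup>2 + k * (Di x / x)\<^sup>2 = ((Ci x)\<^sup>2 + k * (Di x)\<^sup>2) / x\<^sup>2"
      by (simp add: power_divide add_divide_distrib)
    ultimately have "(Ci x)\<^sup>2 + k * (Di x)\<^sup>2 \<noteq> 0" by auto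
    then show ?thesis by (rule that)
  qed
  define N where "N = (Ci \<delta>)\<^sup>2 + k * (Di \<delta>)\<^sup>2"
  have N: "N \<noteq> 0" using \<delta> by (simp add: N_def)
  have ceq: "c = (\<lambda>s. ((Ci (s + \<delta>) - Ci s) * Ci \<delta> + k * (Di (s + \<delta>) - Di s) * Di \<delta>) / N)"
    unfolding CI DI using N by (auto simp: field_simps N_def power2_eq_square)
  have deq: "d = (\<lambda>s. ((Di (s + \<delta>) - Di s) * Ci \<delta> - (Ci (s + \<delta>) - Ci s) * Di \<delta>) / N)"
    unfolding CI DI using N by (auto simp: field_simps N_def power2_eq_square kk)
  have dCd: "((\<lambda>s. Ci (s + \<delta>)) has_real_derivative c (s + \<delta>)) (at s)"
       "((\<lambda>s. Di (s + \<delta>)) has_real_derivative d (s + \<delta>)) (at s)" for s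
    using dCs[of \<delta> s] dDs[of \<delta> s] by (simp_all add: add.commute)
  have "\<exists>\<alpha>. (c has_real_derivative \<alpha>) (at 0)"
    by (subst ceq, rule exI) (rule derivative_eq_intros dCd dC dD refl N)+
  then obtain \<alpha> where \<alpha>: "(c has_real_derivative \<alpha>) (at 0)" by blast
  have "\<exists>\<omega>. (d has_real_derivative \<omega>) (at 0)"
    by (subst deq, rule exI) (rule derivative_eq_intros dCd dC dD refl N)+
  then obtain \<omega> where \<omega>: "(d has_real_derivative \<omega>) (at 0)" by blast
  \<comment> \<open>Differentiating the relation \<open>sq\<close> at 0 leaves the angular speed
    \<omega> as the only free parameter.\<close>
  have "((\<lambda>s. (c s)\<^sup>2 + k * (d s)\<^sup>2) has_real_derivative 2 * \<alpha>) (at 0)"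
    by (rule derivative_eq_intros \<alpha> \<omega> refl)+ (simp add: z)
  moreover have "((\<lambda>s. (c s)\<^sup>2 + k * (d s)\<^sup>2) has_real_derivative 0) (at 0)" by (simp add: sq)
  ultimately have \<alpha>0: "\<alpha> = 0" using DERIV_unique by fastforce
  have dc: "(c has_real_derivative - k * \<omega> * d s) (at s)" for s
  proof -
    have "((\<lambda>x. c s * c x - k * d s * d x) has_real_derivative - k * \<omega> * d s) (at 0)"
      by (rule derivative_eq_intros \<alpha> \<omega> refl)+ (simp add: \<alpha>0)
    then have "((\<lambda>x. c (s + x)) has_real_derivative - k * \<omega> * d s) (at 0)" by (simp add: addc)
    then show ?thesis using DERIV_at_within_shift[of c _ s 0 UNIV] by simp
  qed
  have dd: "(d has_real_derivative \<omega> * c s) (at s)" for s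
  proof -
    have "((\<lambda>x. d s * c x + c s * d x) has_real_derivative \<omega> * c s) (at 0)"
      by (rule derivative_eq_intros \<alpha> \<omega> refl)+ (simp add: \<alpha>0)
    then have "((\<lambda>x. d (s + x)) has_real_derivative \<omega> * c s) (at 0)" by (simp add: addd)
    then show ?thesis using DERIV_at_within_shift[of d _ s 0 UNIV] by simp
  qed
  let ?G = "\<lambda>s. gcos (-k) (\<omega> * s)" and ?S = "\<lambda>s. gsin (-k) (\<omega> * s)"
  have k': "- k = 1 \<or> - k = -1" using k by auto
  have dG: "(?G has_real_derivative - k * ?S s * \<omega>) (at s)" for s
    using DERIV_chain2[OF gcos_deriv[OF k'], of "\<lambda>s. \<omega> * s" \<omega> s] by (auto intro!: derivative_eq_intros)
  have dS: "(?S has_real_derivative ?G s * \<omega>) (at s)" for s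
    using DERIV_chain2[OF gsin_deriv, of "\<lambda>s. \<omega> * s" \<omega> s] by (auto intro!: derivative_eq_intros)
  \<comment> \<open>The given rotation is composed with the inverse of the standard one of speed
    \<omega>. Both entries of the product have zero derivative, so it stays the identity.\<close>
  have "((\<lambda>s. c s * ?G s + k * d s * ?S s) has_real_derivative 0) (at s)" for s
    by (rule derivative_eq_intros dc dd dG dS refl)+ (simp add: algebra_simps)
  from DERIV_isconst_all[of _ _ 0, OF allI[OF this]] have A: "c s * ?G s + k * d s * ?S s = 1" for s
    by (simp add: z)
  have "((\<lambda>s. d s * ?G s - c s * ?S s) has_real_derivative 0) (at s)" for s
    by (rule derivative_eq_intros dc dd dG dS refl)+ (simp add: algebra_simps)
  from DERIV_isconst_all[of _ _ 0, OF allI[OF this]] have B: "d s * ?G s - c s * ?S s = 0" for s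
    by (simp add: z)
  have P: "?G s * ?G s + k * (?S s * ?S s) = 1" for s
    using gcos_gsin_squared[OF k', of "\<omega> * s"] by (simp add: power2_eq_square)
  show ?thesis
  proof (rule that)
    fix s
    have "c s = c s * (?G s * ?G s + k * (?S s * ?S s))" by (simp add: P)
    also have "\<dots> = ?G s * (c s * ?G s + k * d s * ?S s) - k * ?S s * (d s * ?G s - c s * ?S s)"
      by (simp add: algebra_simps)
    finally show "c s = ?G s" by (simp add: A B)
    have "d s = d s * (?G s * ?G s + k * (?S s * ?S s))" by (simp add: P)
    also have "\<dots> = ?S s * (c s * ?G s + k * d s * ?S s) + ?G s * (d s * ?G s - c s * ?S s)"
      by (simp add: algebra_simps)
    finally show "d s = ?S s" by (simp add: A B)
  qed
qed

text \<open>The angle whose generalized sine \<open>gsin (-k)\<close> is \<open>z\<close>. Applied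
  to q / r it is the polar angle of a point (p, q) with p > 0 in the plane of the rotation; the
  explicit formula makes its continuity evident.\<close>

definition gang :: "real \<Rightarrow> real \<Rightarrow> real" where
  "gang k z = (if k = 1 then arcsin z else arsinh z)"

lemma gang:
  assumes k: "k = 1 \<or> k = -1" and p: "p > 0" and r: "r > 0" "r\<^sup>2 = p\<^sup>2 + k * q\<^sup>2"
  shows "gsin (-k) (gang k (q / r)) = q / r" "gcos (-k) (gang k (q / r)) = p / r"
proof -
  define y z where "y = p / r" and "z = q / r"
  have "y\<^sup>2 + k * z\<^sup>2 = (p\<^sup>2 + k * q\<^sup>2) / r\<^sup>2"
    by (simp add: y_def z_def power_divide add_divide_distrib)
  also have "\<dots> = 1" using r(1) by (simp flip: r(2))
  finally have e: "y\<^sup>2 + k * z\<^sup>2 = 1" .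
  have y: "y > 0" using p r by (simp add: y_def)
  have "gsin (-k) (gang k z) = z \<and> gcos (-k) (gang k z) = y"
  proof (cases "k = 1")
    case True
    have "z\<^sup>2 \<le> 1" using e True zero_le_power2[of y] by (simp only: mult_1)
    then have "\<bar>z\<bar> \<le> 1" by (simp add: abs_square_le_1)
    moreover have "sqrt (1 - z\<^sup>2) = y" using e y True by (intro real_sqrt_unique) auto
    ultimately show ?thesis using True by (simp add: gsin_def gcos_def gang_def abs_le_iff cos_arcsin)
  next
    case False
    then have km: "k = -1" using k by simp
    then have "sqrt (z\<^sup>2 + 1) = y" using e y by (intro real_sqrt_unique) auto
    then show ?thesis using km by (simp add: gcos_def gsin_def gang_def cosh_arsinh_real sinh_arsinh_real)
  qed
  then show "gsin (-k) (gang k (q / r)) = q / r" "gcos (-k) (gang k (q / r)) = p / r"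
    by (simp_all add: y_def z_def)
qed

context mink_frame
begin

text \<open>Each \<open>R s\<close> fixes the complement of the plane, hence preserves the plane
  itself and acts there by a 2 x 2 isometry. Its determinant \<open>D\<close> has square 1, is
  continuous in \<open>s\<close> and equals 1 at 0, so it is always 1. This forces the shape of a
  rotation matrix, and the group law becomes the addition formulas. Nontriviality of the group
  excludes \<omega> = 0.\<close>

lemma rotation_group_in_frame:
  assumes R: "rotation_group (span {u1, u2}) R"
  obtains \<omega> where "\<omega> \<noteq> 0"
    "\<And>s p q a b. R s (fr p q a b) =
      fr (gcos (-k) (\<omega> * s) * p - k * gsin (-k) (\<omega> * s) * q) (gsin (-k) (\<omega> * s) * p + gcos (-k) (\<omega> * s) * q) a b"
proof -
  have lin: "linear (R s)" and iso: "mink (R s v) (R s w) = mink v w" and R0: "R 0 = id"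
    and add: "R (s + t) = R s \<circ> R t" and cont: "continuous_on UNIV (\<lambda>s. R s v)"
    and fixo: "(\<forall>w\<in>span {u1, u2}. mink v w = 0) \<Longrightarrow> R s v = v" for s t v w
    using R unfolding rotation_group_def by blast+
  have Rw: "R s (fr 0 0 a b) = fr 0 0 a b" for s a b
  proof (rule fixo, rule ballI)
    fix w assume w: "w \<in> span {u1, u2}"
    obtain p q a' b' where "w = fr p q a' b'" by (rule fr_surj)
    then show "mink (fr 0 0 a b) w = 0" using w by (simp add: fr_mem_span_u mink_fr)
  qed
  have RV: "\<exists>c d. R s (fr p q 0 0) = fr c d 0 0" for s p q
  proof -
    obtain c d a b where e: "R s (fr p q 0 0) = fr c d a b" by (rule fr_surj)
    have "mink (R s (fr p q 0 0)) (R s (fr 0 0 a' b')) = 0" for a' b'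
      by (simp add: iso mink_fr)
    from this[of 1 0] this[of 0 1] have "a = 0" "b = 0" by (simp_all add: e Rw mink_fr)
    then show ?thesis using e by blast
  qed
  have "\<exists>c d. \<forall>s. R s (fr p q 0 0) = fr (c s) (d s) 0 0" for p q
    using RV[of _ p q] by metis
  then obtain c d p q where cd: "\<And>s. R s (fr 1 0 0 0) = fr (c s) (d s) 0 0"
    and pq: "\<And>s. R s (fr 0 1 0 0) = fr (p s) (q s) 0 0" by metis
  have rel: "k * (c s * c s) + d s * d s = k" "k * (p s * p s) + q s * q s = 1" "k * (c s * p s) + d s * q s = 0" for s
    using iso[of s "fr 1 0 0 0" "fr 1 0 0 0"] iso[of s "fr 0 1 0 0" "fr 0 1 0 0"] iso[of s "fr 1 0 0 0" "fr 0 1 0 0"]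
    by (simp_all add: cd pq mink_fr mult.assoc)
  have init: "c 0 = 1" "d 0 = 0" "p 0 = 0" "q 0 = 1"
    using cd[of 0] pq[of 0] by (simp_all add: R0 fr_eq_iff)
  have ccont: "continuous_on UNIV c" "continuous_on UNIV d" "continuous_on UNIV p" "continuous_on UNIV q"
  proof -
    have "continuous_on UNIV (\<lambda>s. l * mink (R s v) w)" for v w l
      by (intro mink.continuous_on cont continuous_intros)
    from this[of k "fr 1 0 0 0" "fr 1 0 0 0"] this[of 1 "fr 1 0 0 0" "fr 0 1 0 0"]
      this[of k "fr 0 1 0 0" "fr 1 0 0 0"] this[of 1 "fr 0 1 0 0" "fr 0 1 0 0"]
    show "continuous_on UNIV c" "continuous_on UNIV d" "continuous_on UNIV p" "continuous_on UNIV q"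
      by (simp_all add: cd pq mink_fr)
  qed
  define D where "D s = c s * q s - d s * p s" for s
  have D2: "D s * D s = 1" for s
  proof -
    have "(k * (c s * c s) + d s * d s) * (k * (p s * p s) + q s * q s)
        - (k * (c s * p s) + d s * q s) * (k * (c s * p s) + d s * q s) = k * (D s * D s)"
      by (simp add: D_def algebra_simps)
    then have "k * (D s * D s) = k * 1" using rel[of s] by simp
    then show ?thesis using kk(4) mult_cancel_left by blast
  qed
  have D1: "D s = 1" for s
  proof (rule ccontr)
    assume "D s \<noteq> 1"
    then have "D s = -1" using D2[of s] by (simp add: square_eq_1_iff)
    have "continuous_on UNIV D" unfolding D_def[abs_def] by (intro continuous_intros ccont)
    then have "connected (D ` UNIV)" by (intro connected_continuous_image) auto
    then have "is_interval (D ` UNIV)" by (simp add: is_interval_connected_1)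
    moreover have "D 0 = 1" using init by (simp add: D_def)
    then have "-1 \<in> D ` UNIV" "1 \<in> D ` UNIV" using \<open>D s = -1\<close> by (metis rangeI)+
    ultimately have "0 \<in> D ` UNIV" using mem_is_interval_1_I[of "D ` UNIV" "-1" 1 0] by simp
    then show False using D2 by (metis imageE mult_zero_left zero_neq_one)
  qed
  have sq: "c s * c s + k * (d s * d s) = 1" for s
    using arg_cong[OF rel(1)[of s], of "\<lambda>x. k * x"] by (simp add: algebra_simps)
  have q: "q s = c s" for s
  proof -
    have "q s = q s * (c s * c s + k * (d s * d s))" by (simp add: sq)
    also have "\<dots> = c s * D s + k * d s * (k * (c s * p s) + d s * q s)"
      by (simp add: D_def algebra_simps)
    finally show ?thesis by (simp add: D1 rel)
  qed
  have p: "p s = - k * d s" for s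
  proof -
    have "p s = p s * (c s * c s + k * (d s * d s))" by (simp add: sq)
    also have "\<dots> = k * c s * (k * (c s * p s) + d s * q s) - k * d s * D s"
      by (simp add: D_def algebra_simps)
    finally show ?thesis by (simp add: D1 rel)
  qed
  have Rfr: "R s (fr x y a b) = fr (c s * x - k * d s * y) (d s * x + c s * y) a b" for s x y a b
  proof -
    have "fr x y a b = x *\<^sub>R fr 1 0 0 0 + y *\<^sub>R fr 0 1 0 0 + fr 0 0 a b" by (simp add: fr_ops)
    then have "R s (fr x y a b) = x *\<^sub>R R s (fr 1 0 0 0) + y *\<^sub>R R s (fr 0 1 0 0) + R s (fr 0 0 a b)"
      by (simp add: linear_add[OF lin] linear_scale[OF lin])
    then show ?thesis by (simp add: cd pq Rw fr_ops p q algebra_simps)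
  qed
  have "fr (c (s + t)) (d (s + t)) 0 0 = R s (R t (fr 1 0 0 0))" for s t
    using cd[of "s + t"] by (simp add: add)
  then have addf: "c (s + t) = c s * c t - k * d s * d t" "d (s + t) = d s * c t + c s * d t" for s t
    by (simp_all add: cd Rfr fr_eq_iff)
  obtain \<omega> where \<omega>: "\<And>s. c s = gcos (-k) (\<omega> * s)" "\<And>s. d s = gsin (-k) (\<omega> * s)"
    by (rule gcos_gsin_unique[OF k ccont(1,2) init(1,2) addf])
      (use sq in \<open>auto simp: power2_eq_square\<close>)
  have "\<omega> \<noteq> 0"
  proof
    assume "\<omega> = 0"
    have "R s v = v" for s v
    proof -
      obtain x y a b where "v = fr x y a b" by (rule fr_surj)
      then show ?thesis using \<open>\<omega> = 0\<close> by (simp add: Rfr \<omega>)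
    qed
    then show False using R unfolding rotation_group_def by (metis eq_id_iff)
  qed
  then show ?thesis using that Rfr unfolding \<omega> by blast
qed

end

section \<open>Surfaces of revolution over a profile curve\<close>

text \<open>The sum of the principal curvatures is the trace of the second fundamental form with
  respect to the first. When the latter is \<open>u\<close> times the identity, the principal frame
  is a scaled orthogonal basis: the second vector is the first one turned by a right angle, up to
  the sign \<open>D\<close>.\<close>

lemma conformal_trace:
  fixes a1 a2 b1 b2 u L M N :: real
  assumes u: "u * (a1 * a1 + a2 * a2) = 1" "u * (b1 * b1 + b2 * b2) = 1" "u * (a1 * b1 + a2 * b2) = 0"
  shows "u * (a1 * (a1 * L + a2 * M) + a2 * (a1 * M + a2 * N) + b1 * (b1 * L + b2 * M) + b2 * (b1 * M + b2 * N)) = L + N"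
proof -
  have o: "a1 * b1 + a2 * b2 = 0" using u by auto
  define D where "D = u * (a1 * b2 - a2 * b1)"
  have b1: "b1 = - D * a2"
  proof -
    have "b1 = b1 * (u * (a1 * a1 + a2 * a2))" by (simp add: u)
    also have "\<dots> = u * a1 * (a1 * b1 + a2 * b2) - D * a2" by (simp add: D_def algebra_simps)
    finally show ?thesis by (simp add: o)
  qed
  have b2: "b2 = D * a1"
  proof -
    have "b2 = b2 * (u * (a1 * a1 + a2 * a2))" by (simp add: u)
    also have "\<dots> = u * a2 * (a1 * b1 + a2 * b2) + D * a1" by (simp add: D_def algebra_simps)
    finally show ?thesis by (simp add: o)
  qed
  have "D * D = D * D * (u * (a1 * a1 + a2 * a2))" by (simp add: u)
  also have "\<dots> = u * (b1 * b1 + b2 * b2)" by (simp add: b1 b2 algebra_simps)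
  finally have DD: "D * D = 1" by (simp add: u)
  have "u * (a1 * (a1 * L + a2 * M) + a2 * (a1 * M + a2 * N) + b1 * (b1 * L + b2 * M) + b2 * (b1 * M + b2 * N))
      = u * (a1 * a1 * L + 2 * a1 * a2 * M + a2 * a2 * N + (D * D) * (a2 * a2 * L - 2 * a1 * a2 * M + a1 * a1 * N))"
    by (simp add: b1 b2 algebra_simps)
  also have "\<dots> = (u * (a1 * a1 + a2 * a2)) * (L + N)" unfolding DD by (simp add: algebra_simps)
  finally show ?thesis by (simp add: u)
qed

text \<open>In the frame of the meridian plane, \<open>(r, a, b)\<close> is the position, \<open>(r1, a1, b1)\<close> the velocity and
  \<open>(r2, a2, b2)\<close> the acceleration of the profile curve, and \<open>(y, y1, y2)\<close> is the unit normal of the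
  surface. The orthogonal complement of position and velocity is a line, so the normal is
  \<open>\<plusminus>(\<nu>, N1, N2)\<close>, and the equation follows since \<open>(Z, Z1, Z2)\<close>, the defect of
  \<open>\<Delta>F = 2 u F + 2 H u n\<close>, is orthogonal to all three vectors.\<close>

lemma cmc_algebra:
  fixes k r a b r1 a1 b1 r2 a2 b2 u m H :: real
  assumes k: "k * k = 1" and r: "r > 0" "u = r * r" "u = a * a - k * b * b - k" and m: "m = r * r1" "m = a * a1 - k * b * b1"
    and conf: "k * r1 * r1 - k * a1 * a1 + b1 * b1 = u"
    and conf': "k * r1 * r2 - k * a1 * a2 + b1 * b2 = m"
    and rr: "r * r2 + r1 * r1 = a1 * a1 + a * a2 - k * (b1 * b1 + b * b2)"
    and n: "k * y * y - k * y1 * y1 + y2 * y2 = 1" "k * y * r - k * y1 * a + y2 * b = 0"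
      "k * y * r1 - k * y1 * a1 + y2 * b1 = 0"
    and H: "2 * H * u = - r * y + k * y * r2 - k * y1 * a2 + y2 * b2"
  obtains \<epsilon> where "\<epsilon> = 1 \<or> \<epsilon> = -1"
    "a2 = 2 * u * a - 2 * (\<epsilon> * H) * (u * b1 - m * b)" "b2 = 2 * u * b - 2 * (\<epsilon> * H) * k * (u * a1 - m * a)"
proof -
  have k2: "k * (k * z) = z" for z using k by (metis mult.assoc mult_1)
  have u: "u > 0" using r by simp
  \<comment> \<open>(\<nu>, N1, N2) is the cross product of position and velocity with its indices
    raised by the indefinite form, multiplied by -k / r. The component r1 is eliminated through m =
    r r1.\<close>
  define N1 where "N1 = - (u * b1 - m * b) / u"
  define N2 where "N2 = - k * (u * a1 - m * a) / u"
  define \<nu> where "\<nu> = - (a * b1 - b * a1) / r"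
  have uN: "u * N1 = - (u * b1 - m * b)" "u * N2 = - k * (u * a1 - m * a)" "r * \<nu> = - (a * b1 - b * a1)"
    using u r by (auto simp: N1_def N2_def \<nu>_def)
  have rnu: "r * \<nu> = a * N1 - k * b * N2"
  proof -
    have "u * (a * N1 - k * b * N2) = a * (u * N1) - k * b * (u * N2)" by (simp add: algebra_simps)
    also have "\<dots> = u * (r * \<nu>)" unfolding uN by (simp add: algebra_simps k2)
    finally show ?thesis using u by simp
  qed
  \<comment> \<open>A vector orthogonal to position and velocity is the multiple \<open>s\<close> of
    (\<nu>, N1, N2), where \<open>s\<close> is its product with that vector. This is used twice: for
    the given normal, and for the defect \<open>Z\<close>.\<close>
  have par: "z1 = N1 * s" "z2 = N2 * s" "z = \<nu> * s"
    if z: "k * z * r - k * z1 * a + z2 * b = 0" "k * z * r1 - k * z1 * a1 + z2 * b1 = 0"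
      and s: "s = k * z * \<nu> - k * z1 * N1 + z2 * N2"
      and unit: "k * \<nu> * \<nu> - k * N1 * N1 + N2 * N2 = 1" for z z1 z2 s
  proof -
    have "k * (k * z * r - k * z1 * a + z2 * b) = z * r - z1 * a + k * z2 * b"
      by (simp add: algebra_simps k2)
    then have zr: "z * r = a * z1 - k * b * z2" unfolding z(1) by (simp add: algebra_simps)
    have "r * (r * (k * z * r1 - k * z1 * a1 + z2 * b1)) = k * (r * r1) * (z * r) - k * (r * r) * a1 * z1 + (r * r) * b1 * z2"
      by (simp add: algebra_simps)
    also have "\<dots> = k * m * (z * r) - k * u * a1 * z1 + u * b1 * z2" by (simp add: m(1) r(2))
    also have "\<dots> = (u * N2) * z1 - (u * N1) * z2" unfolding uN zr by (simp add: algebra_simps k2)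
    finally have "u * (N2 * z1) = u * (N1 * z2)" unfolding z(2) by (simp add: mult.assoc)
    then have NZ: "N2 * z1 = N1 * z2" using u by simp
    have "r * (\<nu> * z1) = (a * N1 - k * b * N2) * z1" by (metis rnu mult.assoc)
    also have "\<dots> = a * N1 * z1 - k * b * (N2 * z1)" by (simp add: algebra_simps)
    also have "\<dots> = N1 * (a * z1 - k * b * z2)" unfolding NZ by (simp add: algebra_simps)
    also have "\<dots> = r * (N1 * z)" unfolding zr[symmetric] by (simp add: algebra_simps)
    finally have v1: "\<nu> * z1 = N1 * z" using r(1) by simp
    have "r * (\<nu> * z2) = (a * N1 - k * b * N2) * z2" by (metis rnu mult.assoc)
    also have "\<dots> = a * (N1 * z2) - k * b * N2 * z2" by (simp add: algebra_simps)
    also have "\<dots> = N2 * (a * z1 - k * b * z2)" unfolding NZ[symmetric] by (simp add: algebra_simps)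
    also have "\<dots> = r * (N2 * z)" unfolding zr[symmetric] by (simp add: algebra_simps)
    finally have v2: "\<nu> * z2 = N2 * z" using r(1) by simp
    have "z1 = z1 * (k * \<nu> * \<nu> - k * N1 * N1 + N2 * N2)" by (simp add: unit)
    also have "\<dots> = k * \<nu> * (\<nu> * z1) - k * N1 * N1 * z1 + N2 * (N2 * z1)" by (simp add: algebra_simps)
    also have "\<dots> = N1 * s" unfolding v1 NZ s by (simp add: algebra_simps)
    finally show "z1 = N1 * s" .
    have "z2 = z2 * (k * \<nu> * \<nu> - k * N1 * N1 + N2 * N2)" by (simp add: unit)
    also have "\<dots> = k * \<nu> * (\<nu> * z2) - k * N1 * (N1 * z2) + N2 * N2 * z2" by (simp add: algebra_simps)
    also have "\<dots> = N2 * s" unfolding v2 NZ[symmetric] s by (simp add: algebra_simps)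
    finally show "z2 = N2 * s" .
    have "z = z * (k * \<nu> * \<nu> - k * N1 * N1 + N2 * N2)" by (simp add: unit)
    also have "\<dots> = k * \<nu> * \<nu> * z - k * N1 * (N1 * z) + N2 * (N2 * z)" by (simp add: algebra_simps)
    also have "\<dots> = \<nu> * s" unfolding v1[symmetric] v2[symmetric] s by (simp add: algebra_simps)
    finally show "z = \<nu> * s" .
  qed
  have au: "a * a - k * b * b = u + k" using r(3) by simp
  have tang: "u * (a1 * a1 - k * b1 * b1) = m * m - k * u * u"
  proof -
    have "k * u * u = k * (r * r) * (k * r1 * r1 - k * a1 * a1 + b1 * b1)" by (simp add: r(2) conf)
    also have "\<dots> = (r * r1) * (r * r1) - (r * r) * (a1 * a1 - k * b1 * b1)" by (simp add: algebra_simps k2)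
    finally show ?thesis by (simp add: m(1)[symmetric] r(2)[symmetric])
  qed
  have unit: "k * \<nu> * \<nu> - k * N1 * N1 + N2 * N2 = 1"
  proof -
    let ?D = "a * b1 - b * a1"
    have mm: "(u + k) * (a1 * a1 - k * b1 * b1) = m * m - k * ?D * ?D"
      unfolding au[symmetric] m(2) by (simp add: algebra_simps k2)
    have "u * (m * m - k * ?D * ?D) = (u + k) * (u * (a1 * a1 - k * b1 * b1))"
      unfolding mm[symmetric] by (simp add: algebra_simps)
    also have "\<dots> = (u + k) * (m * m - k * u * u)" by (simp only: tang)
    finally have kD: "k * u * (?D * ?D) = u * (m * m) - (u + k) * (m * m - k * u * u)"
      by (simp add: algebra_simps)
    have "u * u * (k * \<nu> * \<nu> - k * N1 * N1 + N2 * N2) = k * u * ((r * \<nu>) * (r * \<nu>)) - k * (u * N1) * (u * N1) + (u * N2) * (u * N2)"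
      by (simp add: r(2) algebra_simps)
    also have "\<dots> = k * u * (?D * ?D) - k * (u * b1 - m * b) * (u * b1 - m * b) + (u * a1 - m * a) * (u * a1 - m * a)"
      unfolding uN by (simp add: algebra_simps k2)
    also have "\<dots> = k * u * (?D * ?D) + u * (u * (a1 * a1 - k * b1 * b1)) - 2 * u * m * (a * a1 - k * b * b1) + m * m * (a * a - k * b * b)"
      by (simp add: algebra_simps)
    also have "\<dots> = u * u"
      unfolding kD tang au m(2)[symmetric] by (simp add: algebra_simps k2)
    finally show ?thesis using u by simp
  qed
  \<comment> \<open>The product of the given normal with the explicit one; both are unit vectors on
    the same line.\<close>
  define \<epsilon> where "\<epsilon> = k * y * \<nu> - k * y1 * N1 + y2 * N2"
  note ny = par[OF n(2,3) \<epsilon>_def unit]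
  have "1 = \<epsilon> * \<epsilon> * (k * \<nu> * \<nu> - k * N1 * N1 + N2 * N2)"
    using n(1) by (simp add: ny algebra_simps)
  then have "\<epsilon> * \<epsilon> = 1" by (simp add: unit)
  then have \<epsilon>: "\<epsilon> = 1 \<or> \<epsilon> = -1" by (simp add: square_eq_1_iff)
  \<comment> \<open>The term - k r is the second derivative in the direction of rotation at angle 0,
    so r2 - k r is the first component of the Laplacian there.\<close>
  define Z where "Z = r2 - k * r - 2 * u * r - 2 * H * u * y"
  define Z1 where "Z1 = a2 - 2 * u * a - 2 * H * u * y1"
  define Z2 where "Z2 = b2 - 2 * u * b - 2 * H * u * y2"
  have ztt: "k * r2 * r - k * a2 * a + b2 * b = - u"
  proof -
    have "k * r2 * r - k * a2 * a + b2 * b = k * (r * r2 + r1 * r1) - k * r1 * r1 - k * (a * a2) + b2 * b" by (simp add: algebra_simps)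
    also have "\<dots> = - (k * r1 * r1 - k * a1 * a1 + b1 * b1)" unfolding rr by (simp add: algebra_simps k2 k)
    finally show ?thesis by (simp add: conf)
  qed
  have z1: "k * Z * r - k * Z1 * a + Z2 * b = 0"
  proof -
    have "k * Z * r - k * Z1 * a + Z2 * b = (k * r2 * r - k * a2 * a + b2 * b) - k * k * (r * r)
        - 2 * u * (k * (r * r) - k * a * a + b * b) - 2 * H * u * (k * y * r - k * y1 * a + y2 * b)"
      by (simp add: Z_def Z1_def Z2_def algebra_simps)
    also have "k * (r * r) - k * a * a + b * b = -1"
      unfolding r(2)[symmetric] r(3) by (simp add: algebra_simps k k2)
    finally show ?thesis by (simp add: ztt n k r(2)[symmetric])
  qed
  have z2: "k * Z * r1 - k * Z1 * a1 + Z2 * b1 = 0"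
  proof -
    have "k * Z * r1 - k * Z1 * a1 + Z2 * b1 = (k * r1 * r2 - k * a1 * a2 + b1 * b2) - k * k * (r * r1)
        - 2 * u * k * (r * r1 - (a * a1 - k * b * b1) ) - 2 * H * u * (k * y * r1 - k * y1 * a1 + y2 * b1)"
      by (simp add: Z_def Z1_def Z2_def algebra_simps k2)
    then show ?thesis by (simp add: conf' n k m(1)[symmetric] m(2)[symmetric])
  qed
  have "k * Z * y - k * Z1 * y1 + Z2 * y2 = (- r * y + k * y * r2 - k * y1 * a2 + y2 * b2)
      - 2 * u * (k * y * r - k * y1 * a + y2 * b) - 2 * H * u * (k * y * y - k * y1 * y1 + y2 * y2)"
    by (simp add: Z_def Z1_def Z2_def algebra_simps k2)
  then have z3: "k * Z * y - k * Z1 * y1 + Z2 * y2 = 0" using H by (simp add: n)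
  have "k * Z * y - k * Z1 * y1 + Z2 * y2 = \<epsilon> * (k * Z * \<nu> - k * Z1 * N1 + Z2 * N2)"
    by (simp add: ny algebra_simps)
  then have "k * Z * \<nu> - k * Z1 * N1 + Z2 * N2 = 0" using z3 \<epsilon> by auto
  from par(1,2)[OF z1 z2 this[symmetric] unit] have "Z1 = 0" "Z2 = 0" by simp_all
  then have "a2 = 2 * u * a + 2 * H * \<epsilon> * (u * N1)" "b2 = 2 * u * b + 2 * H * \<epsilon> * (u * N2)"
    by (simp_all add: Z1_def Z2_def ny algebra_simps)
  then show ?thesis using that[OF \<epsilon>] unfolding uN by (simp add: algebra_simps)
qed

lemma product_has_derivative:
  fixes c \<rho> :: "real \<Rightarrow> real"
  assumes "(c has_real_derivative c') (at (fst z))" "(\<rho> has_real_derivative \<rho>') (at (snd z))"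
  shows "((\<lambda>z. c (fst z) * \<rho> (snd z)) has_derivative
    (\<lambda>h. fst h * (c' * \<rho> (snd z)) + snd h * (c (fst z) * \<rho>'))) (at z)"
proof -
  have 1: "((\<lambda>z. c (fst z)) has_derivative (\<lambda>h. fst h * c')) (at z)"
    by (rule DERIV_compose_FDERIV[where g = fst, OF assms(1)]) (auto intro!: derivative_intros)
  have 2: "((\<lambda>z. \<rho> (snd z)) has_derivative (\<lambda>h. snd h * \<rho>')) (at z)"
    by (rule DERIV_compose_FDERIV[where g = snd, OF assms(2)]) (auto intro!: derivative_intros)
  show ?thesis
    by (rule has_derivative_eq_rhs[OF has_derivative_mult[OF 1 2]]) (auto simp: algebra_simps)
qed

section \<open>The patch obtained by rotating a profile curve, with its derivatives\<close>

context mink_frame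
begin

text \<open>For the point \<open>fr r 0 a b\<close> the equation of the hyperboloid reads r^2 = a^2
  - k b^2 - k. With r^2 given by this polynomial, the profile equation is polynomial in (a, b) and
  their velocities.\<close>

definition usq :: "real \<Rightarrow> real \<Rightarrow> real" where
  "usq a b = a * a - k * b * b - k"

definition rad :: "(real \<Rightarrow> real) \<Rightarrow> (real \<Rightarrow> real) \<Rightarrow> real \<Rightarrow> real" where
  "rad a b t = sqrt (usq (a t) (b t))"

definition rad' :: "(real \<Rightarrow> real) \<Rightarrow> (real \<Rightarrow> real) \<Rightarrow> (real \<Rightarrow> real) \<Rightarrow> (real \<Rightarrow> real) \<Rightarrow> real \<Rightarrow> real" where
  "rad' a a1 b b1 t = (a t * a1 t - k * b t * b1 t) / rad a b t"

definition rad'' where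
  "rad'' a a1 a2 b b1 b2 t =
     (a1 t * a1 t + a t * a2 t - k * (b1 t * b1 t + b t * b2 t) - rad' a a1 b b1 t * rad' a a1 b b1 t) / rad a b t"

definition regular_profile where
  "regular_profile J a a1 a2 b b1 b2 \<longleftrightarrow>
     (\<forall>t\<in>J. (a has_real_derivative a1 t) (at t) \<and> (a1 has_real_derivative a2 t) (at t) \<and>
        (b has_real_derivative b1 t) (at t) \<and> (b1 has_real_derivative b2 t) (at t) \<and>
        usq (a t) (b t) > 0 \<and> (a1 t \<noteq> 0 \<or> b1 t \<noteq> 0)) \<and>
     continuous_on J a2 \<and> continuous_on J b2"

definition patch :: "(real \<Rightarrow> real) \<Rightarrow> (real \<Rightarrow> real) \<Rightarrow> real \<times> real \<Rightarrow> mink_space" where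
  "patch a b z = fr (gcos (-k) (fst z) * rad a b (snd z)) (gsin (-k) (fst z) * rad a b (snd z)) (a (snd z)) (b (snd z))"

lemma k': "- k = 1 \<or> - k = -1"
  using k by auto

lemma rad_pos: "usq (a t) (b t) > 0 \<Longrightarrow> rad a b t > 0"
  by (simp add: rad_def)

lemma rad_squared: "usq (a t) (b t) > 0 \<Longrightarrow> rad a b t * rad a b t = usq (a t) (b t)"
  by (simp add: rad_def)

lemma rad_deriv:
  assumes "(a has_real_derivative a1 t) (at t)" "(b has_real_derivative b1 t) (at t)" "usq (a t) (b t) > 0"
  shows "(rad a b has_real_derivative rad' a a1 b b1 t) (at t)"
proof -
  have "((\<lambda>t. usq (a t) (b t)) has_real_derivative 2 * (a t * a1 t - k * b t * b1 t)) (at t)"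
    unfolding usq_def by (rule derivative_eq_intros assms refl)+ (simp add: algebra_simps)
  note DERIV_chain2[OF DERIV_real_sqrt[OF assms(3)] this]
  moreover have "inverse (sqrt (usq (a t) (b t))) / 2 * (2 * (a t * a1 t - k * b t * b1 t)) = rad' a a1 b b1 t"
    unfolding rad'_def rad_def by (simp only: divide_inverse) simp
  moreover have "rad a b = (\<lambda>t. sqrt (usq (a t) (b t)))" by (simp add: fun_eq_iff rad_def)
  ultimately show ?thesis by (simp only:)
qed

lemma rad'_deriv:
  assumes "(a has_real_derivative a1 t) (at t)" "(b has_real_derivative b1 t) (at t)" "usq (a t) (b t) > 0"
    and "(a1 has_real_derivative a2 t) (at t)" "(b1 has_real_derivative b2 t) (at t)"
  shows "(rad' a a1 b b1 has_real_derivative rad'' a a1 a2 b b1 b2 t) (at t)"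
proof -
  have r: "rad a b t > 0" using assms(3) by (rule rad_pos)
  have "((\<lambda>t. (a t * a1 t - k * b t * b1 t) / rad a b t) has_real_derivative
     ((a1 t * a1 t + a t * a2 t - k * (b1 t * b1 t + b t * b2 t)) * rad a b t
        - (a t * a1 t - k * b t * b1 t) * rad' a a1 b b1 t) / (rad a b t * rad a b t)) (at t)"
    by (rule derivative_eq_intros assms rad_deriv[of a a1 t b b1, OF assms(1-3)] refl)+ (use r in \<open>auto simp: algebra_simps\<close>)
  moreover have "a t * a1 t - k * b t * b1 t = rad' a a1 b b1 t * rad a b t" using r by (simp add: rad'_def)
  ultimately have "((\<lambda>t. (a t * a1 t - k * b t * b1 t) / rad a b t) has_real_derivative
     ((a1 t * a1 t + a t * a2 t - k * (b1 t * b1 t + b t * b2 t)) * rad a b t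
        - (rad' a a1 b b1 t * rad a b t) * rad' a a1 b b1 t) / (rad a b t * rad a b t)) (at t)"
    by simp
  moreover have "((a1 t * a1 t + a t * a2 t - k * (b1 t * b1 t + b t * b2 t)) * rad a b t
        - (rad' a a1 b b1 t * rad a b t) * rad' a a1 b b1 t) / (rad a b t * rad a b t) = rad'' a a1 a2 b b1 b2 t"
    using r by (simp add: rad''_def field_simps)
  ultimately show ?thesis by (simp add: rad'_def[abs_def])
qed

lemma fr_has_derivative:
  assumes "(p has_derivative p') F" "(q has_derivative q') F" "(a has_derivative a') F" "(b has_derivative b') F"
  shows "((\<lambda>z. fr (p z) (q z) (a z) (b z)) has_derivative (\<lambda>h. fr (p' h) (q' h) (a' h) (b' h))) F"
  unfolding fr_def by (intro derivative_intros assms)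

lemma continuous_on_fr:
  assumes "continuous_on U p" "continuous_on U q" "continuous_on U a" "continuous_on U b"
  shows "continuous_on U (\<lambda>z. fr (p z) (q z) (a z) (b z))"
  unfolding fr_def by (intro continuous_intros assms)

lemma snd_has_derivative:
  fixes a :: "real \<Rightarrow> real"
  assumes "(a has_real_derivative d) (at (snd z))"
  shows "((\<lambda>z. a (snd z)) has_derivative (\<lambda>h. snd h * d)) (at z)"
  by (rule DERIV_compose_FDERIV[where g = snd, OF assms]) (auto intro!: derivative_intros)

text \<open>The derivative in the angle is a nonzero vector in the plane of the rotation because the
  radius is positive, whereas the derivative in \<open>t\<close> has a nonzero component in the
  complementary plane. Hence they are independent.\<close>

lemma patch_immersion:
  assumes J: "open J" and R: "regular_profile J a a1 a2 b b1 b2"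
  shows "immersion_on (UNIV \<times> J) (patch a b)"
    and "\<And>z v. z \<in> UNIV \<times> J \<Longrightarrow> frechet_derivative (patch a b) (at z) v =
      fst v *\<^sub>R fr (- k * gsin (-k) (fst z) * rad a b (snd z)) (gcos (-k) (fst z) * rad a b (snd z)) 0 0 +
      snd v *\<^sub>R fr (gcos (-k) (fst z) * rad' a a1 b b1 (snd z)) (gsin (-k) (fst z) * rad' a a1 b b1 (snd z)) (a1 (snd z)) (b1 (snd z))"
    and "\<And>z v w. z \<in> UNIV \<times> J \<Longrightarrow> frechet_derivative (\<lambda>y. frechet_derivative (patch a b) (at y) v) (at z) w =
      fst v *\<^sub>R (fst w *\<^sub>R fr (- k * gcos (-k) (fst z) * rad a b (snd z)) (- k * gsin (-k) (fst z) * rad a b (snd z)) 0 0 +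
         snd w *\<^sub>R fr (- k * gsin (-k) (fst z) * rad' a a1 b b1 (snd z)) (gcos (-k) (fst z) * rad' a a1 b b1 (snd z)) 0 0) +
      snd v *\<^sub>R (fst w *\<^sub>R fr (- k * gsin (-k) (fst z) * rad' a a1 b b1 (snd z)) (gcos (-k) (fst z) * rad' a a1 b b1 (snd z)) 0 0 +
         snd w *\<^sub>R fr (gcos (-k) (fst z) * rad'' a a1 a2 b b1 b2 (snd z)) (gsin (-k) (fst z) * rad'' a a1 a2 b b1 b2 (snd z))
            (a2 (snd z)) (b2 (snd z)))"
proof -
  let ?G = "\<lambda>z. gcos (-k) (fst z)" and ?S = "\<lambda>z. gsin (-k) (fst z)"
  let ?r = "\<lambda>z. rad a b (snd z)" and ?r1 = "\<lambda>z. rad' a a1 b b1 (snd z)" and ?r2 = "\<lambda>z. rad'' a a1 a2 b b1 b2 (snd z)"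
  let ?f1 = "\<lambda>z. fr (- k * ?S z * ?r z) (?G z * ?r z) 0 0"
  let ?f2 = "\<lambda>z. fr (?G z * ?r1 z) (?S z * ?r1 z) (a1 (snd z)) (b1 (snd z))"
  have d: "(a has_real_derivative a1 t) (at t)" "(a1 has_real_derivative a2 t) (at t)"
    "(b has_real_derivative b1 t) (at t)" "(b1 has_real_derivative b2 t) (at t)"
    "usq (a t) (b t) > 0" "a1 t \<noteq> 0 \<or> b1 t \<noteq> 0"
    "(rad a b has_real_derivative rad' a a1 b b1 t) (at t)"
    "(rad' a a1 b b1 has_real_derivative rad'' a a1 a2 b b1 b2 t) (at t)" if "t \<in> J" for t
  proof -
    show dd: "(a has_real_derivative a1 t) (at t)" "(a1 has_real_derivative a2 t) (at t)"
      "(b has_real_derivative b1 t) (at t)" "(b1 has_real_derivative b2 t) (at t)"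
      "usq (a t) (b t) > 0" "a1 t \<noteq> 0 \<or> b1 t \<noteq> 0"
      using R that by (auto simp: regular_profile_def)
    show "(rad a b has_real_derivative rad' a a1 b b1 t) (at t)"
      by (rule rad_deriv[of a a1 t b b1, OF dd(1,3,5)])
    show "(rad' a a1 b b1 has_real_derivative rad'' a a1 a2 b b1 b2 t) (at t)"
      by (rule rad'_deriv[of a a1 t b b1 a2 b2, OF dd(1,3,5,2,4)])
  qed
  have g: "(gcos (-k) has_real_derivative - k * gsin (-k) s) (at s)"
      "((\<lambda>s. - k * gsin (-k) s) has_real_derivative - k * gcos (-k) s) (at s)"
      "(gsin (-k) has_real_derivative gcos (-k) s) (at s)" for s
    using gcos_deriv[OF k'] gsin_deriv by (auto intro!: derivative_eq_intros)
  have cJ: "continuous_on J f" if "\<And>t. t \<in> J \<Longrightarrow> (f has_real_derivative f' t) (at t)" for f f' :: "real \<Rightarrow> real"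
    using that DERIV_isCont continuous_at_imp_continuous_on by blast
  have c2: "continuous_on J a2" "continuous_on J b2" using R by (auto simp: regular_profile_def)
  have r0: "\<forall>t\<in>J. rad a b t \<noteq> 0"
    using rad_pos[of a _ b] d(5) by (metis less_irrefl)
  have cr2: "continuous_on J (rad'' a a1 a2 b b1 b2)"
    unfolding rad''_def[abs_def] using r0
    by (intro continuous_intros cJ[OF d(1)] cJ[OF d(2)] cJ[OF d(3)] cJ[OF d(4)] cJ[OF d(7)] cJ[OF d(8)] c2)
      auto
  have cU: "continuous_on (UNIV \<times> J) (\<lambda>z. f (snd z))" if "continuous_on J f" for f :: "real \<Rightarrow> real"
    by (rule continuous_on_compose2[OF that]) (auto intro: continuous_intros)
  have cG: "continuous_on (UNIV \<times> J) ?G" "continuous_on (UNIV \<times> J) ?S"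
  proof -
    have "continuous_on UNIV (gcos (-k))" "continuous_on UNIV (gsin (-k))"
      using DERIV_isCont[OF g(1)] DERIV_isCont[OF g(3)] by (simp_all add: continuous_at_imp_continuous_on)
    then show "continuous_on (UNIV \<times> J) ?G" "continuous_on (UNIV \<times> J) ?S"
      by (auto elim!: continuous_on_compose2 intro: continuous_on_fst)
  qed
  have zero: "((\<lambda>z. 0) has_derivative (\<lambda>h. 0)) F" for F :: "(real \<times> real) filter" by (rule has_derivative_const)
  have D: "open (UNIV \<times> J)"
    "(patch a b has_derivative (\<lambda>h. fst h *\<^sub>R ?f1 z + snd h *\<^sub>R ?f2 z)) (at z)"
    "(?f1 has_derivative (\<lambda>h. fst h *\<^sub>R fr (- k * ?G z * ?r z) (- k * ?S z * ?r z) 0 0 +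
         snd h *\<^sub>R fr (- k * ?S z * ?r1 z) (?G z * ?r1 z) 0 0)) (at z)"
    "(?f2 has_derivative (\<lambda>h. fst h *\<^sub>R fr (- k * ?S z * ?r1 z) (?G z * ?r1 z) 0 0 +
         snd h *\<^sub>R fr (?G z * ?r2 z) (?S z * ?r2 z) (a2 (snd z)) (b2 (snd z)))) (at z)"
    if "z \<in> UNIV \<times> J" for z
  proof -
    have z: "snd z \<in> J" using that by auto
    show "open (UNIV \<times> J)" by (rule open_Times[OF open_UNIV J])
    show "(patch a b has_derivative (\<lambda>h. fst h *\<^sub>R ?f1 z + snd h *\<^sub>R ?f2 z)) (at z)"
      unfolding patch_def[abs_def]
      by (rule has_derivative_eq_rhs[OF fr_has_derivative[OF product_has_derivative[OF g(1) d(7)[OF z]]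
        product_has_derivative[OF g(3) d(7)[OF z]] snd_has_derivative[OF d(1)[OF z]] snd_has_derivative[OF d(3)[OF z]]]])
        (simp add: fr_ops fun_eq_iff fr_eq_iff)
    show "(?f1 has_derivative (\<lambda>h. fst h *\<^sub>R fr (- k * ?G z * ?r z) (- k * ?S z * ?r z) 0 0 +
         snd h *\<^sub>R fr (- k * ?S z * ?r1 z) (?G z * ?r1 z) 0 0)) (at z)"
      by (rule has_derivative_eq_rhs[OF fr_has_derivative[OF product_has_derivative[OF g(2) d(7)[OF z]]
        product_has_derivative[OF g(1) d(7)[OF z]] zero zero]])
        (simp add: fr_ops fun_eq_iff fr_eq_iff)
    show "(?f2 has_derivative (\<lambda>h. fst h *\<^sub>R fr (- k * ?S z * ?r1 z) (?G z * ?r1 z) 0 0 +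
         snd h *\<^sub>R fr (?G z * ?r2 z) (?S z * ?r2 z) (a2 (snd z)) (b2 (snd z)))) (at z)"
      by (rule has_derivative_eq_rhs[OF fr_has_derivative[OF product_has_derivative[OF g(1) d(8)[OF z]]
        product_has_derivative[OF g(3) d(8)[OF z]] snd_has_derivative[OF d(2)[OF z]] snd_has_derivative[OF d(4)[OF z]]]])
        (simp add: fr_ops fun_eq_iff fr_eq_iff)
  qed
  have oU: "open (UNIV \<times> J)" by (rule open_Times[OF open_UNIV J])
  have C: "continuous_on (UNIV \<times> J) (\<lambda>z. fr (- k * ?G z * ?r z) (- k * ?S z * ?r z) 0 0)"
    "continuous_on (UNIV \<times> J) (\<lambda>z. fr (- k * ?S z * ?r1 z) (?G z * ?r1 z) 0 0)"
    "continuous_on (UNIV \<times> J) (\<lambda>z. fr (?G z * ?r2 z) (?S z * ?r2 z) (a2 (snd z)) (b2 (snd z)))"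
    by (intro continuous_on_fr continuous_intros cG cU[OF cJ[OF d(7)]] cU[OF cJ[OF d(8)]] cU[OF cr2] cU[OF c2(1)] cU[OF c2(2)]; assumption)+
  note K = Ck_on_2I[OF oU D(2) D(3) D(4) C(1) C(2) C(2) C(3)]
  show DF: "frechet_derivative (patch a b) (at z) v = fst v *\<^sub>R ?f1 z + snd v *\<^sub>R ?f2 z" if "z \<in> UNIV \<times> J" for z v
    using K(2)[OF _ _ _ that] by blast
  show "frechet_derivative (\<lambda>y. frechet_derivative (patch a b) (at y) v) (at z) w =
      fst v *\<^sub>R (fst w *\<^sub>R fr (- k * ?G z * ?r z) (- k * ?S z * ?r z) 0 0 +
         snd w *\<^sub>R fr (- k * ?S z * ?r1 z) (?G z * ?r1 z) 0 0) +
      snd v *\<^sub>R (fst w *\<^sub>R fr (- k * ?S z * ?r1 z) (?G z * ?r1 z) 0 0 +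
         snd w *\<^sub>R fr (?G z * ?r2 z) (?S z * ?r2 z) (a2 (snd z)) (b2 (snd z)))" if "z \<in> UNIV \<times> J" for z v w
    using K(3)[OF _ _ _ that] by blast
  have "inj (frechet_derivative (patch a b) (at z))" if z: "z \<in> UNIV \<times> J" for z
  proof -
    have lin: "linear (frechet_derivative (patch a b) (at z))"
      using has_derivative_linear[OF D(2)[OF z]] by (simp only: DF[OF z, abs_def])
    have zJ: "snd z \<in> J" using z by auto
    have "v = 0" if "frechet_derivative (patch a b) (at z) v = 0" for v
    proof -
      have "fr (fst v * (- k * ?S z * ?r z) + snd v * (?G z * ?r1 z)) (fst v * (?G z * ?r z) + snd v * (?S z * ?r1 z))
        (snd v * a1 (snd z)) (snd v * b1 (snd z)) = fr 0 0 0 0"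
        using that by (simp add: DF[OF z] fr_ops)
      then have e: "fst v * (- k * ?S z * ?r z) + snd v * (?G z * ?r1 z) = 0" "fst v * (?G z * ?r z) + snd v * (?S z * ?r1 z) = 0"
        "snd v * a1 (snd z) = 0" "snd v * b1 (snd z) = 0"
        by (simp_all only: fr_eq_iff)
      have s: "snd v = 0" using e(3,4) d(6)[OF zJ] by auto
      have r: "?r z > 0" using rad_pos[of a "snd z" b] d(5)[OF zJ] .
      have "?S z * ?S z + k * (?G z * ?G z) \<noteq> 0"
      proof -
        have "?G z * ?G z + k * (?S z * ?S z) = 1" using gcos_gsin_squared[OF k', of "fst z"] by (simp add: power2_eq_square)
        then have "k * (?G z * ?G z + k * (?S z * ?S z)) = k" by simp
        then show ?thesis by (simp add: algebra_simps)
      qed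
      then have "?S z \<noteq> 0 \<or> ?G z \<noteq> 0" by auto
      then have "fst v = 0" using e(1,2) s r by auto
      then show ?thesis using s by (simp add: prod_eq_iff)
    qed
    then show ?thesis using linear_injective_0[OF lin] by blast
  qed
  moreover have "Ck_on 2 (UNIV \<times> J) (patch a b)" using K(1) by blast
  ultimately show "immersion_on (UNIV \<times> J) (patch a b)" by (simp add: immersion_on_def)
qed

end

lemma frechet_derivative_cong_open:
  assumes "open U" "z \<in> U" "\<And>w. w \<in> U \<Longrightarrow> f w = g w"
  shows "frechet_derivative f (at z) = frechet_derivative g (at z)"
proof -
  have "(f has_derivative D) (at z) \<longleftrightarrow> (g has_derivative D) (at z)" for D
    using has_derivative_transform_within_open[of f D z UNIV U g] has_derivative_transform_within_open[of g D z UNIV U f] assms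
    by auto
  then show ?thesis by (simp add: frechet_derivative_def)
qed

lemma Ck_on_cong:
  assumes "open U" "\<And>w. w \<in> U \<Longrightarrow> f w = g w" "Ck_on n U f"
  shows "Ck_on n U g"
  using assms(2,3)
proof (induction n arbitrary: f g)
  case 0
  then show ?case by (simp cong: continuous_on_cong)
next
  case (Suc n)
  have "f differentiable_on U" using Suc.prems by simp
  then have "g differentiable_on U"
    unfolding differentiable_on_def differentiable_def
    using has_derivative_transform[of _ U g f] Suc.prems(1) by metis
  moreover have "Ck_on n U (\<lambda>z. frechet_derivative g (at z) a)" for a
  proof (rule Suc.IH)
    show "frechet_derivative f (at w) a = frechet_derivative g (at w) a" if "w \<in> U" for w
      using frechet_derivative_cong_open[OF assms(1) that Suc.prems(1)] by simp
    show "Ck_on n U (\<lambda>z. frechet_derivative f (at z) a)" using Suc.prems(2) by simp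
  qed
  ultimately show ?case by simp
qed

lemma immersion_on_cong:
  assumes "open U" "\<And>w. w \<in> U \<Longrightarrow> f w = g w" "immersion_on U f"
  shows "immersion_on U g"
  using Ck_on_cong[OF assms(1,2)] frechet_derivative_cong_open[OF assms(1) _ assms(2)] assms(3)
  unfolding immersion_on_def by force

section \<open>Lifts of profile curves and the equation they satisfy\<close>

locale rot_surface = mink_frame k u1 u2 w1 w2
  for k :: real and u1 u2 w1 w2 :: mink_space +
  fixes M :: "'m::t2_space set" and x :: "'m \<Rightarrow> mink_space" and \<phi> :: "real \<Rightarrow> 'm \<Rightarrow> 'm" and H :: real
  assumes M: "immersed_surface M x"
    and \<phi>_M: "\<And>s m. m \<in> M \<Longrightarrow> \<phi> s m \<in> M"
    and \<phi>_0: "\<And>m. m \<in> M \<Longrightarrow> \<phi> 0 m = m"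
    and \<phi>_add: "\<And>s t m. m \<in> M \<Longrightarrow> \<phi> (s + t) m = \<phi> s (\<phi> t m)"
    and \<phi>_cont: "continuous_on (UNIV \<times> M) (\<lambda>(s, m). \<phi> s m)"
    and x_\<phi>: "\<And>s m p q a b. m \<in> M \<Longrightarrow> x m = fr p q a b \<Longrightarrow>
      x (\<phi> s m) = fr (gcos (-k) s * p - k * gsin (-k) s * q) (gsin (-k) s * p + gcos (-k) s * q) a b"
    and cmc: "cmc_surface M x H" and H: "H > 0"
begin

lemma x_hyp3: "m \<in> M \<Longrightarrow> x m \<in> hyp3"
  using M by (auto simp: immersed_surface_def)

text \<open>The second frame coordinate is 0 and the first is positive wherever \<open>usq\<close>
  is, so the image curve runs in the half-space of the meridian. The lift itself is only required to
  be continuous.\<close>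

definition lift_on :: "real set \<Rightarrow> (real \<Rightarrow> 'm) \<Rightarrow> (real \<Rightarrow> real) \<Rightarrow> (real \<Rightarrow> real) \<Rightarrow> bool" where
  "lift_on J \<gamma> a b \<longleftrightarrow>
     continuous_on J \<gamma> \<and> \<gamma> ` J \<subseteq> M \<and> (\<forall>t\<in>J. x (\<gamma> t) = fr (rad a b t) 0 (a t) (b t))"

definition sweep :: "(real \<Rightarrow> 'm) \<Rightarrow> real \<times> real \<Rightarrow> 'm" where
  "sweep \<gamma> z = \<phi> (fst z) (\<gamma> (snd z))"

lemma continuous_on_\<phi>:
  assumes "continuous_on S f" "continuous_on S g" "g ` S \<subseteq> M"
  shows "continuous_on S (\<lambda>z. \<phi> (f z) (g z))"
proof -
  have "continuous_on S (\<lambda>z. (f z, g z))" using assms by (intro continuous_intros)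
  from continuous_on_compose2[OF \<phi>_cont this] show ?thesis using assms(3) by auto
qed

lemma continuous_on_sweep:
  assumes "continuous_on J \<gamma>" "\<gamma> ` J \<subseteq> M"
  shows "continuous_on (UNIV \<times> J) (sweep \<gamma>)"
  unfolding sweep_def[abs_def]
proof (rule continuous_on_\<phi>)
  show "continuous_on (UNIV \<times> J) fst" by (rule continuous_on_fst[OF continuous_on_id])
  show "continuous_on (UNIV \<times> J) (\<lambda>z. \<gamma> (snd z))"
    by (rule continuous_on_compose2[OF assms(1)]) (auto intro: continuous_on_snd)
qed (use assms in auto)

lemma x_sweep:
  assumes "lift_on J \<gamma> a b" "z \<in> UNIV \<times> J"
  shows "x (sweep \<gamma> z) = patch a b z" and "sweep \<gamma> z \<in> M"
proof -
  have "\<gamma> (snd z) \<in> M" "x (\<gamma> (snd z)) = fr (rad a b (snd z)) 0 (a (snd z)) (b (snd z))"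
    using assms by (auto simp: lift_on_def)
  from x_\<phi>[OF this] \<phi>_M[OF this(1)] show "x (sweep \<gamma> z) = patch a b z" "sweep \<gamma> z \<in> M"
    by (simp_all add: sweep_def patch_def)
qed

lemma sweep_local_param:
  assumes J: "open J" and R: "regular_profile J a a1 a2 b b1 b2" and L: "lift_on J \<gamma> a b" and z: "z \<in> UNIV \<times> J"
  obtains U where "z \<in> U" "U \<subseteq> UNIV \<times> J" "local_param M x U (sweep \<gamma>)"
proof (rule local_param_of_lift[OF M _ _ _ _ z, of "sweep \<gamma>"])
  show o: "open (UNIV \<times> J)" by (rule open_Times[OF open_UNIV J])
  show "continuous_on (UNIV \<times> J) (sweep \<gamma>)"
    using L by (intro continuous_on_sweep) (auto simp: lift_on_def)
  show "sweep \<gamma> ` (UNIV \<times> J) \<subseteq> M" using x_sweep(2)[OF L] by blast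
  show "immersion_on (UNIV \<times> J) (x \<circ> sweep \<gamma>)"
    by (rule immersion_on_cong[OF o _ patch_immersion(1)[OF J R]]) (simp add: x_sweep(1)[OF L])
qed (use that in blast)

definition conformal :: "real set \<Rightarrow> (real \<Rightarrow> real) \<Rightarrow> (real \<Rightarrow> real) \<Rightarrow> (real \<Rightarrow> real) \<Rightarrow> (real \<Rightarrow> real) \<Rightarrow> bool" where
  "conformal J a a1 b b1 \<longleftrightarrow>
     (\<forall>t\<in>J. k * rad' a a1 b b1 t * rad' a a1 b b1 t - k * a1 t * a1 t + b1 t * b1 t = usq (a t) (b t))"

text \<open>The sweep is a chart, so the curvature hypothesis applies to it, and at angle 0 its
  fundamental forms are explicit: the first is \<open>usq\<close> times the identity, the second is
  diagonal. The sign compares the normal supplied at this point with the explicit one, so at this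
  stage it may vary with \<open>t\<close>.\<close>

lemma conformal_profile_ode:
  assumes J: "open J" and R: "regular_profile J a a1 a2 b b1 b2" and L: "lift_on J \<gamma> a b"
    and conf: "conformal J a a1 b b1" and t: "t \<in> J"
  obtains \<epsilon> where "\<epsilon> = 1 \<or> \<epsilon> = -1"
    "a2 t = 2 * usq (a t) (b t) * a t
       - 2 * (\<epsilon> * H) * (usq (a t) (b t) * b1 t - (a t * a1 t - k * b t * b1 t) * b t)"
    "b2 t = 2 * usq (a t) (b t) * b t
       - 2 * (\<epsilon> * H) * k * (usq (a t) (b t) * a1 t - (a t * a1 t - k * b t * b1 t) * a t)"
proof -
  let ?r = "rad a b t" and ?r1 = "rad' a a1 b b1 t" and ?r2 = "rad'' a a1 a2 b b1 b2 t" and ?u = "usq (a t) (b t)"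
  have d: "(a has_real_derivative a1 t) (at t)" "(a1 has_real_derivative a2 t) (at t)"
    "(b has_real_derivative b1 t) (at t)" "(b1 has_real_derivative b2 t) (at t)" "?u > 0"
    using R t by (auto simp: regular_profile_def)
  have r: "?r > 0" "?r * ?r = ?u" using d(5) by (auto intro: rad_pos rad_squared)
  have m: "?r * ?r1 = a t * a1 t - k * b t * b1 t" using r(1) by (simp add: rad'_def)
  have rr: "?r * ?r2 + ?r1 * ?r1 = a1 t * a1 t + a t * a2 t - k * (b1 t * b1 t + b t * b2 t)"
    using r(1) by (simp add: rad''_def)
  have dr1: "(rad' a a1 b b1 has_real_derivative ?r2) (at t)"
    by (rule rad'_deriv[of a a1 t b b1 a2 b2, OF d(1,3,5,2,4)])
  \<comment> \<open>Half the derivative of the conformality relation.\<close>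
  have conf': "k * ?r1 * ?r2 - k * a1 t * a2 t + b1 t * b2 t = ?r * ?r1"
  proof -
    let ?E = "\<lambda>t. k * rad' a a1 b b1 t * rad' a a1 b b1 t - k * a1 t * a1 t + b1 t * b1 t - usq (a t) (b t)"
    have "(?E has_real_derivative 2 * (k * ?r1 * ?r2 - k * a1 t * a2 t + b1 t * b2 t - (a t * a1 t - k * b t * b1 t))) (at t)"
      unfolding usq_def by (rule derivative_eq_intros d(1-4) dr1 refl)+ (simp add: algebra_simps)
    moreover have "(?E has_real_derivative 0) (at t)"
      by (rule has_field_derivative_transform_within_open[of "\<lambda>_. 0", OF _ J t])
        (use conf in \<open>auto simp: conformal_def\<close>)
    ultimately have "2 * (k * ?r1 * ?r2 - k * a1 t * a2 t + b1 t * b2 t - (a t * a1 t - k * b t * b1 t)) = 0"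
      by (rule DERIV_unique)
    then show ?thesis by (simp add: m)
  qed
  have cu: "k * ?r1 * ?r1 - k * a1 t * a1 t + b1 t * b1 t = ?u" using conf t by (simp add: conformal_def)
  have z: "(0, t) \<in> UNIV \<times> J" using t by simp
  obtain U where U: "(0, t) \<in> U" "U \<subseteq> UNIV \<times> J" "local_param M x U (sweep \<gamma>)"
    by (rule sweep_local_param[OF J R L z])
  have oU: "open U" using U(3) by (simp add: local_param_def)
  let ?f = "x \<circ> sweep \<gamma>"
  have feq: "?f w = patch a b w" if "w \<in> U" for w using x_sweep(1)[OF L, of w] U(2) that by auto
  have DF: "frechet_derivative ?f (at w) = frechet_derivative (patch a b) (at w)" if "w \<in> U" for w
    by (rule frechet_derivative_cong_open[OF oU that feq])
  have D1: "frechet_derivative ?f (at (0, t)) v = fr (snd v * ?r1) (fst v * ?r) (snd v * a1 t) (snd v * b1 t)" for v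
    by (simp add: DF[OF U(1)] patch_immersion(2)[OF J R z] fr_ops)
  have "frechet_derivative (\<lambda>y. frechet_derivative ?f (at y) v) (at (0, t))
      = frechet_derivative (\<lambda>y. frechet_derivative (patch a b) (at y) v) (at (0, t))" for v
    by (rule frechet_derivative_cong_open[OF oU U(1)]) (simp add: DF)
  then have D2: "frechet_derivative (\<lambda>y. frechet_derivative ?f (at y) v) (at (0, t)) w =
      fr (- k * fst v * fst w * ?r + snd v * snd w * ?r2) (fst v * snd w * ?r1 + snd v * fst w * ?r1)
        (snd v * snd w * a2 t) (snd v * snd w * b2 t)" for v w
    by (simp add: patch_immersion(3)[OF J R z] fr_ops fr_eq_iff algebra_simps)
  obtain n k1 k2 where n: "unit_normal ?f (0, t) n" and pc: "principal_curvatures ?f n (0, t) k1 k2" and Hk: "H = (k1 + k2) / 2"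
    using cmc U unfolding cmc_surface_def by metis
  obtain y \<sigma> y1 y2 where ny: "n = fr y \<sigma> y1 y2" by (rule fr_surj)
  have nn: "mink n n = 1" "mink n (?f (0, t)) = 0" "mink n (frechet_derivative ?f (at (0, t)) v) = 0" for v
    using n unfolding unit_normal_def by blast+
  \<comment> \<open>At angle 0 the orbit has direction \<open>u2\<close>, so the normal has no
    component there.\<close>
  have \<sigma>: "\<sigma> = 0" using nn(3)[of "(1, 0)"] r(1) unfolding D1 ny by (simp add: mink_fr)
  have n1: "k * y * y - k * y1 * y1 + y2 * y2 = 1" using nn(1) by (simp add: ny \<sigma> mink_fr)
  have n2: "k * y * ?r - k * y1 * a t + y2 * b t = 0"
    using nn(2) unfolding feq[OF U(1)] by (simp add: ny \<sigma> mink_fr patch_def)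
  have n3: "k * y * ?r1 - k * y1 * a1 t + y2 * b1 t = 0"
    using nn(3)[of "(0, 1)"] unfolding D1 ny by (simp add: mink_fr \<sigma>)
  have f1: "fund1 ?f (0, t) v w = ?u * (fst v * fst w + snd v * snd w)" for v w
  proof -
    have "fund1 ?f (0, t) v w = fst v * fst w * (?r * ?r)
        + snd v * snd w * (k * ?r1 * ?r1 - k * a1 t * a1 t + b1 t * b1 t)"
      by (simp add: fund1_def D1 mink_fr algebra_simps)
    then show ?thesis by (simp only: r(2) cu) (simp add: algebra_simps)
  qed
  let ?L = "- ?r * y" and ?N = "k * y * ?r2 - k * y1 * a2 t + y2 * b2 t"
  have f2: "fund2 ?f n (0, t) v w = fst v * (fst w * ?L + snd w * 0) + snd v * (fst w * 0 + snd w * ?N)" for v w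
    by (simp add: fund2_def D2 ny \<sigma> mink_fr algebra_simps)
  obtain v w where vw: "fund1 ?f (0, t) v v = 1" "fund1 ?f (0, t) w w = 1" "fund1 ?f (0, t) v w = 0"
    "fund2 ?f n (0, t) v v = k1" "fund2 ?f n (0, t) w w = k2"
    using pc unfolding principal_curvatures_def by blast
  note tr = conformal_trace[of ?u "fst v" "snd v" "fst w" "snd w" ?L 0 ?N, OF vw(1,2,3)[unfolded f1]]
  have "?u * (k1 + k2) = ?L + ?N"
    unfolding tr[symmetric] vw(4,5)[symmetric] f2 by (simp only: add.assoc)
  moreover have "2 * H = k1 + k2" by (simp add: Hk)
  ultimately have Hu: "2 * H * ?u = - ?r * y + k * y * ?r2 - k * y1 * a2 t + y2 * b2 t"
    by (simp add: mult.commute)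
  show ?thesis
    by (rule cmc_algebra[OF kk(1) r(1) r(2)[symmetric] usq_def m[symmetric] refl cu conf'[unfolded m] rr n1 n2 n3 Hu, of thesis])
      (rule that, assumption+)
qed

end

section \<open>Constancy of a continuous sign, and change of time\<close>

lemma continuous_sign_constant:
  fixes f :: "real \<Rightarrow> real"
  assumes "continuous_on J f" "is_interval J" "\<And>t. t \<in> J \<Longrightarrow> f t = 1 \<or> f t = -1" "s \<in> J" "t \<in> J"
  shows "f s = f t"
proof -
  have "connected (f ` J)" using assms(1,2) by (intro connected_continuous_image) (simp_all add: is_interval_connected_1)
  then have I: "is_interval (f ` J)" by (simp add: is_interval_connected_1)
  have "0 \<notin> f ` J" using assms(3) by force
  then have False if "-1 \<in> f ` J" "1 \<in> f ` J"
    using mem_is_interval_1_I[OF I that, of 0] by simp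
  then show ?thesis using assms(3)[OF assms(4)] assms(3)[OF assms(5)] assms(4,5) by (metis imageI)
qed

text \<open>Separation of variables: \<sigma> is the inverse of the primitive \<open>T\<close> of 1
  / h.\<close>

lemma time_change_exists:
  fixes h :: "real \<Rightarrow> real"
  assumes \<delta>: "\<delta> > 0" and h: "continuous_on {-\<delta><..<\<delta>} h" "\<And>t. t \<in> {-\<delta><..<\<delta>} \<Longrightarrow> h t > 0"
  obtains \<epsilon> \<sigma> where "\<epsilon> > 0" "\<sigma> 0 = 0" "\<And>s. s \<in> {-\<epsilon><..<\<epsilon>} \<Longrightarrow> \<sigma> s \<in> {-\<delta><..<\<delta>}"
    "\<And>s. s \<in> {-\<epsilon><..<\<epsilon>} \<Longrightarrow> (\<sigma> has_real_derivative h (\<sigma> s)) (at s)"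
proof -
  \<comment> \<open>The interval is shrunk twice: to \<open>d\<close>, so that 1 / h is continuous
    on a closed interval, and later to \<open>e\<close>, so that \<open>T\<close> is differentiable
    on a closed interval where the intermediate value theorem can be applied.\<close>
  define d where "d = \<delta> / 2"
  define T where "T t = (LBINT y=ereal 0..ereal t. 1 / h y)" for t
  have d: "d > 0" "{-d..d} \<subseteq> {-\<delta><..<\<delta>}" "d < \<delta>" using \<delta> by (auto simp: d_def)
  have hd: "h t > 0" if "t \<in> {-d..d}" for t using h(2) d(2) that by blast
  have "continuous_on {-d..d} (\<lambda>y. 1 / h y)"
    by (intro continuous_intros continuous_on_subset[OF h(1) d(2)]) (use hd in force)
  then have dT: "(T has_real_derivative 1 / h t) (at t)" if "t \<in> {-d<..<d}" for t
    unfolding T_def[abs_def] using that by (intro interval_integral_has_real_derivative) auto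
  define e where "e = d / 2"
  have e: "e > 0" "{-e..e} \<subseteq> {-d<..<d}" "e < d" using d(1) by (auto simp: e_def)
  have T0: "T 0 = 0" by (simp add: T_def)
  have mono: "T s < T t" if "s < t" "s \<in> {-e..e}" "t \<in> {-e..e}" for s t
  proof (rule DERIV_pos_imp_increasing[OF that(1)])
    fix y assume "s \<le> y" "y \<le> t"
    then have "y \<in> {-d<..<d}" using e(1,3) that by auto
    then show "\<exists>D. (T has_real_derivative D) (at y) \<and> D > 0" using dT[of y] hd[of y] by (intro exI[of _ "1 / h y"] conjI) auto
  qed
  have cT: "isCont T t" if "t \<in> {-e..e}" for t using dT[of t] e that DERIV_isCont by blast
  define \<epsilon> where "\<epsilon> = min (T e) (- T (-e))"
  have \<epsilon>: "\<epsilon> > 0" using mono[of 0 e] mono[of "-e" 0] e by (simp add: \<epsilon>_def T0)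
  define \<sigma> where "\<sigma> s = (THE t. t \<in> {-e<..<e} \<and> T t = s)" for s
  have \<sigma>T: "\<sigma> (T t) = t" if "t \<in> {-e<..<e}" for t
    unfolding \<sigma>_def
  proof (rule the_equality)
    fix t' assume "t' \<in> {-e<..<e} \<and> T t' = T t"
    then show "t' = t" using mono[of t t'] mono[of t' t] that by (cases t t' rule: linorder_cases) auto
  qed (use that in simp)
  have \<sigma>: "\<sigma> s \<in> {-e<..<e}" "T (\<sigma> s) = s" if s: "s \<in> {-\<epsilon><..<\<epsilon>}" for s
  proof -
    have "\<exists>t\<ge>-e. t \<le> e \<and> T t = s"
      by (rule IVT) (use s e cT in \<open>auto simp: \<epsilon>_def\<close>)
    then obtain t where t: "-e \<le> t" "t \<le> e" "T t = s" by blast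
    have "t \<noteq> e" "t \<noteq> -e" using s t(3) by (auto simp: \<epsilon>_def)
    then have "t \<in> {-e<..<e}" using t by auto
    with \<sigma>T[OF this] t(3) show "\<sigma> s \<in> {-e<..<e}" "T (\<sigma> s) = s" by auto
  qed
  have d\<sigma>: "(\<sigma> has_real_derivative h (\<sigma> s)) (at s)" if s: "s \<in> {-\<epsilon><..<\<epsilon>}" for s
  proof -
    define r where "r = min (e - \<sigma> s) (e + \<sigma> s) / 2"
    have r: "r > 0" "\<And>t. \<sigma> s - r \<le> t \<Longrightarrow> t \<le> \<sigma> s + r \<Longrightarrow> t \<in> {-e<..<e}"
      using \<sigma>(1)[OF s] by (auto simp: r_def min_def field_simps split: if_splits)
    have "isCont \<sigma> (T (\<sigma> s))"
    proof (rule isCont_inverse_function2[of "\<sigma> s - r" "\<sigma> s" "\<sigma> s + r"])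
      show "\<sigma> (T t) = t" if "\<sigma> s - r \<le> t" "t \<le> \<sigma> s + r" for t using \<sigma>T r(2) that by blast
      show "isCont T t" if "\<sigma> s - r \<le> t" "t \<le> \<sigma> s + r" for t using cT[of t] r(2)[OF that] by auto
    qed (use r(1) in auto)
    then have c: "isCont \<sigma> s" by (simp add: \<sigma>(2)[OF s])
    have sd: "\<sigma> s \<in> {-d<..<d}" using \<sigma>(1)[OF s] e(1,3) by auto
    then have pos: "h (\<sigma> s) > 0" using hd[of "\<sigma> s"] by auto
    have "(\<sigma> has_real_derivative inverse (1 / h (\<sigma> s))) (at s)"
      by (rule DERIV_inverse_function[OF dT[OF sd] _ _ _ _ c, of "-\<epsilon>" \<epsilon>]) (use pos s \<sigma>(2) in auto)
    then show ?thesis by simp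
  qed
  show ?thesis
  proof (rule that[OF \<epsilon>, of \<sigma>])
    show "\<sigma> 0 = 0" using \<sigma>T[of 0] e by (simp add: T0)
    show "\<sigma> s \<in> {-\<delta><..<\<delta>}" if "s \<in> {-\<epsilon><..<\<epsilon>}" for s using \<sigma>(1)[OF that] e(1,3) d(1,3) by auto
  qed (rule d\<sigma>)
qed

section \<open>The profile equation and the sign of the normal\<close>

context rot_surface
begin

text \<open>Profile curves in conformal parametrization (\<open>\<bar>F\<^sub>t\<bar> = \<bar>F\<^sub>s\<bar> = r\<close>), with \<open>r\<^sup>2\<close> eliminated in favour
  of \<open>usq a b\<close>. The equation is a polynomial vector field in \<open>(a, a1, b, b1)\<close>, and the direction of the
  curve is part of it: the reversed curve has mean curvature \<open>- H\<close>.\<close>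

definition acc_a :: "real \<Rightarrow> real \<Rightarrow> real \<Rightarrow> real \<Rightarrow> real" where
  "acc_a a a1 b b1 = 2 * usq a b * a - 2 * H * (usq a b * b1 - (a * a1 - k * b * b1) * b)"

definition acc_b :: "real \<Rightarrow> real \<Rightarrow> real \<Rightarrow> real \<Rightarrow> real" where
  "acc_b a a1 b b1 = 2 * usq a b * b - 2 * H * k * (usq a b * a1 - (a * a1 - k * b * b1) * a)"

definition cmc_profile :: "real set \<Rightarrow> (real \<Rightarrow> real) \<Rightarrow> (real \<Rightarrow> real) \<Rightarrow> (real \<Rightarrow> real) \<Rightarrow> (real \<Rightarrow> real) \<Rightarrow> bool" where
  "cmc_profile J a a1 b b1 \<longleftrightarrow>
     (\<forall>t\<in>J. (a has_real_derivative a1 t) (at t) \<and> (a1 has_real_derivative acc_a (a t) (a1 t) (b t) (b1 t)) (at t) \<and>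
        (b has_real_derivative b1 t) (at t) \<and> (b1 has_real_derivative acc_b (a t) (a1 t) (b t) (b1 t)) (at t) \<and>
        usq (a t) (b t) > 0 \<and>
        k * (a t * a1 t - k * b t * b1 t) * (a t * a1 t - k * b t * b1 t)
          + usq (a t) (b t) * (b1 t * b1 t - k * a1 t * a1 t) = usq (a t) (b t) * usq (a t) (b t))"

text \<open>Up to nonzero factors these are the components of the normal along \<open>w2\<close> and
  \<open>w1\<close> in the complementary plane. If both vanished, (a1, b1) would be m / v times (a,
  b), and the relation \<open>c\<close> would become v^3 = - m^2. Hence the sign in front of
  \<open>H\<close> is determined by the equation.\<close>

lemma normal_nonzero:
  assumes u: "usq a b > 0"
    and c: "k * (a * a1 - k * b * b1) * (a * a1 - k * b * b1) + usq a b * (b1 * b1 - k * a1 * a1) = usq a b * usq a b"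
  shows "usq a b * b1 - (a * a1 - k * b * b1) * b \<noteq> 0 \<or> usq a b * a1 - (a * a1 - k * b * b1) * a \<noteq> 0"
    and "a1 \<noteq> 0 \<or> b1 \<noteq> 0"
proof -
  show "a1 \<noteq> 0 \<or> b1 \<noteq> 0" using u c by auto
  define m where "m = a * a1 - k * b * b1"
  define v where "v = usq a b"
  have v: "a * a - k * b * b = v + k" by (simp add: v_def usq_def)
  show "usq a b * b1 - (a * a1 - k * b * b1) * b \<noteq> 0 \<or> usq a b * a1 - (a * a1 - k * b * b1) * a \<noteq> 0"
  proof (rule ccontr)
    assume "\<not> ?thesis"
    then have e: "v * b1 = m * b" "v * a1 = m * a" by (auto simp: m_def v_def)
    have "v * (k * m * m + v * (b1 * b1 - k * a1 * a1)) = k * m * m * v + (v * b1) * (v * b1) - k * (v * a1) * (v * a1)"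
      by (simp add: algebra_simps)
    also have "\<dots> = k * m * m * v - k * (m * m) * (a * a - k * b * b)" unfolding e by (simp add: algebra_simps)
    also have "\<dots> = - (m * m)" unfolding v by (simp add: algebra_simps)
    finally have "v * (v * v) = - (m * m)" using c by (simp add: m_def v_def)
    moreover have "v * (v * v) > 0" using u by (simp add: v_def)
    ultimately show False using zero_le_square[of m] by linarith
  qed
qed

lemma cmc_profile_regular:
  assumes "cmc_profile J a a1 b b1"
  shows "regular_profile J a a1 (\<lambda>t. acc_a (a t) (a1 t) (b t) (b1 t)) b b1 (\<lambda>t. acc_b (a t) (a1 t) (b t) (b1 t))"
proof -
  have d: "(a has_real_derivative a1 t) (at t)" "(a1 has_real_derivative acc_a (a t) (a1 t) (b t) (b1 t)) (at t)"
    "(b has_real_derivative b1 t) (at t)" "(b1 has_real_derivative acc_b (a t) (a1 t) (b t) (b1 t)) (at t)"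
    "usq (a t) (b t) > 0" "a1 t \<noteq> 0 \<or> b1 t \<noteq> 0" if "t \<in> J" for t
    using assms that normal_nonzero(2)[of "a t" "b t" "a1 t" "b1 t"] unfolding cmc_profile_def by blast+
  have c: "continuous_on J a" "continuous_on J a1" "continuous_on J b" "continuous_on J b1"
    by (intro continuous_at_imp_continuous_on ballI DERIV_isCont, rule d, assumption)+
  have "continuous_on J (\<lambda>t. acc_a (a t) (a1 t) (b t) (b1 t))" "continuous_on J (\<lambda>t. acc_b (a t) (a1 t) (b t) (b1 t))"
    unfolding acc_a_def acc_b_def usq_def by (intro continuous_intros c)+
  with d show ?thesis by (simp add: regular_profile_def)
qed

text \<open>A sign in the equation is removed by reversing the profile curve.\<close>

lemma conformal_profile_cmc:
  assumes \<delta>: "\<delta> > 0" and R: "regular_profile {-\<delta><..<\<delta>} a a1 a2 b b1 b2" and L: "lift_on {-\<delta><..<\<delta>} \<gamma> a b"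
    and conf: "conformal {-\<delta><..<\<delta>} a a1 b b1"
  obtains a' a1' b' b1' \<gamma>' where "cmc_profile {-\<delta><..<\<delta>} a' a1' b' b1'" "lift_on {-\<delta><..<\<delta>} \<gamma>' a' b'" "\<gamma>' 0 = \<gamma> 0"
proof -
  let ?J = "{-\<delta><..<\<delta>}"
  \<comment> \<open>Up to the factor -r^2, \<open>X t\<close> and \<open>k * Y t\<close> are the
    components of the explicit unit normal along \<open>w1\<close> and \<open>w2\<close>.\<close>
  define X where "X t = usq (a t) (b t) * b1 t - (a t * a1 t - k * b t * b1 t) * b t" for t
  define Y where "Y t = usq (a t) (b t) * a1 t - (a t * a1 t - k * b t * b1 t) * a t" for t
  have d: "(a has_real_derivative a1 t) (at t)" "(a1 has_real_derivative a2 t) (at t)"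
    "(b has_real_derivative b1 t) (at t)" "(b1 has_real_derivative b2 t) (at t)" "usq (a t) (b t) > 0" if "t \<in> ?J" for t
    using R that by (auto simp: regular_profile_def)
  have c: "continuous_on ?J a" "continuous_on ?J a1" "continuous_on ?J b" "continuous_on ?J b1"
    by (intro continuous_at_imp_continuous_on ballI DERIV_isCont, rule d, assumption)+
  have c2: "continuous_on ?J a2" "continuous_on ?J b2" using R by (auto simp: regular_profile_def)
  have cp: "k * (a t * a1 t - k * b t * b1 t) * (a t * a1 t - k * b t * b1 t)
          + usq (a t) (b t) * (b1 t * b1 t - k * a1 t * a1 t) = usq (a t) (b t) * usq (a t) (b t)" if t: "t \<in> ?J" for t
  proof -
    let ?r = "rad a b t" and ?r1 = "rad' a a1 b b1 t"
    have r: "?r > 0" "?r * ?r = usq (a t) (b t)" using d(5)[OF t] by (auto intro: rad_pos rad_squared)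
    have m: "a t * a1 t - k * b t * b1 t = ?r * ?r1" using r(1) by (simp add: rad'_def)
    have "k * (?r * ?r1) * (?r * ?r1) + (?r * ?r) * (b1 t * b1 t - k * a1 t * a1 t) =
        (?r * ?r) * (k * ?r1 * ?r1 - k * a1 t * a1 t + b1 t * b1 t)" by (simp add: algebra_simps)
    then show ?thesis using conf t unfolding m conformal_def by (simp add: r(2))
  qed
  have XY: "X t * X t + Y t * Y t > 0" if "t \<in> ?J" for t
    using normal_nonzero(1)[OF d(5)[OF that] cp[OF that]] sum_squares_gt_zero_iff[of "X t" "Y t"]
    by (auto simp: X_def Y_def)
  \<comment> \<open>The two equations are solved for the sign by projecting onto (X, k Y). The
    resulting formula is visibly continuous in \<open>t\<close>.\<close>
  define \<epsilon> where "\<epsilon> t = - ((a2 t - 2 * usq (a t) (b t) * a t) * X t + (b2 t - 2 * usq (a t) (b t) * b t) * (k * Y t)) / (2 * H * (X t * X t + Y t * Y t))" for t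
  have \<epsilon>: "\<epsilon> t = 1 \<or> \<epsilon> t = -1" "a2 t = 2 * usq (a t) (b t) * a t - 2 * (\<epsilon> t * H) * X t"
    "b2 t = 2 * usq (a t) (b t) * b t - 2 * (\<epsilon> t * H) * k * Y t" if t: "t \<in> ?J" for t
  proof -
    obtain e where e: "e = 1 \<or> e = -1" "a2 t = 2 * usq (a t) (b t) * a t - 2 * (e * H) * X t"
      "b2 t = 2 * usq (a t) (b t) * b t - 2 * (e * H) * k * Y t"
      using conformal_profile_ode[OF open_greaterThanLessThan R L conf t] unfolding X_def Y_def by blast
    have "- ((a2 t - 2 * usq (a t) (b t) * a t) * X t + (b2 t - 2 * usq (a t) (b t) * b t) * (k * Y t)) = e * (2 * H * (X t * X t + Y t * Y t))"
      unfolding e by (simp add: algebra_simps)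
    moreover have "2 * H * (X t * X t + Y t * Y t) \<noteq> 0"
      by (rule less_imp_neq[THEN not_sym], intro mult_pos_pos) (use XY[OF t] H in auto)
    ultimately have "\<epsilon> t = e" unfolding \<epsilon>_def by (metis nonzero_mult_div_cancel_right)
    with e show "\<epsilon> t = 1 \<or> \<epsilon> t = -1" "a2 t = 2 * usq (a t) (b t) * a t - 2 * (\<epsilon> t * H) * X t"
      "b2 t = 2 * usq (a t) (b t) * b t - 2 * (\<epsilon> t * H) * k * Y t" by simp_all
  qed
  have cX: "continuous_on ?J X" "continuous_on ?J Y"
    unfolding X_def Y_def usq_def by (intro continuous_intros c)+
  have XYn: "\<forall>t\<in>?J. 2 * H * (X t * X t + Y t * Y t) \<noteq> 0"
  proof
    fix t assume "t \<in> ?J"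
    then have "2 * H * (X t * X t + Y t * Y t) > 0" using XY H by (intro mult_pos_pos) auto
    then show "2 * H * (X t * X t + Y t * Y t) \<noteq> 0" by linarith
  qed
  have c\<epsilon>: "continuous_on ?J \<epsilon>"
    unfolding \<epsilon>_def usq_def by (intro continuous_intros c c2 cX XYn)
  have const: "\<epsilon> t = \<epsilon> 0" if "t \<in> ?J" for t
    by (rule continuous_sign_constant[OF c\<epsilon>]) (use that \<delta> \<epsilon>(1) in auto)
  show ?thesis
  proof (cases "\<epsilon> 0 = 1")
    case True
    have "cmc_profile ?J a a1 b b1"
      unfolding cmc_profile_def
    proof (intro ballI conjI)
      fix t assume t: "t \<in> ?J"
      have "a2 t = acc_a (a t) (a1 t) (b t) (b1 t)" "b2 t = acc_b (a t) (a1 t) (b t) (b1 t)"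
        using \<epsilon>(2,3)[OF t] const[OF t] True by (simp_all add: acc_a_def acc_b_def X_def Y_def)
      with d(2,4)[OF t] show "(a1 has_real_derivative acc_a (a t) (a1 t) (b t) (b1 t)) (at t)"
        "(b1 has_real_derivative acc_b (a t) (a1 t) (b t) (b1 t)) (at t)" by simp_all
    qed (use d cp in auto)
    then show ?thesis using that L by blast
  next
    case False
    then have m1: "\<epsilon> t = -1" if "t \<in> ?J" for t using const[OF that] \<epsilon>(1)[of 0] \<delta> by auto
    have neg: "- t \<in> ?J" if "t \<in> ?J" for t using that by auto
    have dm: "((\<lambda>t. f (- t)) has_real_derivative - f' (- t)) (at t)"
      if "\<And>t. t \<in> ?J \<Longrightarrow> (f has_real_derivative f' t) (at t)" "t \<in> ?J" for f f' :: "real \<Rightarrow> real" and t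
      using that(1)[OF neg[OF that(2)]] by (simp add: DERIV_mirror)
    have "cmc_profile ?J (\<lambda>t. a (- t)) (\<lambda>t. - a1 (- t)) (\<lambda>t. b (- t)) (\<lambda>t. - b1 (- t))"
      unfolding cmc_profile_def
    proof (intro ballI conjI)
      fix t assume t: "t \<in> ?J"
      note n = neg[OF t]
      show "((\<lambda>t. a (- t)) has_real_derivative - a1 (- t)) (at t)" by (rule dm[OF d(1) t])
      show "((\<lambda>t. b (- t)) has_real_derivative - b1 (- t)) (at t)" by (rule dm[OF d(3) t])
      have "a2 (- t) = acc_a (a (- t)) (- a1 (- t)) (b (- t)) (- b1 (- t))"
         "b2 (- t) = acc_b (a (- t)) (- a1 (- t)) (b (- t)) (- b1 (- t))"
        using \<epsilon>(2,3)[OF n] m1[OF n] by (simp_all add: acc_a_def acc_b_def X_def Y_def algebra_simps)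
      with DERIV_minus[OF dm[OF d(2) t]] DERIV_minus[OF dm[OF d(4) t]]
      show "((\<lambda>t. - a1 (- t)) has_real_derivative acc_a (a (- t)) (- a1 (- t)) (b (- t)) (- b1 (- t))) (at t)"
        "((\<lambda>t. - b1 (- t)) has_real_derivative acc_b (a (- t)) (- a1 (- t)) (b (- t)) (- b1 (- t))) (at t)" by simp_all
      show "usq (a (- t)) (b (- t)) > 0" by (rule d(5)[OF n])
      show "k * (a (- t) * - a1 (- t) - k * b (- t) * - b1 (- t)) * (a (- t) * - a1 (- t) - k * b (- t) * - b1 (- t)) +
         usq (a (- t)) (b (- t)) * (- b1 (- t) * - b1 (- t) - k * - a1 (- t) * - a1 (- t)) = usq (a (- t)) (b (- t)) * usq (a (- t)) (b (- t))"
        using cp[OF n] by (simp add: algebra_simps)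
    qed
    moreover have "lift_on ?J (\<lambda>t. \<gamma> (- t)) (\<lambda>t. a (- t)) (\<lambda>t. b (- t))"
      unfolding lift_on_def
    proof (intro conjI ballI)
      show "continuous_on ?J (\<lambda>t. \<gamma> (- t))"
        by (rule continuous_on_compose2[of ?J \<gamma>]) (use L in \<open>auto simp: lift_on_def intro!: continuous_intros\<close>)
      show "(\<lambda>t. \<gamma> (- t)) ` ?J \<subseteq> M" using L neg by (auto simp: lift_on_def)
      show "x (\<gamma> (- t)) = fr (rad (\<lambda>t. a (- t)) (\<lambda>t. b (- t)) t) 0 (a (- t)) (b (- t))" if "t \<in> ?J" for t
        using L neg[OF that] by (auto simp: lift_on_def rad_def)
    qed
    ultimately show ?thesis using that[of "\<lambda>t. a (- t)" "\<lambda>t. - a1 (- t)" "\<lambda>t. b (- t)" "\<lambda>t. - b1 (- t)" "\<lambda>t. \<gamma> (- t)"] by simp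
  qed
qed

end

section \<open>Existence and uniqueness of local lifts\<close>

lemma continuous_on_gang:
  fixes f :: "real \<Rightarrow> real"
  assumes "continuous_on S f" "\<And>t. t \<in> S \<Longrightarrow> k = 1 \<Longrightarrow> \<bar>f t\<bar> \<le> 1"
  shows "continuous_on S (\<lambda>t. gang k (f t))"
proof (cases "k = 1")
  case True
  have "continuous_on S (\<lambda>t. arcsin (f t))"
    using assms(2)[OF _ True] by (intro continuous_on_arcsin assms(1)) (auto simp: abs_le_iff)
  then show ?thesis using True by (simp add: gang_def)
next
  case False
  have "continuous_on S (\<lambda>t. arsinh (f t))" by (rule continuous_on_arsinh'[OF assms(1)])
  then show ?thesis using False by (simp add: gang_def)
qed

lemma mink_line_deriv:
  assumes "(f has_derivative f') (at (z + t *\<^sub>R v))"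
  shows "((\<lambda>t. mink (f (z + t *\<^sub>R v)) e) has_real_derivative mink (f' v) e) (at t)"
proof -
  have "((\<lambda>t. z + t *\<^sub>R v) has_derivative (\<lambda>h. h *\<^sub>R v)) (at t)"
    by (auto intro!: derivative_eq_intros)
  from has_derivative_compose[OF this assms]
  have "((\<lambda>t. f (z + t *\<^sub>R v)) has_derivative (\<lambda>h. f' (h *\<^sub>R v))) (at t)" .
  then have "((\<lambda>t. mink (f (z + t *\<^sub>R v)) e) has_derivative (\<lambda>h. mink (f' (h *\<^sub>R v)) e)) (at t)"
    by (rule bounded_linear.has_derivative[OF mink.bounded_linear_left])
  moreover have "mink (f' (h *\<^sub>R v)) e = mink (f' v) e * h" for h
    using has_derivative_linear[OF assms] by (simp add: linear_scale mink.scaleR_left)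
  ultimately show ?thesis by (simp add: has_field_derivative_def)
qed

context rot_surface
begin

lemma fr_expand: "v = fr (k * mink v u1) (mink v u2) (- k * mink v w1) (mink v w2)"
proof -
  obtain p q a b where "v = fr p q a b" by (rule fr_surj)
  then show ?thesis by (simp add: fr_coords)
qed

text \<open>A straight line through \<open>z0\<close> in a chart is rotated point by point into the
  meridian. Rotations leave the coordinates along \<open>w1\<close> and \<open>w2\<close> unchanged,
  so \<open>a\<close> and \<open>b\<close> inherit the regularity of the chart, while for the
  rotated curve in \<open>M\<close> continuity of the angle suffices.\<close>

lemma exists_regular_lift:
  assumes m: "m \<in> M" "x m = fr r0 0 a0 b0" and r0: "r0 > 0"
  obtains \<delta> \<gamma> a a1 a2 b b1 b2 where "\<delta> > 0" "regular_profile {-\<delta><..<\<delta>} a a1 a2 b b1 b2"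
    "lift_on {-\<delta><..<\<delta>} \<gamma> a b" "\<gamma> 0 = m"
proof -
  obtain U q g where c: "local_param M x U q" "m \<in> q ` U" "homeomorphism U (q ` U) q g" "open U"
    "immersion_on U (x \<circ> q)" "openin (top_of_set M) (q ` U)"
    by (rule immersed_surface_chart[OF M m(1)])
  obtain z0 where z0: "z0 \<in> U" "m = q z0" using c(2) by blast
  have qM: "q z \<in> M" if "z \<in> U" for z using that c(6) openin_subset by force
  have qc: "continuous_on U q" using c(3) by (simp add: homeomorphism_def)
  define f where "f = x \<circ> q"
  have ck: "Ck_on 2 U f" and inj: "\<And>z. z \<in> U \<Longrightarrow> inj (frechet_derivative f (at z))"
    using c(5) by (auto simp: immersion_on_def f_def)
  note D = Ck_on_2D[OF c(4) ck]
  define P where "P z = k * mink (f z) u1" for z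
  define Q where "Q z = mink (f z) u2" for z
  define A where "A z = - k * mink (f z) w1" for z
  define B where "B z = mink (f z) w2" for z
  have fz: "f z = fr (P z) (Q z) (A z) (B z)" for z
    unfolding P_def Q_def A_def B_def by (rule fr_expand)
  have hyp: "k * (P z)\<^sup>2 + (Q z)\<^sup>2 - k * (A z)\<^sup>2 + (B z)\<^sup>2 = -1" if "z \<in> U" for z
    using fr_hyp3(1) x_hyp3[OF qM[OF that]] fz[of z] by (simp add: f_def)
  have us: "usq (A z) (B z) = (P z)\<^sup>2 + k * (Q z)\<^sup>2" if "z \<in> U" for z
  proof -
    have "k * (k * (P z)\<^sup>2 + (Q z)\<^sup>2 - k * (A z)\<^sup>2 + (B z)\<^sup>2) = k * (-1)" by (simp only: hyp[OF that])
    then show ?thesis by (simp add: usq_def algebra_simps power2_eq_square)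
  qed
  have at0: "P z0 = r0" "Q z0 = 0" using m(2) z0(2) fz[of z0] by (simp_all add: f_def fr_eq_iff)
  define A1 where "A1 v z = - k * mink (frechet_derivative f (at z) v) w1" for v z
  define B1 where "B1 v z = mink (frechet_derivative f (at z) v) w2" for v z
  define A2 where "A2 v z = - k * mink (frechet_derivative (\<lambda>z. frechet_derivative f (at z) v) (at z) v) w1" for v z
  define B2 where "B2 v z = mink (frechet_derivative (\<lambda>z. frechet_derivative f (at z) v) (at z) v) w2" for v z
  have dA: "((\<lambda>t. A (z0 + t *\<^sub>R v)) has_real_derivative A1 v (z0 + t *\<^sub>R v)) (at t)"
    and dB: "((\<lambda>t. B (z0 + t *\<^sub>R v)) has_real_derivative B1 v (z0 + t *\<^sub>R v)) (at t)"
    and dA1: "((\<lambda>t. A1 v (z0 + t *\<^sub>R v)) has_real_derivative A2 v (z0 + t *\<^sub>R v)) (at t)"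
    and dB1: "((\<lambda>t. B1 v (z0 + t *\<^sub>R v)) has_real_derivative B2 v (z0 + t *\<^sub>R v)) (at t)"
    if "z0 + t *\<^sub>R v \<in> U" for v t
    unfolding A_def B_def A1_def B1_def A2_def B2_def
    by (intro DERIV_cmult mink_line_deriv D(1) D(2) that)+
  \<comment> \<open>If no direction moved the two invariant coordinates, tangency to the hyperboloid
    and r0 > 0 would also remove the component along \<open>u1\<close>. The derivative would then
    have its image in the line of \<open>u2\<close>, contradicting injectivity.\<close>
  obtain v where v: "A1 v z0 \<noteq> 0 \<or> B1 v z0 \<noteq> 0"
  proof (rule ccontr)
    assume "\<not> thesis"
    then have nz: "A1 v z0 = 0" "B1 v z0 = 0" for v using that by blast+
    let ?D = "frechet_derivative f (at z0)"
    have lin: "linear ?D" using D(1)[OF z0(1)] by (rule has_derivative_linear)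
    have P1: "mink (?D v) u1 = 0" for v
    proof -
      have zz: "z0 + 0 *\<^sub>R v \<in> U" using z0(1) by simp
      have dP: "((\<lambda>t. P (z0 + t *\<^sub>R v)) has_real_derivative k * mink (?D v) u1) (at 0)"
        unfolding P_def using mink_line_deriv[OF D(1)[OF zz], of u1] by (intro DERIV_cmult) simp
      have dQ: "((\<lambda>t. Q (z0 + t *\<^sub>R v)) has_real_derivative mink (?D v) u2) (at 0)"
        unfolding Q_def using mink_line_deriv[OF D(1)[OF zz], of u2] by simp
      have dAB: "((\<lambda>t. A (z0 + t *\<^sub>R v)) has_real_derivative 0) (at 0)" "((\<lambda>t. B (z0 + t *\<^sub>R v)) has_real_derivative 0) (at 0)"
        using dA[OF zz] dB[OF zz] nz[of v] by simp_all
      let ?E = "\<lambda>t. k * (P (z0 + t *\<^sub>R v))\<^sup>2 + (Q (z0 + t *\<^sub>R v))\<^sup>2 - k * (A (z0 + t *\<^sub>R v))\<^sup>2 + (B (z0 + t *\<^sub>R v))\<^sup>2"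
      have "(?E has_real_derivative 2 * r0 * mink (?D v) u1) (at 0)"
        by (rule derivative_eq_intros dP dQ dAB refl)+ (simp add: at0)
      moreover have "(?E has_real_derivative 0) (at 0)"
      proof (rule has_field_derivative_transform_within_open[of "\<lambda>_. -1" _ _ "(\<lambda>t. z0 + t *\<^sub>R v) -` U"])
        show "open ((\<lambda>t. z0 + t *\<^sub>R v) -` U)" by (intro open_vimage c(4) continuous_intros)
      qed (use z0(1) hyp in auto)
      ultimately have "2 * r0 * mink (?D v) u1 = 0" by (rule DERIV_unique)
      then show ?thesis using r0 by simp
    qed
    have Dv: "?D v = fr 0 (mink (?D v) u2) 0 0" for v
      using fr_expand[of "?D v"] nz[of v] P1[of v] by (simp add: A1_def B1_def)
    define q1 where "q1 = mink (?D (1, 0)) u2"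
    define q2 where "q2 = mink (?D (0, 1)) u2"
    have inj0: "?D v = 0 \<Longrightarrow> v = 0" for v using inj[OF z0(1)] linear_injective_0[OF lin] by blast
    have "?D (q2 *\<^sub>R (1, 0) - q1 *\<^sub>R (0, 1)) = q2 *\<^sub>R ?D (1, 0) - q1 *\<^sub>R ?D (0, 1)"
      by (simp only: linear_diff[OF lin] linear_scale[OF lin])
    also have "\<dots> = fr 0 (q2 * q1 - q1 * q2) 0 0"
      using Dv[of "(1, 0)"] Dv[of "(0, 1)"] by (metis fr_ops(2) fr_ops(3) q1_def q2_def mult_zero_right diff_self)
    finally have "q2 *\<^sub>R ((1, 0) :: real \<times> real) - q1 *\<^sub>R (0, 1) = 0" using inj0 by (simp add: fr_ops)
    then have "q1 = 0" by (simp add: prod_eq_iff)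
    then have "?D (1, 0) = 0" using Dv[of "(1, 0)"] by (simp add: q1_def fr_ops)
    then have "(1 :: real, 0 :: real) = 0" by (rule inj0)
    then show False by (simp add: prod_eq_iff)
  qed
  have fcont: "continuous_on U f" using ck by (metis D(1) has_derivative_continuous continuous_at_imp_continuous_on)
  have cont: "continuous_on U P" "continuous_on U Q" "continuous_on U (A1 v)" "continuous_on U (B1 v)"
    "continuous_on U (A2 v)" "continuous_on U (B2 v)"
    unfolding P_def Q_def A1_def B1_def A2_def B2_def
    by (intro continuous_intros mink.continuous_on fcont D(3) D(4))+
  \<comment> \<open>On \<open>S\<close> the first coordinate stays positive, as the angle function
    \<open>gang\<close> requires, and the velocity of (a, b) stays nonzero.\<close>
  define S where "S = U \<inter> (\<lambda>z. min (P z) (A1 v z * A1 v z + B1 v z * B1 v z)) -` {0<..}"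
  have oS: "open S" unfolding S_def
    by (rule continuous_open_preimage) (intro continuous_intros cont c(4) open_greaterThan)+
  have "z0 \<in> S" using z0(1) at0 r0 v sum_squares_gt_zero_iff[of "A1 v z0" "B1 v z0"] by (auto simp: S_def)
  then obtain \<rho> where \<rho>: "\<rho> > 0" "ball z0 \<rho> \<subseteq> S" using oS open_contains_ball by blast
  define \<delta> where "\<delta> = \<rho> / (norm v + 1)"
  have \<delta>: "\<delta> > 0" using \<rho>(1) by (simp add: \<delta>_def add_nonneg_pos)
  let ?J = "{-\<delta><..<\<delta>}" and ?c = "\<lambda>t. z0 + t *\<^sub>R v"
  have cS: "?c t \<in> S" if "t \<in> ?J" for t
  proof -
    have "norm (t *\<^sub>R v) \<le> \<bar>t\<bar> * (norm v + 1)" by (simp add: algebra_simps)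
    also have "\<dots> < \<delta> * (norm v + 1)" using that by (intro mult_strict_right_mono) (auto simp: add_nonneg_pos)
    also have "\<dots> = \<rho>" by (simp add: \<delta>_def add_nonneg_eq_0_iff)
    finally show ?thesis using \<rho>(2) by (auto simp: dist_norm)
  qed
  have cU: "?c t \<in> U" and Pp: "P (?c t) > 0" and AB: "A1 v (?c t) \<noteq> 0 \<or> B1 v (?c t) \<noteq> 0" if "t \<in> ?J" for t
    using cS[OF that] by (auto simp: S_def)
  have cc: "continuous_on ?J ?c" by (intro continuous_intros)
  have ccU: "continuous_on ?J (\<lambda>t. h (?c t))" if "continuous_on U h" for h :: "real \<times> real \<Rightarrow> real"
    by (rule continuous_on_compose2[OF that cc]) (use cU in auto)
  define a where "a t = A (?c t)" for t
  define b where "b t = B (?c t)" for t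
  have hq: "(P (?c t))\<^sup>2 + k * (Q (?c t))\<^sup>2 > 0" if t: "t \<in> ?J" for t
  proof (cases "k = 1")
    case True
    then show ?thesis using Pp[OF t] by (simp add: add_pos_nonneg)
  next
    case False
    then have km: "k = -1" using k by simp
    have "usq (A (?c t)) (B (?c t)) = A (?c t) * A (?c t) + B (?c t) * B (?c t) + 1"
      unfolding usq_def using km by simp
    then show ?thesis using us[OF cU[OF t]] zero_le_square[of "A (?c t)"] zero_le_square[of "B (?c t)"] by linarith
  qed
  have up: "usq (a t) (b t) > 0" if "t \<in> ?J" for t using us[OF cU[OF that]] hq[OF that] by (simp add: a_def b_def)
  have R: "regular_profile ?J a (\<lambda>t. A1 v (?c t)) (\<lambda>t. A2 v (?c t)) b (\<lambda>t. B1 v (?c t)) (\<lambda>t. B2 v (?c t))"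
    unfolding regular_profile_def
    using dA[OF cU] dB[OF cU] dA1[OF cU] dB1[OF cU] up AB ccU[OF cont(5)] ccU[OF cont(6)]
    by (simp add: a_def[abs_def] b_def[abs_def])
  have r: "rad a b t > 0" "(rad a b t)\<^sup>2 = (P (?c t))\<^sup>2 + k * (Q (?c t))\<^sup>2" if "t \<in> ?J" for t
    using rad_pos[of a t b, OF up[OF that]] rad_squared[of a t b, OF up[OF that]] us[OF cU[OF that]]
    by (simp_all add: a_def b_def power2_eq_square)
  \<comment> \<open>Minus the polar angle in the plane of the rotation, so that the rotated point
    has second coordinate 0.\<close>
  define \<theta> where "\<theta> t = - gang k (Q (?c t) / rad a b t)" for t
  define \<gamma> where "\<gamma> t = \<phi> (\<theta> t) (q (?c t))" for t
  have c\<theta>: "continuous_on ?J \<theta>"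
    unfolding \<theta>_def
  proof (intro continuous_intros continuous_on_gang)
    show "continuous_on ?J (rad a b)"
      unfolding rad_def usq_def a_def b_def A_def B_def
      by (intro continuous_intros mink.continuous_on continuous_on_compose2[OF fcont cc]) (use cU in auto)
    show "continuous_on ?J (\<lambda>t. Q (?c t))" by (rule ccU[OF cont(2)])
    show "\<forall>t\<in>?J. rad a b t \<noteq> 0" using r(1) by (metis less_irrefl)
    show "\<bar>Q (?c t) / rad a b t\<bar> \<le> 1" if "t \<in> ?J" "k = 1" for t
    proof -
      have "(Q (?c t))\<^sup>2 \<le> (rad a b t)\<^sup>2" using r(2)[OF that(1)] that(2) by simp
      then have "\<bar>Q (?c t)\<bar> \<le> rad a b t" using r(1)[OF that(1)] by (simp add: abs_le_square_iff[symmetric])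
      then show ?thesis using r(1)[OF that(1)] by (simp add: abs_divide)
    qed
  qed
  have qcc: "continuous_on ?J (\<lambda>t. q (?c t))" by (rule continuous_on_compose2[OF qc cc]) (use cU in auto)
  have "lift_on ?J \<gamma> a b"
    unfolding lift_on_def
  proof (intro conjI ballI)
    show "continuous_on ?J \<gamma>"
      unfolding \<gamma>_def by (rule continuous_on_\<phi>[OF c\<theta> qcc]) (use qM cU in blast)
    show "\<gamma> ` ?J \<subseteq> M" unfolding \<gamma>_def using \<phi>_M[OF qM[OF cU]] by blast
    fix t assume t: "t \<in> ?J"
    note G = gang[OF k Pp[OF t] r[OF t]]
    have "x (q (?c t)) = fr (P (?c t)) (Q (?c t)) (a t) (b t)"
      using fz[of "?c t"] by (simp add: f_def a_def b_def)
    from x_\<phi>[OF qM[OF cU[OF t]] this, of "\<theta> t"]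
    have "x (\<gamma> t) = fr (P (?c t) / rad a b t * P (?c t) + k * (Q (?c t) / rad a b t) * Q (?c t))
        (- (Q (?c t) / rad a b t) * P (?c t) + P (?c t) / rad a b t * Q (?c t)) (a t) (b t)"
      by (simp add: \<gamma>_def \<theta>_def G)
    also have "P (?c t) / rad a b t * P (?c t) + k * (Q (?c t) / rad a b t) * Q (?c t) = (rad a b t)\<^sup>2 / rad a b t"
      unfolding r(2)[OF t] by (simp add: power2_eq_square add_divide_distrib)
    finally show "x (\<gamma> t) = fr (rad a b t) 0 (a t) (b t)" by (simp add: power2_eq_square)
  qed
  moreover have "\<gamma> 0 = m" using z0 at0 \<phi>_0[OF m(1)] by (simp add: \<gamma>_def \<theta>_def gang_def)
  ultimately show ?thesis using that[OF \<delta> R] by blast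
qed

text \<open>The velocity of the profile curve is orthogonal to the timelike position, hence its
  square \<open>E\<close> is positive. A change of time with speed \<open>h\<close> = sqrt(u / E)
  gives h^2 E = u, which is conformality; the sign of the normal is then removed by the preceding
  reversal argument.\<close>

lemma exists_cmc_lift:
  assumes m: "m \<in> M" "x m = fr r0 0 a0 b0" and r0: "r0 > 0"
  obtains \<delta> \<gamma> a a1 b b1 where "\<delta> > 0" "cmc_profile {-\<delta><..<\<delta>} a a1 b b1"
    "lift_on {-\<delta><..<\<delta>} \<gamma> a b" "\<gamma> 0 = m"
proof -
  obtain \<delta> \<gamma> a a1 a2 b b1 b2 where \<delta>: "\<delta> > 0" and R: "regular_profile {-\<delta><..<\<delta>} a a1 a2 b b1 b2"
    and L: "lift_on {-\<delta><..<\<delta>} \<gamma> a b" and \<gamma>0: "\<gamma> 0 = m"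
    by (rule exists_regular_lift[OF m r0])
  let ?J = "{-\<delta><..<\<delta>}"
  have d: "(a has_real_derivative a1 t) (at t)" "(a1 has_real_derivative a2 t) (at t)"
    "(b has_real_derivative b1 t) (at t)" "(b1 has_real_derivative b2 t) (at t)" "usq (a t) (b t) > 0"
    "a1 t \<noteq> 0 \<or> b1 t \<noteq> 0" if "t \<in> ?J" for t
    using R that by (auto simp: regular_profile_def)
  define u where "u t = usq (a t) (b t)" for t
  define u1 where "u1 t = 2 * (a t * a1 t - k * b t * b1 t)" for t
  define r1 where "r1 = rad' a a1 b b1"
  define r2 where "r2 = rad'' a a1 a2 b b1 b2"
  define E where "E t = k * r1 t * r1 t - k * a1 t * a1 t + b1 t * b1 t" for t
  define E1 where "E1 t = 2 * (k * r1 t * r2 t - k * a1 t * a2 t + b1 t * b2 t)" for t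
  have dr: "(rad a b has_real_derivative r1 t) (at t)" "(r1 has_real_derivative r2 t) (at t)" if "t \<in> ?J" for t
    unfolding r1_def r2_def
    by (rule rad_deriv[of a a1 t b b1, OF d(1,3,5)[OF that]], rule rad'_deriv[of a a1 t b b1 a2 b2, OF d(1,3,5,2,4)[OF that]])
  have du: "(u has_real_derivative u1 t) (at t)" if "t \<in> ?J" for t
    unfolding u_def[abs_def] u1_def usq_def
    by (rule derivative_eq_intros d[OF that] refl)+ (simp add: algebra_simps)
  have dE: "(E has_real_derivative E1 t) (at t)" if "t \<in> ?J" for t
    unfolding E_def[abs_def] E1_def
    by (rule derivative_eq_intros d[OF that] dr[OF that] refl)+ (simp add: algebra_simps)
  have upos: "u t > 0" if "t \<in> ?J" for t using d(5)[OF that] by (simp add: u_def)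
  have Epos: "E t > 0" if t: "t \<in> ?J" for t
  proof -
    have r: "rad a b t > 0" "rad a b t * rad a b t = usq (a t) (b t)" using rad_pos[of a t b] rad_squared[of a t b] d(5)[OF t] by auto
    have m: "rad a b t * r1 t = a t * a1 t - k * b t * b1 t" using r(1) by (simp add: r1_def rad'_def)
    let ?F = "fr (rad a b t) 0 (a t) (b t)" and ?T = "fr (r1 t) 0 (a1 t) (b1 t)"
    have "mink ?F ?F = k * (rad a b t * rad a b t) - k * a t * a t + b t * b t" by (simp add: mink_fr)
    also have "\<dots> = -1" unfolding r(2) usq_def by (simp add: algebra_simps)
    finally have F: "mink ?F ?F < 0" by simp
    have "mink ?F ?T = k * (rad a b t * r1 t) - k * a t * a1 t + b t * b1 t" by (simp add: mink_fr)
    then have FT: "mink ?F ?T = 0" unfolding m by (simp add: algebra_simps)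
    have "?T \<noteq> fr 0 0 0 0" using d(6)[OF t] unfolding fr_eq_iff by blast
    then have "?T \<noteq> 0" by (simp add: fr_ops(4))
    from mink_pos_of_orth_timelike[OF F FT this] show ?thesis by (simp add: mink_fr E_def)
  qed
  define h where "h t = sqrt (u t / E t)" for t
  define h1 where "h1 t = ((u1 t * E t - u t * E1 t) / (E t * E t)) / (2 * h t)" for t
  have hpos: "h t > 0" and hsq: "h t * h t * E t = u t" if "t \<in> ?J" for t
    using upos[OF that] Epos[OF that] by (simp_all add: h_def)
  have dh: "(h has_real_derivative h1 t) (at t)" if t: "t \<in> ?J" for t
  proof -
    have "((\<lambda>t. u t / E t) has_real_derivative (u1 t * E t - u t * E1 t) / (E t * E t)) (at t)"
      by (rule DERIV_divide[OF du[OF t] dE[OF t]]) (use Epos[OF t] in simp)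
    note DERIV_chain2[OF DERIV_real_sqrt this]
    then have "(h has_real_derivative inverse (sqrt (u t / E t)) / 2 * ((u1 t * E t - u t * E1 t) / (E t * E t))) (at t)"
      unfolding h_def[abs_def] using upos[OF t] Epos[OF t] by simp
    moreover have "inverse (sqrt (u t / E t)) / 2 * ((u1 t * E t - u t * E1 t) / (E t * E t)) = h1 t"
      unfolding h1_def h_def by (simp add: inverse_eq_divide)
    ultimately show ?thesis by simp
  qed
  have cJ: "continuous_on ?J f" if "\<And>t. t \<in> ?J \<Longrightarrow> (f has_real_derivative f' t) (at t)" for f f' :: "real \<Rightarrow> real"
    using that DERIV_isCont continuous_at_imp_continuous_on by blast
  have c2: "continuous_on ?J a2" "continuous_on ?J b2" using R by (auto simp: regular_profile_def)
  note cs = cJ[OF d(1)] cJ[OF d(2)] cJ[OF d(3)] cJ[OF d(4)] cJ[OF dr(1)] cJ[OF dr(2)] cJ[OF du] cJ[OF dE] cJ[OF dh] c2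
  have cr2: "continuous_on ?J r2"
    unfolding r2_def rad''_def[abs_def] r1_def[symmetric]
    by (intro continuous_intros cs; (assumption)?) (use rad_pos[of a _ b] d(5) in force)
  have ch1: "continuous_on ?J h1"
    unfolding h1_def u1_def E1_def
    by (intro continuous_intros cs cr2; (assumption)?) (use hpos Epos in force)+
  obtain \<epsilon> \<sigma> where \<epsilon>: "\<epsilon> > 0" and \<sigma>0: "\<sigma> 0 = 0" and \<sigma>J: "\<And>s. s \<in> {-\<epsilon><..<\<epsilon>} \<Longrightarrow> \<sigma> s \<in> ?J"
    and d\<sigma>: "\<And>s. s \<in> {-\<epsilon><..<\<epsilon>} \<Longrightarrow> (\<sigma> has_real_derivative h (\<sigma> s)) (at s)"
    by (rule time_change_exists[OF \<delta> cs(9) hpos]) auto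
  let ?I = "{-\<epsilon><..<\<epsilon>}"
  have c\<sigma>: "continuous_on ?I \<sigma>" using d\<sigma> DERIV_isCont continuous_at_imp_continuous_on by blast
  have comp: "continuous_on ?I (\<lambda>s. f (\<sigma> s))" if "continuous_on ?J f" for f :: "real \<Rightarrow> real"
    by (rule continuous_on_compose2[OF that c\<sigma>]) (use \<sigma>J in auto)
  have chain: "((\<lambda>s. f (\<sigma> s)) has_real_derivative f' (\<sigma> s) * h (\<sigma> s)) (at s)"
    if "\<And>t. t \<in> ?J \<Longrightarrow> (f has_real_derivative f' t) (at t)" "s \<in> ?I" for f f' :: "real \<Rightarrow> real" and s
    by (rule DERIV_chain2[OF that(1)[OF \<sigma>J[OF that(2)]] d\<sigma>[OF that(2)]])
  have dah: "((\<lambda>t. a1 t * h t) has_real_derivative (a2 t * h t + h1 t * a1 t)) (at t)"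
    "((\<lambda>t. b1 t * h t) has_real_derivative (b2 t * h t + h1 t * b1 t)) (at t)" if "t \<in> ?J" for t
    by (rule DERIV_mult[OF d(2)[OF that] dh[OF that]], rule DERIV_mult[OF d(4)[OF that] dh[OF that]])
  have R': "regular_profile ?I (\<lambda>s. a (\<sigma> s)) (\<lambda>s. a1 (\<sigma> s) * h (\<sigma> s)) (\<lambda>s. (a2 (\<sigma> s) * h (\<sigma> s) + h1 (\<sigma> s) * a1 (\<sigma> s)) * h (\<sigma> s))
     (\<lambda>s. b (\<sigma> s)) (\<lambda>s. b1 (\<sigma> s) * h (\<sigma> s)) (\<lambda>s. (b2 (\<sigma> s) * h (\<sigma> s) + h1 (\<sigma> s) * b1 (\<sigma> s)) * h (\<sigma> s))"
    unfolding regular_profile_def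
  proof (intro conjI ballI)
    fix s assume s: "s \<in> ?I"
    show "((\<lambda>s. a (\<sigma> s)) has_real_derivative a1 (\<sigma> s) * h (\<sigma> s)) (at s)" by (rule chain[OF d(1) s])
    show "((\<lambda>s. b (\<sigma> s)) has_real_derivative b1 (\<sigma> s) * h (\<sigma> s)) (at s)" by (rule chain[OF d(3) s])
    show "((\<lambda>s. a1 (\<sigma> s) * h (\<sigma> s)) has_real_derivative (a2 (\<sigma> s) * h (\<sigma> s) + h1 (\<sigma> s) * a1 (\<sigma> s)) * h (\<sigma> s)) (at s)"
      by (rule chain[OF dah(1) s])
    show "((\<lambda>s. b1 (\<sigma> s) * h (\<sigma> s)) has_real_derivative (b2 (\<sigma> s) * h (\<sigma> s) + h1 (\<sigma> s) * b1 (\<sigma> s)) * h (\<sigma> s)) (at s)"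
      by (rule chain[OF dah(2) s])
    show "usq (a (\<sigma> s)) (b (\<sigma> s)) > 0" by (rule d(5)[OF \<sigma>J[OF s]])
    show "a1 (\<sigma> s) * h (\<sigma> s) \<noteq> 0 \<or> b1 (\<sigma> s) * h (\<sigma> s) \<noteq> 0"
      using d(6)[OF \<sigma>J[OF s]] hpos[OF \<sigma>J[OF s]] by auto
  qed (intro continuous_intros comp cs ch1; assumption?)+
  have rc: "rad (\<lambda>s. a (\<sigma> s)) (\<lambda>s. b (\<sigma> s)) s = rad a b (\<sigma> s)" for s by (simp add: rad_def)
  have L': "lift_on ?I (\<lambda>s. \<gamma> (\<sigma> s)) (\<lambda>s. a (\<sigma> s)) (\<lambda>s. b (\<sigma> s))"
    unfolding lift_on_def rc
  proof (intro conjI ballI)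
    show "continuous_on ?I (\<lambda>s. \<gamma> (\<sigma> s))"
      by (rule continuous_on_compose2[OF _ c\<sigma>, of ?J]) (use L \<sigma>J in \<open>auto simp: lift_on_def\<close>)
  qed (use L \<sigma>J in \<open>auto simp: lift_on_def\<close>)
  have "conformal ?I (\<lambda>s. a (\<sigma> s)) (\<lambda>s. a1 (\<sigma> s) * h (\<sigma> s)) (\<lambda>s. b (\<sigma> s)) (\<lambda>s. b1 (\<sigma> s) * h (\<sigma> s))"
    unfolding conformal_def
  proof
    fix s assume s: "s \<in> ?I"
    have r': "rad' (\<lambda>s. a (\<sigma> s)) (\<lambda>s. a1 (\<sigma> s) * h (\<sigma> s)) (\<lambda>s. b (\<sigma> s)) (\<lambda>s. b1 (\<sigma> s) * h (\<sigma> s)) s = r1 (\<sigma> s) * h (\<sigma> s)"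
      by (simp add: rad'_def rc r1_def algebra_simps diff_divide_distrib)
    have "k * (r1 (\<sigma> s) * h (\<sigma> s)) * (r1 (\<sigma> s) * h (\<sigma> s)) - k * (a1 (\<sigma> s) * h (\<sigma> s)) * (a1 (\<sigma> s) * h (\<sigma> s))
        + (b1 (\<sigma> s) * h (\<sigma> s)) * (b1 (\<sigma> s) * h (\<sigma> s)) = h (\<sigma> s) * h (\<sigma> s) * E (\<sigma> s)"
      by (simp add: E_def algebra_simps)
    also have "\<dots> = usq (a (\<sigma> s)) (b (\<sigma> s))" using hsq[OF \<sigma>J[OF s]] by (simp add: u_def)
    finally show "k * rad' (\<lambda>s. a (\<sigma> s)) (\<lambda>s. a1 (\<sigma> s) * h (\<sigma> s)) (\<lambda>s. b (\<sigma> s)) (\<lambda>s. b1 (\<sigma> s) * h (\<sigma> s)) s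
        * rad' (\<lambda>s. a (\<sigma> s)) (\<lambda>s. a1 (\<sigma> s) * h (\<sigma> s)) (\<lambda>s. b (\<sigma> s)) (\<lambda>s. b1 (\<sigma> s) * h (\<sigma> s)) s
        - k * (a1 (\<sigma> s) * h (\<sigma> s)) * (a1 (\<sigma> s) * h (\<sigma> s)) + (b1 (\<sigma> s) * h (\<sigma> s)) * (b1 (\<sigma> s) * h (\<sigma> s))
      = usq (a (\<sigma> s)) (b (\<sigma> s))" by (simp only: r')
  qed
  from conformal_profile_cmc[OF \<epsilon> R' L' this]
  obtain a' a1' b' b1' \<gamma>' where "cmc_profile ?I a' a1' b' b1'" "lift_on ?I \<gamma>' a' b'" "\<gamma>' 0 = \<gamma> (\<sigma> 0)" by blast
  with that[OF \<epsilon>] \<sigma>0 \<gamma>0 show ?thesis by simp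
qed

lemma cmc_profile_unique:
  assumes P: "cmc_profile J a a1 b b1" "cmc_profile J a' a1' b' b1'" and J: "is_interval J" and t0: "t0 \<in> J"
    and eq: "a t0 = a' t0" "a1 t0 = a1' t0" "b t0 = b' t0" "b1 t0 = b1' t0" and t: "t \<in> J"
  shows "a t = a' t" "b t = b' t"
proof -
  define F :: "real \<times> real \<times> real \<times> real \<Rightarrow> real \<times> real \<times> real \<times> real" where
    "F y = (fst (snd y), acc_a (fst y) (fst (snd y)) (fst (snd (snd y))) (snd (snd (snd y))),
       snd (snd (snd y)), acc_b (fst y) (fst (snd y)) (fst (snd (snd y))) (snd (snd (snd y))))" for y
  have coord: "locally_lipschitz (\<lambda>y :: real \<times> real \<times> real \<times> real. fst y)" "locally_lipschitz (\<lambda>y :: real \<times> real \<times> real \<times> real. fst (snd y))"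
    "locally_lipschitz (\<lambda>y :: real \<times> real \<times> real \<times> real. fst (snd (snd y)))" "locally_lipschitz (\<lambda>y :: real \<times> real \<times> real \<times> real. snd (snd (snd y)))"
    by (intro locally_lipschitz_bounded_linear bounded_linear_fst_comp bounded_linear_snd_comp bounded_linear_fst bounded_linear_snd)+
  have diff: "locally_lipschitz (\<lambda>y. f y - g y)" if "locally_lipschitz f" "locally_lipschitz g"
    for f g :: "real \<times> real \<times> real \<times> real \<Rightarrow> real"
    using locally_lipschitz_add[OF that(1) locally_lipschitz_mult[OF locally_lipschitz_const[of "-1"] that(2)]] by simp
  have F: "locally_lipschitz F"
    unfolding F_def[abs_def] acc_a_def acc_b_def usq_def
    by (intro locally_lipschitz_Pair diff locally_lipschitz_add locally_lipschitz_mult coord locally_lipschitz_const)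
  have ode: "((\<lambda>t. (a t, a1 t, b t, b1 t)) has_vector_derivative F (a s, a1 s, b s, b1 s)) (at s)"
    if "cmc_profile J a a1 b b1" "s \<in> J" for a a1 b b1 s
    using that unfolding cmc_profile_def F_def
    by (auto intro!: has_vector_derivative_Pair simp flip: has_real_derivative_iff_has_vector_derivative)
  have "(a t, a1 t, b t, b1 t) = (a' t, a1' t, b' t, b1' t)"
    by (rule ode_unique[OF F J ode[OF P(1)] ode[OF P(2)] t0 _ t]) (use eq in auto)
  then show "a t = a' t" "b t = b' t" by simp_all
qed

text \<open>For \<open>k = -1\<close> the hyperboloid gives p^2 - q^2 = 1 + a^2 + b^2 with p > 0, so
  a boost reaches the meridian. For \<open>k = 1\<close> the point is off the axis and a circular
  rotation does.\<close>

lemma rotate_to_meridian: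
  assumes m: "m \<in> M" "x m = fr p q a b" and off: "k = 1 \<Longrightarrow> p \<noteq> 0 \<or> q \<noteq> 0"
  obtains \<theta> r where "r > 0" "x (\<phi> \<theta> m) = fr r 0 a b" "\<phi> \<theta> m \<in> M"
proof -
  have h: "k * p\<^sup>2 + q\<^sup>2 - k * a\<^sup>2 + b\<^sup>2 = -1" "k = -1 \<Longrightarrow> p > 0" using fr_hyp3[of p q a b] x_hyp3[OF m(1)] m(2) by auto
  have pos: "p\<^sup>2 + k * q\<^sup>2 > 0"
  proof (cases "k = 1")
    case True
    then show ?thesis using off sum_power2_gt_zero_iff[of p q] by simp
  next
    case False
    then have "p\<^sup>2 + k * q\<^sup>2 = 1 + a\<^sup>2 + b\<^sup>2" using h(1) k by auto
    then show ?thesis using zero_le_power2[of a] zero_le_power2[of b] by linarith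
  qed
  define r where "r = sqrt (p\<^sup>2 + k * q\<^sup>2)"
  have r: "r > 0" "r\<^sup>2 = p\<^sup>2 + k * q\<^sup>2" using pos by (simp_all add: r_def)
  obtain \<theta> where \<theta>: "gcos (-k) \<theta> = p / r" "gsin (-k) \<theta> = - (q / r)"
  proof (cases "k = 1")
    case True
    have "(p / r)\<^sup>2 + (q / r)\<^sup>2 = (p\<^sup>2 + k * q\<^sup>2) / r\<^sup>2" using True by (simp add: power_divide add_divide_distrib)
    also have "\<dots> = 1" using r(1) by (simp flip: r(2))
    finally have "(p / r)\<^sup>2 + (- (q / r))\<^sup>2 = 1" by simp
    then obtain t where "p / r = cos t" "- (q / r) = sin t" using sincos_total_2pi by metis
    then show ?thesis using that[of t] True by (simp add: gcos_def gsin_def)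
  next
    case False
    then have km: "k = -1" using k by simp
    show ?thesis
      using that[of "- gang k (q / r)"] gang[OF k h(2)[OF km] r] by simp
  qed
  have "x (\<phi> \<theta> m) = fr ((p\<^sup>2 + k * q\<^sup>2) / r) 0 a b"
    unfolding x_\<phi>[OF m] \<theta> by (simp add: fr_eq_iff power2_eq_square add_divide_distrib)
  also have "(p\<^sup>2 + k * q\<^sup>2) / r = r" unfolding r(2)[symmetric] by (simp add: power2_eq_square)
  finally show ?thesis using that r(1) \<phi>_M[OF m(1)] by blast
qed

subsection \<open>Continuation of the profile curve\<close>

lemma cmc_profile_shift:
  assumes "cmc_profile J a a1 b b1"
  shows "cmc_profile {t. t - c \<in> J} (\<lambda>t. a (t - c)) (\<lambda>t. a1 (t - c)) (\<lambda>t. b (t - c)) (\<lambda>t. b1 (t - c))"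
proof -
  have "((\<lambda>t. f (t - c)) has_real_derivative D) (at t)" if "(f has_real_derivative D) (at (t - c))" for f :: "real \<Rightarrow> real" and D t
    using DERIV_at_within_shift[of f D "-c" t UNIV] that by simp
  then show ?thesis using assms unfolding cmc_profile_def by blast
qed

lemma lift_on_shift:
  assumes "lift_on J \<gamma> a b"
  shows "lift_on {t. t - c \<in> J} (\<lambda>t. \<gamma> (t - c)) (\<lambda>t. a (t - c)) (\<lambda>t. b (t - c))"
  unfolding lift_on_def
proof (intro conjI ballI)
  show "continuous_on {t. t - c \<in> J} (\<lambda>t. \<gamma> (t - c))"
    by (rule continuous_on_compose2[of J \<gamma>]) (use assms in \<open>auto simp: lift_on_def intro!: continuous_intros\<close>)
qed (use assms in \<open>auto simp: lift_on_def rad_def\<close>)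

lemma lift_on_cong:
  assumes "lift_on J \<gamma> a b" "\<And>t. t \<in> J \<Longrightarrow> a t = a' t" "\<And>t. t \<in> J \<Longrightarrow> b t = b' t"
  shows "lift_on J \<gamma> a' b'"
  using assms by (auto simp: lift_on_def rad_def)

text \<open>Two profile curves through the same point are tangent there; if their directions were
  opposite, they would have mean curvature \<open>H\<close> for opposite normals.\<close>

lemma lift_junction:
  assumes J: "open J" "open J'" and P: "cmc_profile J a a1 b b1" "cmc_profile J' a' a1' b' b1'"
    and L: "lift_on J \<gamma> a b" "lift_on J' \<gamma>' a' b'" and t: "t1 \<in> J" "t2 \<in> J'" "\<gamma> t1 = \<gamma>' t2"
  shows "a t1 = a' t2" "b t1 = b' t2" "a1 t1 = a1' t2" "b1 t1 = b1' t2"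
proof -
  have xe: "fr (rad a b t1) 0 (a t1) (b t1) = fr (rad a' b' t2) 0 (a' t2) (b' t2)"
    using L t unfolding lift_on_def by metis
  then show ab: "a t1 = a' t2" "b t1 = b' t2" by (simp_all add: fr_eq_iff)
  obtain U where U: "(0, t1) \<in> U" "U \<subseteq> UNIV \<times> J" "local_param M x U (sweep \<gamma>)"
    by (rule sweep_local_param[OF J(1) cmc_profile_regular[OF P(1)] L(1), of "(0, t1)"]) (use t in auto)
  then obtain g where g: "homeomorphism U (sweep \<gamma> ` U) (sweep \<gamma>) g" and oO: "openin (top_of_set M) (sweep \<gamma> ` U)"
    unfolding local_param_def by blast
  have s0: "sweep \<gamma> (0, t1) = \<gamma>' t2" using \<phi>_0 L(1) t by (auto simp: sweep_def lift_on_def)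
  have \<gamma>c: "continuous_on J' \<gamma>'" "\<gamma>' \<in> J' \<rightarrow> M" using L(2) by (auto simp: lift_on_def)
  have "openin (top_of_set J') (J' \<inter> \<gamma>' -` (sweep \<gamma> ` U))"
    by (rule continuous_openin_preimage[OF \<gamma>c oO])
  then have "open (J' \<inter> \<gamma>' -` (sweep \<gamma> ` U))" using J(2) openin_open_trans by blast
  moreover have "t2 \<in> J' \<inter> \<gamma>' -` (sweep \<gamma> ` U)" using t(2) imageI[OF U(1), of "sweep \<gamma>"] by (simp add: s0)
  ultimately obtain \<eta> where \<eta>: "\<eta> > 0" "ball t2 \<eta> \<subseteq> J' \<inter> \<gamma>' -` (sweep \<gamma> ` U)" using open_contains_ball by blast
  define I where "I = ball t2 \<eta>"
  have I: "open I" "is_interval I" "t2 \<in> I" "I \<subseteq> J'" "\<And>t. t \<in> I \<Longrightarrow> \<gamma>' t \<in> sweep \<gamma> ` U"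
    using \<eta> by (auto simp: I_def is_interval_ball_real)
  \<comment> \<open>The second arc is read in the chart swept out by the first; \<tau> is the
    profile parameter it acquires there. The arcs differ by a rotation and the change of parameter
    \<tau>.\<close>
  define \<zeta> where "\<zeta> t = g (\<gamma>' t)" for t
  define \<tau> where "\<tau> t = snd (\<zeta> t)" for t
  have gs: "\<And>z. z \<in> U \<Longrightarrow> g (sweep \<gamma> z) = z" and sg: "\<And>y. y \<in> sweep \<gamma> ` U \<Longrightarrow> sweep \<gamma> (g y) = y"
    and gU: "g ` sweep \<gamma> ` U = U" and gc: "continuous_on (sweep \<gamma> ` U) g"
    using g by (auto simp: homeomorphism_def)
  have \<zeta>U: "\<zeta> t \<in> U" "sweep \<gamma> (\<zeta> t) = \<gamma>' t" if "t \<in> I" for t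
    using I(5)[OF that] gU sg by (auto simp: \<zeta>_def)
  have \<tau>2: "\<tau> t2 = t1" using gs[OF U(1)] by (simp add: \<tau>_def \<zeta>_def s0)
  have \<tau>J: "\<tau> t \<in> J" if "t \<in> I" for t using \<zeta>U(1)[OF that] U(2) by (auto simp: \<tau>_def)
  have \<tau>c: "continuous_on I \<tau>"
    unfolding \<tau>_def \<zeta>_def
    by (intro continuous_on_snd continuous_on_compose2[OF gc] continuous_on_subset[OF \<gamma>c(1) I(4)]) (use I(5) in blast)
  have eq: "a' t = a (\<tau> t)" "b' t = b (\<tau> t)" if tI: "t \<in> I" for t
  proof -
    have "patch a b (\<zeta> t) = x (\<gamma>' t)"
      using x_sweep(1)[OF L(1), of "\<zeta> t"] \<zeta>U[OF tI] U(2) by auto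
    also have "\<dots> = fr (rad a' b' t) 0 (a' t) (b' t)" using L(2) I(4) tI by (auto simp: lift_on_def)
    finally show "a' t = a (\<tau> t)" "b' t = b (\<tau> t)" by (simp_all add: patch_def fr_eq_iff \<tau>_def)
  qed
  have d: "(a has_real_derivative a1 t) (at t)" "(a1 has_real_derivative acc_a (a t) (a1 t) (b t) (b1 t)) (at t)"
    "(b has_real_derivative b1 t) (at t)" "(b1 has_real_derivative acc_b (a t) (a1 t) (b t) (b1 t)) (at t)"
    "usq (a t) (b t) > 0" "k * (a t * a1 t - k * b t * b1 t) * (a t * a1 t - k * b t * b1 t)
          + usq (a t) (b t) * (b1 t * b1 t - k * a1 t * a1 t) = usq (a t) (b t) * usq (a t) (b t)"
    if "cmc_profile J a a1 b b1" "t \<in> J" for J a a1 b b1 t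
    using that unfolding cmc_profile_def by blast+
  have nz: "a1 t * a1 t + b1 t * b1 t > 0" if "t \<in> J" for t
    using normal_nonzero(2)[OF d(5,6)[OF P(1) that]] sum_squares_gt_zero_iff[of "a1 t" "b1 t"] by blast
  \<comment> \<open>The coefficient of (a1', b1') along (a1, b1), which turns out to be the
    derivative of \<tau>. Conformality of both curves forces it to be 1 or -1.\<close>
  define e where "e t = (a1' t * a1 (\<tau> t) + b1' t * b1 (\<tau> t)) / (a1 (\<tau> t) * a1 (\<tau> t) + b1 (\<tau> t) * b1 (\<tau> t))" for t
  have d\<tau>: "(\<tau> has_real_derivative e t) (at t)" if tI: "t \<in> I" for t
  proof -
    let ?A = "a1 (\<tau> t)" and ?B = "b1 (\<tau> t)"
    define Lf where "Lf v = (fst v * ?A + snd v * ?B) / (?A * ?A + ?B * ?B)" for v :: "real \<times> real"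
    have Jt: "\<tau> t \<in> J" "t \<in> J'" using \<tau>J[OF tI] I(4) tI by auto
    have "((\<lambda>t. (a t, b t)) has_vector_derivative (?A, ?B)) (at (\<tau> t))"
      using d(1,3)[OF P(1) Jt(1)] by (intro has_vector_derivative_Pair) (simp_all flip: has_real_derivative_iff_has_vector_derivative)
    then have f: "((\<lambda>t. (a t, b t)) has_derivative (\<lambda>h. h *\<^sub>R (?A, ?B))) (at (\<tau> t))" by (simp only: has_vector_derivative_def)
    have "((\<lambda>t. (a' t, b' t)) has_vector_derivative (a1' t, b1' t)) (at t)"
      using d(1,3)[OF P(2) Jt(2)] by (intro has_vector_derivative_Pair) (simp_all flip: has_real_derivative_iff_has_vector_derivative)
    then have w: "((\<lambda>t. (a (\<tau> t), b (\<tau> t))) has_vector_derivative (a1' t, b1' t)) (at t)"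
      by (rule has_vector_derivative_transform_within_open[OF _ I(1) tI]) (simp add: eq)
    have "(\<tau> has_vector_derivative Lf (a1' t, b1' t)) (at t)"
    proof (rule lift_has_vector_derivative[OF f _ _ _ w])
      have "Lf = (\<lambda>v. v \<bullet> (?A / (?A * ?A + ?B * ?B), ?B / (?A * ?A + ?B * ?B)))"
        by (simp add: Lf_def[abs_def] fun_eq_iff inner_prod_def add_divide_distrib)
      then show "bounded_linear Lf" by (simp only: bounded_linear_inner_left)
      show "Lf (v *\<^sub>R (?A, ?B)) = v" for v
      proof -
        have N: "?A * ?A + ?B * ?B \<noteq> 0" using nz[OF Jt(1)] by (rule less_imp_neq[THEN not_sym])
        have "Lf (v *\<^sub>R (?A, ?B)) = v * (?A * ?A + ?B * ?B) / (?A * ?A + ?B * ?B)"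
          by (simp add: Lf_def algebra_simps)
        then show ?thesis by (simp only: nonzero_mult_div_cancel_right[OF N])
      qed
      show "isCont \<tau> t" using \<tau>c I(1) tI by (simp add: continuous_on_eq_continuous_at)
    qed
    then show ?thesis by (simp add: Lf_def e_def has_real_derivative_iff_has_vector_derivative)
  qed
  have chain: "a1' t = a1 (\<tau> t) * e t" "b1' t = b1 (\<tau> t) * e t" if tI: "t \<in> I" for t
  proof -
    have Jt: "\<tau> t \<in> J" "t \<in> J'" using \<tau>J[OF tI] I(4) tI by auto
    have "(a' has_real_derivative a1 (\<tau> t) * e t) (at t)"
      by (rule has_field_derivative_transform_within_open[OF DERIV_chain2[OF d(1)[OF P(1) Jt(1)] d\<tau>[OF tI]] I(1) tI]) (simp add: eq)
    then show "a1' t = a1 (\<tau> t) * e t" using d(1)[OF P(2) Jt(2)] DERIV_unique by blast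
    have "(b' has_real_derivative b1 (\<tau> t) * e t) (at t)"
      by (rule has_field_derivative_transform_within_open[OF DERIV_chain2[OF d(3)[OF P(1) Jt(1)] d\<tau>[OF tI]] I(1) tI]) (simp add: eq)
    then show "b1' t = b1 (\<tau> t) * e t" using d(3)[OF P(2) Jt(2)] DERIV_unique by blast
  qed
  have e: "e t = 1 \<or> e t = -1" if tI: "t \<in> I" for t
  proof -
    have Jt: "\<tau> t \<in> J" "t \<in> J'" using \<tau>J[OF tI] I(4) tI by auto
    let ?a = "a (\<tau> t)" and ?b = "b (\<tau> t)" and ?a1 = "a1 (\<tau> t)" and ?b1 = "b1 (\<tau> t)"
    have "usq ?a ?b * usq ?a ?b = k * (?a * (?a1 * e t) - k * ?b * (?b1 * e t)) * (?a * (?a1 * e t) - k * ?b * (?b1 * e t))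
          + usq ?a ?b * ((?b1 * e t) * (?b1 * e t) - k * (?a1 * e t) * (?a1 * e t))"
      using d(6)[OF P(2) Jt(2)] by (simp only: eq[OF tI] chain[OF tI])
    also have "\<dots> = (e t * e t) * (k * (?a * ?a1 - k * ?b * ?b1) * (?a * ?a1 - k * ?b * ?b1) + usq ?a ?b * (?b1 * ?b1 - k * ?a1 * ?a1))"
      by (simp add: algebra_simps)
    also have "\<dots> = (e t * e t) * (usq ?a ?b * usq ?a ?b)" by (simp only: d(6)[OF P(1) Jt(1)])
    finally have "e t * e t = 1" using d(5)[OF P(1) Jt(1)] by simp
    then show ?thesis by (simp add: square_eq_1_iff)
  qed
  have ca: "continuous_on I (\<lambda>t. a1 (\<tau> t))" "continuous_on I (\<lambda>t. b1 (\<tau> t))" "continuous_on I a1'" "continuous_on I b1'"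
  proof -
    have "continuous_on J a1" "continuous_on J b1" "continuous_on I a1'" "continuous_on I b1'"
      using DERIV_isCont[OF d(2)[OF P(1)]] DERIV_isCont[OF d(4)[OF P(1)]] DERIV_isCont[OF d(2)[OF P(2)]] DERIV_isCont[OF d(4)[OF P(2)]] I(4)
      by (auto intro!: continuous_at_imp_continuous_on)
    then show "continuous_on I (\<lambda>t. a1 (\<tau> t))" "continuous_on I (\<lambda>t. b1 (\<tau> t))" "continuous_on I a1'" "continuous_on I b1'"
      using \<tau>J by (auto intro: continuous_on_compose2[OF _ \<tau>c])
  qed
  have ce: "continuous_on I e"
    unfolding e_def by (intro continuous_intros ca) (use nz \<tau>J in force)
  have "e t2 \<noteq> -1"
  proof
    assume "e t2 = -1"
    then have em: "e t = -1" if "t \<in> I" for t using continuous_sign_constant[OF ce I(2) e that I(3)] by simp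
    have a1m: "a1' t2 = - a1 t1" "b1' t2 = - b1 t1" using chain[OF I(3)] em[OF I(3)] by (simp_all add: \<tau>2)
    have dm: "acc' = acc" if "(f has_real_derivative acc) (at t1)" "(f' has_real_derivative acc') (at t2)"
      "\<And>t. t \<in> I \<Longrightarrow> f' t = - f (\<tau> t)" for f f' :: "real \<Rightarrow> real" and acc acc'
    proof -
      have "(\<tau> has_real_derivative -1) (at t2)" using d\<tau>[OF I(3)] em[OF I(3)] by simp
      from DERIV_minus[OF DERIV_chain2[of f acc \<tau>, OF _ this]] that(1)
      have "((\<lambda>t. - f (\<tau> t)) has_real_derivative acc) (at t2)" by (simp add: \<tau>2)
      then have "(f' has_real_derivative acc) (at t2)"
        by (rule has_field_derivative_transform_within_open[OF _ I(1) I(3)]) (simp add: that(3))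
      then show ?thesis using that(2) DERIV_unique by blast
    qed
    have "acc_a (a' t2) (a1' t2) (b' t2) (b1' t2) = acc_a (a t1) (a1 t1) (b t1) (b1 t1)"
      by (rule dm[OF d(2)[OF P(1) t(1)] d(2)[OF P(2) t(2)]]) (use chain em in auto)
    moreover have "acc_b (a' t2) (a1' t2) (b' t2) (b1' t2) = acc_b (a t1) (a1 t1) (b t1) (b1 t1)"
      by (rule dm[OF d(4)[OF P(1) t(1)] d(4)[OF P(2) t(2)]]) (use chain em in auto)
    \<comment> \<open>The accelerations agree although the velocities are opposite. Only the terms
      with \<open>H\<close> are odd in the velocity, so these terms vanish, contrary to
      \<open>normal_nonzero\<close>.\<close>
    ultimately have "4 * H * (usq (a t1) (b t1) * b1 t1 - (a t1 * a1 t1 - k * b t1 * b1 t1) * b t1) = 0"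
      "4 * H * k * (usq (a t1) (b t1) * a1 t1 - (a t1 * a1 t1 - k * b t1 * b1 t1) * a t1) = 0"
      unfolding a1m ab[symmetric] by (simp_all add: acc_a_def acc_b_def algebra_simps)
    then show False using normal_nonzero(1)[OF d(5,6)[OF P(1) t(1)]] H by simp
  qed
  then have "e t2 = 1" using e[OF I(3)] by blast
  then show "a1 t1 = a1' t2" "b1 t1 = b1' t2" using chain[OF I(3)] by (simp_all add: \<tau>2)
qed

lemma openin_sweep_image:
  assumes "open J" "cmc_profile J a a1 b b1" "lift_on J \<gamma> a b"
  shows "openin (top_of_set M) (sweep \<gamma> ` (UNIV \<times> J))"
proof (subst openin_subopen, intro ballI)
  fix y assume "y \<in> sweep \<gamma> ` (UNIV \<times> J)"
  then obtain z where z: "z \<in> UNIV \<times> J" "y = sweep \<gamma> z" by blast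
  obtain U where U: "z \<in> U" "U \<subseteq> UNIV \<times> J" "local_param M x U (sweep \<gamma>)"
    by (rule sweep_local_param[OF assms(1) cmc_profile_regular[OF assms(2)] assms(3) z(1)])
  then show "\<exists>T. openin (top_of_set M) T \<and> y \<in> T \<and> T \<subseteq> sweep \<gamma> ` (UNIV \<times> J)"
    unfolding local_param_def using z by (intro exI[of _ "sweep \<gamma> ` U"]) auto
qed

text \<open>In the elliptic case the plane of \<open>w1\<close> and \<open>w2\<close> cuts
  hyperbolic space in the axis. In the hyperbolic case this plane is spacelike and misses it, so
  that nothing is removed.\<close>

definition free_part :: "'m set" where
  "free_part = {m \<in> M. x m \<notin> span {w1, w2}}"

lemma exists_cmc_lift_free:
  assumes "m \<in> free_part"
  obtains \<theta> \<delta> \<gamma> a a1 b b1 where "\<delta> > 0" "cmc_profile {-\<delta><..<\<delta>} a a1 b b1"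
    "lift_on {-\<delta><..<\<delta>} \<gamma> a b" "\<gamma> 0 = \<phi> \<theta> m"
proof -
  obtain p q a0 b0 where f: "x m = fr p q a0 b0" by (rule fr_surj)
  have m: "m \<in> M" "p \<noteq> 0 \<or> q \<noteq> 0" using assms f by (auto simp: free_part_def fr_mem_span_w)
  obtain \<theta> r where "r > 0" "x (\<phi> \<theta> m) = fr r 0 a0 b0" "\<phi> \<theta> m \<in> M"
    by (rule rotate_to_meridian[OF m(1) f m(2)])
  then show ?thesis using exists_cmc_lift[of "\<phi> \<theta> m" r a0 b0] that by metis
qed

lemma sweep_in_free_part:
  assumes "cmc_profile J a a1 b b1" "lift_on J \<gamma> a b" "z \<in> UNIV \<times> J"
  shows "sweep \<gamma> z \<in> free_part"
proof -
  have "usq (a (snd z)) (b (snd z)) > 0" using assms by (auto simp: cmc_profile_def)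
  then have r: "rad a b (snd z) > 0" using rad_pos[of a "snd z" b] by blast
  have "(gcos (-k) (fst z))\<^sup>2 + k * (gsin (-k) (fst z))\<^sup>2 = 1" using gcos_gsin_squared[OF k', of "fst z"] by simp
  then have "gcos (-k) (fst z) \<noteq> 0 \<or> gsin (-k) (fst z) \<noteq> 0" by auto
  then show ?thesis
    using x_sweep[OF assms(2,3)] r by (simp add: free_part_def patch_def fr_mem_span_w)
qed

text \<open>In the elliptic case the angle is determined only up to 2 pi, and a full turn may still
  move points of \<open>M\<close>, for instance along a covering. Hence the conclusion concerns the
  matrix of the rotation and not the angle.\<close>

lemma rotation_fixing_meridian:
  assumes "fr (gcos (-k) c * r) (gsin (-k) c * r) a b = fr r' 0 a' b'" "r > 0" "r' > 0"
  shows "gcos (-k) c = 1" "gsin (-k) c = 0"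
proof -
  have e: "gcos (-k) c * r = r'" "gsin (-k) c = 0" using assms by (auto simp: fr_eq_iff)
  show "gsin (-k) c = 0" by (rule e(2))
  have "(gcos (-k) c)\<^sup>2 = 1" using gcos_gsin_squared[OF k', of c] e(2) by simp
  moreover have "gcos (-k) c > 0" using e(1) assms(2,3) by (simp add: zero_less_mult_iff flip: e(1))
  ultimately show "gcos (-k) c = 1" by (simp add: power2_eq_1_iff)
qed

text \<open>The profile curve is lifted over a maximal interval \<open>J\<close>; the surface swept out is closed in
  the part of \<open>M\<close> away from the axis, since otherwise the lift could be continued through a
  boundary point.\<close>

lemma maximal_lift:
  assumes P: "cmc_profile UNIV a a1 b b1"
    and L0: "open J0" "is_interval J0" "t0 \<in> J0" "lift_on J0 \<gamma>0 a b"
  obtains J \<gamma> where "open J" "is_interval J" "t0 \<in> J" "lift_on J \<gamma> a b"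
    "openin (top_of_set M) (free_part - sweep \<gamma> ` (UNIV \<times> J))"
proof -
  define m0 where "m0 = \<gamma>0 t0"
  \<comment> \<open>The value at \<open>t0\<close> is prescribed, so lifts over overlapping
    intervals agree and glue to a lift over the union; the choice of an interval in \<gamma> is
    therefore immaterial.\<close>
  define \<J> where "\<J> = {J. open J \<and> is_interval J \<and> t0 \<in> J \<and> (\<exists>\<gamma>. lift_on J \<gamma> a b \<and> \<gamma> t0 = m0)}"
  have "J0 \<in> \<J>" using L0 by (auto simp: \<J>_def m0_def)
  have "\<exists>\<Gamma>. \<forall>J\<in>\<J>. lift_on J (\<Gamma> J) a b \<and> \<Gamma> J t0 = m0"
    by (rule bchoice) (auto simp: \<J>_def)
  then obtain \<Gamma> where \<Gamma>: "\<And>J. J \<in> \<J> \<Longrightarrow> lift_on J (\<Gamma> J) a b" "\<And>J. J \<in> \<J> \<Longrightarrow> \<Gamma> J t0 = m0" by blast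
  have agree: "\<gamma>1 t = \<gamma>2 t"
    if "is_interval J1" "is_interval J2" "lift_on J1 \<gamma>1 a b" "lift_on J2 \<gamma>2 a b" "s \<in> J1" "s \<in> J2" "\<gamma>1 s = \<gamma>2 s"
      "t \<in> J1" "t \<in> J2" for J1 J2 \<gamma>1 \<gamma>2 s t
  proof (rule lift_unique[OF M, of "J1 \<inter> J2" \<gamma>1 \<gamma>2 s t])
    show "connected (J1 \<inter> J2)" using that(1,2) by (simp add: is_interval_Int flip: is_interval_connected_1)
    show "continuous_on (J1 \<inter> J2) \<gamma>1" "continuous_on (J1 \<inter> J2) \<gamma>2"
      using that(3,4) by (auto simp: lift_on_def intro: continuous_on_subset)
  qed (use that in \<open>auto simp: lift_on_def\<close>)
  define J where "J = \<Union>\<J>"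
  define \<gamma> where "\<gamma> t = \<Gamma> (SOME J. J \<in> \<J> \<and> t \<in> J) t" for t
  have \<gamma>eq: "\<gamma> t = \<Gamma> J' t" if "J' \<in> \<J>" "t \<in> J'" for J' t
  proof -
    let ?S = "SOME J. J \<in> \<J> \<and> t \<in> J"
    have S: "?S \<in> \<J> \<and> t \<in> ?S" by (rule someI[of _ J']) (use that in simp)
    show ?thesis unfolding \<gamma>_def
      by (rule agree[of ?S J' _ _ t0]) (use S that \<Gamma> in \<open>auto simp: \<J>_def\<close>)
  qed
  have J: "open J" "t0 \<in> J" unfolding J_def using \<open>J0 \<in> \<J>\<close> L0 by (auto simp: \<J>_def)
  have "connected J" unfolding J_def
    by (rule connected_Union) (auto simp: \<J>_def is_interval_connected_1[symmetric])
  then have Ji: "is_interval J" by (simp add: is_interval_connected_1)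
  have L: "lift_on J \<gamma> a b"
    unfolding lift_on_def
  proof (intro conjI ballI)
    show "continuous_on J \<gamma>" unfolding J_def
    proof (rule continuous_on_open_Union)
      show "continuous_on J' \<gamma>" if "J' \<in> \<J>" for J'
        by (rule continuous_on_eq[of _ "\<Gamma> J'"]) (use \<Gamma>(1)[OF that] \<gamma>eq[OF that] in \<open>auto simp: lift_on_def\<close>)
    qed (auto simp: \<J>_def)
    show "\<gamma> ` J \<subseteq> M"
    proof
      fix y assume "y \<in> \<gamma> ` J"
      then obtain t J' where "y = \<gamma> t" "t \<in> J'" "J' \<in> \<J>" by (auto simp: J_def)
      then show "y \<in> M" using \<Gamma>(1) \<gamma>eq by (auto simp: lift_on_def)
    qed
    fix t assume "t \<in> J"
    then obtain J' where "t \<in> J'" "J' \<in> \<J>" by (auto simp: J_def)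
    then show "x (\<gamma> t) = fr (rad a b t) 0 (a t) (b t)" using \<Gamma>(1) \<gamma>eq by (auto simp: lift_on_def)
  qed
  have \<gamma>0: "\<gamma> t0 = m0" using \<gamma>eq[OF \<open>J0 \<in> \<J>\<close> L0(3)] \<Gamma>(2)[OF \<open>J0 \<in> \<J>\<close>] by simp
  have PJ: "cmc_profile J' a a1 b b1" for J' using P by (auto simp: cmc_profile_def)
  have "openin (top_of_set M) (free_part - sweep \<gamma> ` (UNIV \<times> J))"
  proof (subst openin_subopen, intro ballI)
    fix m assume m: "m \<in> free_part - sweep \<gamma> ` (UNIV \<times> J)"
    then have mM: "m \<in> M" by (simp add: free_part_def)
    obtain \<theta> \<delta> \<gamma>' a' a1' b' b1' where \<delta>: "\<delta> > 0" and P': "cmc_profile {-\<delta><..<\<delta>} a' a1' b' b1'"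
      and L': "lift_on {-\<delta><..<\<delta>} \<gamma>' a' b'" and \<gamma>'0: "\<gamma>' 0 = \<phi> \<theta> m"
      by (rule exists_cmc_lift_free[of m]) (use m in auto)
    let ?I = "{-\<delta><..<\<delta>}"
    have "sweep \<gamma>' (-\<theta>, 0) = m" using \<phi>_add[OF mM, of "-\<theta>" \<theta>] \<phi>_0[OF mM] by (simp add: sweep_def \<gamma>'0)
    then have mW: "m \<in> sweep \<gamma>' ` (UNIV \<times> ?I)" using \<delta> by (intro image_eqI[of _ _ "(-\<theta>, 0)"]) auto
    have "sweep \<gamma>' ` (UNIV \<times> ?I) \<inter> sweep \<gamma> ` (UNIV \<times> J) = {}"
    proof (rule ccontr)
      assume "\<not> ?thesis"
      then obtain y where y: "y \<in> sweep \<gamma>' ` (UNIV \<times> ?I)" "y \<in> sweep \<gamma> ` (UNIV \<times> J)" by blast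
      obtain z where z: "z \<in> UNIV \<times> ?I" "y = sweep \<gamma>' z" using y(1) by blast
      obtain z' where z': "z' \<in> UNIV \<times> J" "y = sweep \<gamma> z'" using y(2) by blast
      define s t2 s' t1 where "s = fst z" and "t2 = snd z" and "s' = fst z'" and "t1 = snd z'"
      have st: "t2 \<in> ?I" "t1 \<in> J" "\<phi> s (\<gamma>' t2) = \<phi> s' (\<gamma> t1)"
        using z z' by (auto simp: sweep_def s_def t2_def s'_def t1_def)
      \<comment> \<open>Rotation by \<open>c\<close> brings the arc \<gamma>' into contact with
        \<gamma> itself.\<close>
      define c where "c = - s' + s"
      have \<gamma>'M: "\<gamma>' t \<in> M" if "t \<in> ?I" for t using L' that by (auto simp: lift_on_def)
      have \<gamma>M: "\<gamma> t1 \<in> M" using L st(2) by (auto simp: lift_on_def)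
      have ct: "\<phi> c (\<gamma>' t2) = \<gamma> t1"
      proof -
        have "\<phi> c (\<gamma>' t2) = \<phi> (- s') (\<phi> s' (\<gamma> t1))" by (simp only: c_def \<phi>_add[OF \<gamma>'M[OF st(1)]] st(3))
        also have "\<dots> = \<phi> (- s' + s') (\<gamma> t1)" by (rule \<phi>_add[OF \<gamma>M, symmetric])
        finally show ?thesis by (simp add: \<phi>_0[OF \<gamma>M])
      qed
      have x': "x (\<phi> c (\<gamma>' t)) = fr (gcos (-k) c * rad a' b' t) (gsin (-k) c * rad a' b' t) (a' t) (b' t)" if "t \<in> ?I" for t
        using x_sweep(1)[OF L', of "(c, t)"] that by (simp add: sweep_def patch_def)
      have r: "rad a' b' t2 > 0" "rad a b t1 > 0"
        using rad_pos[of a' t2 b'] rad_pos[of a t1 b] P' P st by (auto simp: cmc_profile_def)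
      have "fr (gcos (-k) c * rad a' b' t2) (gsin (-k) c * rad a' b' t2) (a' t2) (b' t2) = fr (rad a b t1) 0 (a t1) (b t1)"
        using x'[OF st(1)] ct L st(2) by (simp add: lift_on_def)
      note rot = rotation_fixing_meridian[OF this r]
      have L'': "lift_on ?I (\<lambda>t. \<phi> c (\<gamma>' t)) a' b'"
        unfolding lift_on_def
      proof (intro conjI ballI)
        show "continuous_on ?I (\<lambda>t. \<phi> c (\<gamma>' t))"
          using L' by (intro continuous_on_\<phi> continuous_intros) (auto simp: lift_on_def)
        show "(\<lambda>t. \<phi> c (\<gamma>' t)) ` ?I \<subseteq> M" using \<phi>_M[OF \<gamma>'M] by blast
        show "x (\<phi> c (\<gamma>' t)) = fr (rad a' b' t) 0 (a' t) (b' t)" if "t \<in> ?I" for t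
          using x'[OF that] by (simp add: rot)
      qed
      note junc = lift_junction[OF J(1) open_greaterThanLessThan PJ P' L L'' st(2,1) ct[symmetric]]
      \<comment> \<open>Shifting by \<open>d\<close> lets the parameters agree at the contact point.
        Uniqueness then identifies the shifted profile with (a, b), so the rotated arc is a lift of
        the same global profile over \<open>J2\<close>.\<close>
      define d where "d = t1 - t2"
      define J2 where "J2 = {t. t - d \<in> ?I}"
      have J2: "J2 = {d - \<delta><..<d + \<delta>}" by (auto simp: J2_def)
      have J2i: "is_interval J2" "open J2" by (auto simp: J2 is_interval_oo)
      have t1J2: "t1 \<in> J2" using st(1) by (simp add: J2_def d_def)
      have P2: "cmc_profile J2 (\<lambda>t. a' (t - d)) (\<lambda>t. a1' (t - d)) (\<lambda>t. b' (t - d)) (\<lambda>t. b1' (t - d))"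
        unfolding J2_def by (rule cmc_profile_shift[OF P'])
      have td: "t1 - d = t2" by (simp add: d_def)
      have eq: "a' (t - d) = a t" "b' (t - d) = b t" if "t \<in> J2" for t
        using cmc_profile_unique[OF P2 PJ J2i(1) t1J2 _ _ _ _ that] junc by (auto simp: td)
      have L2: "lift_on J2 (\<lambda>t. \<phi> c (\<gamma>' (t - d))) a b"
        by (rule lift_on_cong[OF lift_on_shift[OF L'', of d, folded J2_def]]) (use eq in auto)
      define \<gamma>3 where "\<gamma>3 t = (if t \<in> J then \<gamma> t else \<phi> c (\<gamma>' (t - d)))" for t
      have g3: "\<gamma>3 t = \<phi> c (\<gamma>' (t - d))" if "t \<in> J2" for t
        using agree[OF Ji J2i(1) L L2 st(2) t1J2, of t] that ct by (auto simp: \<gamma>3_def td)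
      have L3: "lift_on (J \<union> J2) \<gamma>3 a b"
        unfolding lift_on_def
      proof (intro conjI)
        have "continuous_on J \<gamma>3" by (rule continuous_on_eq[of _ \<gamma>]) (use L in \<open>auto simp: lift_on_def \<gamma>3_def\<close>)
        moreover have "continuous_on J2 \<gamma>3"
          by (rule continuous_on_eq[of _ "\<lambda>t. \<phi> c (\<gamma>' (t - d))"]) (use L2 g3 in \<open>auto simp: lift_on_def\<close>)
        ultimately show "continuous_on (J \<union> J2) \<gamma>3" using J(1) J2i(2) by (intro continuous_on_open_Un)
        show "\<gamma>3 ` (J \<union> J2) \<subseteq> M" using L L2 by (auto simp: lift_on_def \<gamma>3_def)
        show "\<forall>t\<in>J \<union> J2. x (\<gamma>3 t) = fr (rad a b t) 0 (a t) (b t)" using L L2 by (auto simp: lift_on_def \<gamma>3_def)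
      qed
      have "connected (J \<union> J2)"
        by (rule connected_Un) (use Ji J2i st(2) t1J2 in \<open>auto simp: is_interval_connected_1\<close>)
      then have "J \<union> J2 \<in> \<J>"
        using L3 J J2i \<gamma>0 by (auto simp: \<J>_def is_interval_connected_1 \<gamma>3_def intro!: exI[of _ \<gamma>3])
      \<comment> \<open>Maximality. The parameter \<open>d\<close> of the rotated point \<gamma>' 0
        lies in \<open>J2\<close>, hence in \<open>J\<close>, and this point is a rotated copy of
        \<open>m\<close>.\<close>
      then have "J2 \<subseteq> J" by (auto simp: J_def)
      moreover have dJ2: "d \<in> J2" using \<delta> by (simp add: J2)
      ultimately have dJ: "d \<in> J" by blast
      then have "\<gamma> d = \<phi> c (\<gamma>' 0)" using g3[OF dJ2] by (simp add: \<gamma>3_def)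
      then have "\<gamma> d = \<phi> (c + \<theta>) m" by (simp add: \<gamma>'0 \<phi>_add[OF mM])
      then have "sweep \<gamma> (- (c + \<theta>), d) = \<phi> (- (c + \<theta>) + (c + \<theta>)) m" by (simp only: sweep_def fst_conv snd_conv \<phi>_add[OF mM])
      then have "sweep \<gamma> (- (c + \<theta>), d) = m" by (simp add: \<phi>_0[OF mM])
      then have "m \<in> sweep \<gamma> ` (UNIV \<times> J)" using dJ by (intro image_eqI[of _ _ "(- (c + \<theta>), d)"]) auto
      then show False using m by simp
    qed
    moreover have "openin (top_of_set M) (sweep \<gamma>' ` (UNIV \<times> ?I))"
      by (rule openin_sweep_image[OF open_greaterThanLessThan P' L'])
    moreover have "sweep \<gamma>' ` (UNIV \<times> ?I) \<subseteq> free_part" using sweep_in_free_part[OF P' L'] by blast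
    ultimately show "\<exists>T. openin (top_of_set M) T \<and> m \<in> T \<and> T \<subseteq> free_part - sweep \<gamma> ` (UNIV \<times> J)"
      using mW by (intro exI[of _ "sweep \<gamma>' ` (UNIV \<times> ?I)"]) auto
  qed
  then show ?thesis using that J Ji L by blast
qed

subsection \<open>Points on the axis\<close>

definition rot :: "real \<Rightarrow> mink_space \<Rightarrow> mink_space" where
  "rot s v = fr (gcos (-k) s * (k * mink v u1) - k * gsin (-k) s * mink v u2)
     (gsin (-k) s * (k * mink v u1) + gcos (-k) s * mink v u2) (- k * mink v w1) (mink v w2)"

lemma rot_fr: "rot s (fr p q a b) =
    fr (gcos (-k) s * p - k * gsin (-k) s * q) (gsin (-k) s * p + gcos (-k) s * q) a b"
  by (simp add: rot_def fr_coords)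

lemma x_rot: "m \<in> M \<Longrightarrow> x (\<phi> s m) = rot s (x m)"
  using x_\<phi>[of m] fr_surj[of "x m"] rot_fr by metis

lemma bounded_linear_rot: "bounded_linear (rot s)"
proof -
  have "linear (rot s)"
    by (rule linearI) (simp_all add: rot_def mink_simps fr_ops fr_eq_iff algebra_simps)
  then show ?thesis by (simp add: linear_conv_bounded_linear)
qed

text \<open>The ambient rotation fixes x m, but the action could a priori move \<open>m\<close>
  among points with the same image. The orbit and the constant curve are two lifts of the same
  constant map and agree at 0.\<close>

lemma axis_point_fixed:
  assumes "m \<in> M" "x m \<in> span {w1, w2}"
  shows "\<phi> s m = m"
proof (rule lift_unique[OF M, of UNIV "\<lambda>s. \<phi> s m" "\<lambda>s. m" 0 s])
  obtain a b where ab: "x m = fr 0 0 a b" using assms(2) fr_surj[of "x m"] fr_mem_span_w by metis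
  show "x (\<phi> t m) = x m" for t by (simp add: x_rot[OF assms(1)] ab rot_fr)
  show "continuous_on UNIV (\<lambda>s. \<phi> s m)"
    by (rule continuous_on_\<phi>) (use assms in \<open>auto intro: continuous_intros\<close>)
qed (use assms \<phi>_M \<phi>_0 in auto)

text \<open>The tangent plane at a point on the axis of an elliptic rotation is invariant under the
  rotations, hence it is the plane of the rotation.\<close>

lemma tangent_plane_at_axis_point:
  assumes k1: "k = 1" and q: "homeomorphism U (q ` U) q g" "open U" "immersion_on U (x \<circ> q)"
    "openin (top_of_set M) (q ` U)" and z0: "z0 \<in> U" "x (q z0) \<in> span {w1, w2}"
    and v: "frechet_derivative (x \<circ> q) (at z0) v = fr 0 0 a1 b1"
  shows "v = 0"
proof (rule ccontr)
  assume "v \<noteq> 0"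
  define f where "f = x \<circ> q"
  let ?D = "frechet_derivative f (at z0)"
  have ck: "Ck_on 2 U f" and inj: "inj ?D" using q(3) z0(1) by (auto simp: immersion_on_def f_def)
  note C = Ck_on_2D[OF q(2) ck]
  have D: "(f has_derivative ?D) (at z0)" by (rule C(1)[OF z0(1)])
  have lin: "linear ?D" using D by (rule has_derivative_linear)
  have qM: "q z \<in> M" if "z \<in> U" for z using that q(4) openin_subset by force
  have qc: "continuous_on U q" and gc: "continuous_on (q ` U) g" and gq: "\<And>z. z \<in> U \<Longrightarrow> g (q z) = z"
    and qg: "\<And>y. y \<in> q ` U \<Longrightarrow> q (g y) = y"
    using q(1) by (auto simp: homeomorphism_def)
  obtain L where L: "linear L" "L \<circ> ?D = id" using linear_injective_left_inverse[OF lin inj] by blast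
  have L': "bounded_linear L" "L (?D y) = y" for y
    using L(1) fun_cong[OF L(2), of y] by (simp_all add: linear_conv_bounded_linear)
  have along: "((\<lambda>h. F (z0 + h *\<^sub>R y)) has_vector_derivative F' y) (at 0)"
    if "(F has_derivative F') (at z0)" for F :: "real \<times> real \<Rightarrow> mink_space" and F' y
  proof -
    have "((\<lambda>h. z0 + h *\<^sub>R y) has_vector_derivative y) (at 0)" by (auto intro!: derivative_eq_intros)
    moreover have "(F has_derivative F') (at (z0 + 0 *\<^sub>R y) within (\<lambda>h. z0 + h *\<^sub>R y) ` UNIV)"
      using that by (simp add: has_derivative_at_withinI)
    ultimately show ?thesis using vector_derivative_diff_chain_within[of "\<lambda>h. z0 + h *\<^sub>R y" y 0 UNIV F F'] by (simp add: o_def)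
  qed
  \<comment> \<open>A line in the chart is carried by the action to a curve through the same point
    of \<open>M\<close>. In the chart this curve is differentiable by
    \<open>lift_has_vector_derivative\<close>, so the rotated tangent vector is tangent
    again.\<close>
  have inv: "rot s (?D y) \<in> range ?D" for s y
  proof -
    let ?c = "\<lambda>h. z0 + h *\<^sub>R y"
    define V where "V = ?c -` U"
    have V: "open V" "0 \<in> V" unfolding V_def using z0(1) by (auto intro!: open_vimage q(2) continuous_intros)
    have cV: "continuous_on V (\<lambda>h. \<phi> s (q (?c h)))"
      by (intro continuous_on_\<phi> continuous_intros continuous_on_compose2[OF qc]) (use qM in \<open>auto simp: V_def\<close>)
    have cm: "(\<lambda>h. \<phi> s (q (?c h))) \<in> V \<rightarrow> M" using qM \<phi>_M by (auto simp: V_def)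
    define W where "W = V \<inter> (\<lambda>h. \<phi> s (q (?c h))) -` (q ` U)"
    have "openin (top_of_set V) W" unfolding W_def by (rule continuous_openin_preimage[OF cV cm q(4)])
    then have W: "open W" using V(1) openin_open_trans by blast
    have fixq: "\<phi> s (q z0) = q z0" by (rule axis_point_fixed[OF qM[OF z0(1)] z0(2)])
    have W0: "0 \<in> W" using V(2) z0(1) by (simp add: W_def fixq)
    define \<zeta> where "\<zeta> h = g (\<phi> s (q (?c h)))" for h
    have \<zeta>0: "\<zeta> 0 = z0" using gq[OF z0(1)] by (simp add: \<zeta>_def fixq)
    have "continuous_on W \<zeta>" unfolding \<zeta>_def
      by (rule continuous_on_compose2[OF gc continuous_on_subset[OF cV]]) (auto simp: W_def)
    then have c0: "isCont \<zeta> 0" using W W0 by (simp add: continuous_on_eq_continuous_at)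
    have f\<zeta>: "f (\<zeta> h) = rot s (f (?c h))" if "h \<in> W" for h
    proof -
      have "\<phi> s (q (?c h)) \<in> q ` U" "?c h \<in> U" using that by (auto simp: W_def V_def)
      then show ?thesis using qg[of "\<phi> s (q (?c h))"] x_rot[OF qM, of "?c h"] by (simp add: \<zeta>_def f_def)
    qed
    have "((\<lambda>h. rot s (f (?c h))) has_vector_derivative rot s (?D y)) (at 0)"
      by (rule bounded_linear.has_vector_derivative[OF bounded_linear_rot along[OF D]])
    then have fd: "((\<lambda>h. f (\<zeta> h)) has_vector_derivative rot s (?D y)) (at 0)"
      by (rule has_vector_derivative_transform_within_open[OF _ W W0]) (simp add: f\<zeta>)
    have D\<zeta>: "(f has_derivative ?D) (at (\<zeta> 0))" using D by (simp add: \<zeta>0)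
    have "(\<zeta> has_vector_derivative L (rot s (?D y))) (at 0)"
      by (rule lift_has_vector_derivative[OF D\<zeta> L' c0 fd])
    then have "((\<lambda>h. f (\<zeta> h)) has_vector_derivative ?D (L (rot s (?D y)))) (at 0)"
      using vector_derivative_diff_chain_within[of \<zeta> _ 0 UNIV f ?D] D\<zeta> by (simp add: o_def has_derivative_at_withinI)
    then have "?D (L (rot s (?D y))) = rot s (?D y)" using fd vector_derivative_unique_at by blast
    then show ?thesis by (metis rangeI)
  qed
  have T: "subspace (range ?D)" "dim (range ?D) = 2"
  proof -
    show "subspace (range ?D)" using linear_subspace_image[OF lin subspace_UNIV] .
    have "dim (range ?D) = dim (UNIV :: (real \<times> real) set)"
      by (rule dim_image_eq[OF lin]) (use inj in simp)
    then show "dim (range ?D) = 2" by simp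
  qed
  have Dv: "?D v = fr 0 0 a1 b1" using v by (simp add: f_def)
  have Dv0: "?D v \<noteq> 0" using \<open>v \<noteq> 0\<close> inj linear_0[OF lin] by (metis injD)
  have f0: "mink (f z0) (?D y) = 0" for y
  proof -
    have "((\<lambda>h. mink (f (z0 + h *\<^sub>R y)) (f (z0 + h *\<^sub>R y))) has_vector_derivative
        mink (f (z0 + 0 *\<^sub>R y)) (?D y) + mink (?D y) (f (z0 + 0 *\<^sub>R y))) (at 0)"
      by (rule mink.has_vector_derivative[OF along[OF D] along[OF D]])
    moreover have "((\<lambda>h. mink (f (z0 + h *\<^sub>R y)) (f (z0 + h *\<^sub>R y))) has_vector_derivative 0) (at 0)"
    proof (rule has_vector_derivative_transform_within_open[of "\<lambda>_. -1" _ _ "(\<lambda>h. z0 + h *\<^sub>R y) -` U"])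
      show "open ((\<lambda>h. z0 + h *\<^sub>R y) -` U)" by (intro open_vimage q(2) continuous_intros)
    qed (use z0(1) x_hyp3 qM in \<open>auto simp: f_def hyp3_def\<close>)
    ultimately have "mink (f z0) (?D y) + mink (?D y) (f z0) = 0" using vector_derivative_unique_at by fastforce
    then show ?thesis by (simp add: mink_commute)
  qed
  show False
  \<comment> \<open>If the tangent plane were the plane of \<open>w1\<close> and \<open>w2\<close>,
    it would contain the position, which is orthogonal to it and timelike.\<close>
  proof (cases "\<forall>y. ?D y \<in> span {w1, w2}")
    case True
    have "dim (span {w1, w2}) \<le> 2"
      using dim_le_card'[of "{w1, w2}"] by (simp add: card_insert_if split: if_splits)
    then have "range ?D = span {w1, w2}"
      using True T by (intro subspace_dim_equal) auto
    then have "f z0 \<in> range ?D" using z0(2) by (simp add: f_def)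
    then obtain y where "f z0 = ?D y" by (rule rangeE)
    then have "mink (f z0) (f z0) = 0" using f0[of y] by simp
    then show False using x_hyp3[OF qM[OF z0(1)]] by (simp add: f_def hyp3_def)
  next
    case False
    then obtain y where y: "?D y \<notin> span {w1, w2}" by blast
    obtain p q a b where Dy: "?D y = fr p q a b" by (rule fr_surj)
    have pq: "p * p + q * q > 0" using y unfolding Dy fr_mem_span_w by (simp add: sum_squares_gt_zero_iff)
    \<comment> \<open>Subtracting the half turn isolates the component in the plane of the rotation;
      a quarter turn of that component gives a second, orthogonal tangent vector. These two span the
      tangent plane.\<close>
    have "rot pi (?D y) \<in> range ?D" by (rule inv)
    moreover have "rot pi (?D y) = fr (-p) (-q) a b"
      unfolding Dy rot_fr using k1 by (simp add: gcos_def gsin_def)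
    ultimately have "fr (-p) (-q) a b \<in> range ?D" by simp
    then have "fr p q a b - fr (-p) (-q) a b \<in> range ?D" using T(1) Dy by (intro subspace_diff) (auto intro: rangeI simp flip: Dy)
    then have "(1/2) *\<^sub>R (fr p q a b - fr (-p) (-q) a b) \<in> range ?D" using T(1) by (intro subspace_scale)
    then have y1: "fr p q 0 0 \<in> range ?D" by (simp add: fr_ops)
    then obtain y' where "fr p q 0 0 = ?D y'" by blast
    then have "rot (pi / 2) (fr p q 0 0) \<in> range ?D" using inv by simp
    moreover have "rot (pi / 2) (fr p q 0 0) = fr (-q) p 0 0"
      unfolding rot_fr using k1 by (simp add: gcos_def gsin_def)
    ultimately have y2: "fr (-q) p 0 0 \<in> range ?D" by simp
    have "span {fr p q 0 0, fr (-q) p 0 0} = range ?D"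
    proof (rule orthogonal_pair_spans_plane(3)[OF T y1 y2])
      show "mink (fr p q 0 0) (fr p q 0 0) \<noteq> 0"
        unfolding mink_fr using pq k1 sum_squares_gt_zero_iff[of p q] by auto
      show "fr (-q) p 0 0 \<noteq> 0" using pq fr_eq_iff[of "-q" p 0 0 0 0 0 0] by (auto simp: fr_ops(4))
      show "mink (fr p q 0 0) (fr (-q) p 0 0) = 0" by (simp add: mink_fr k1)
    qed
    moreover have "span {fr p q 0 0, fr (-q) p 0 0} \<subseteq> span {u1, u2}"
      by (rule span_minimal) (auto simp: fr_mem_span_u subspace_span)
    ultimately have "?D v \<in> span {u1, u2}" by blast
    then have "?D v = 0" by (simp add: Dv fr_mem_span_u fr_ops(4))
    then show False using Dv0 by simp
  qed
qed

text \<open>By the preceding lemma the projection onto the plane of the rotation has injective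
  derivative at an axis point, so its norm is bounded below by a multiple of the distance and it has
  no other zero nearby. The neighbourhood is the image of a disc, whose punctured version is
  connected.\<close>

lemma axis_point_isolated:
  assumes k1: "k = 1" and m: "m \<in> M" "x m \<in> span {w1, w2}"
  obtains N where "openin (top_of_set M) N" "m \<in> N" "N - {m} \<subseteq> free_part" "connected (N - {m})" "N - {m} \<noteq> {}"
proof -
  obtain U q g where c: "local_param M x U q" "m \<in> q ` U" "homeomorphism U (q ` U) q g" "open U"
    "immersion_on U (x \<circ> q)" "openin (top_of_set M) (q ` U)"
    by (rule immersed_surface_chart[OF M m(1)])
  obtain z0 where z0: "z0 \<in> U" "m = q z0" using c(2) by blast
  let ?f = "x \<circ> q"
  let ?D = "frechet_derivative ?f (at z0)"
  have ck: "Ck_on 2 U ?f" using c(5) by (simp add: immersion_on_def)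
  have D: "(?f has_derivative ?D) (at z0)" by (rule Ck_on_2D(1)[OF c(4) ck z0(1)])
  define pr where "pr y = (mink y u1, mink y u2)" for y
  have bpr: "bounded_linear pr" unfolding pr_def[abs_def]
    by (intro bounded_linear_Pair mink.bounded_linear_left)
  have F: "((\<lambda>z. pr (?f z)) has_derivative (\<lambda>v. pr (?D v))) (at z0)"
    by (rule bounded_linear.has_derivative[OF bpr D])
  have lin: "linear (\<lambda>v. pr (?D v))" using F by (rule has_derivative_linear)
  have inj: "inj (\<lambda>v. pr (?D v))"
    unfolding linear_injective_0[OF lin]
  proof (intro allI impI)
    fix v assume "pr (?D v) = 0"
    then have "?D v = fr 0 0 (- k * mink (?D v) w1) (mink (?D v) w2)"
      using fr_expand[of "?D v"] by (simp add: pr_def zero_prod_def)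
    then show "v = 0" using tangent_plane_at_axis_point[OF k1 c(3,4,5,6) z0(1)] m(2) z0(2) by blast
  qed
  obtain B where B: "B > 0" "\<And>v. norm v * B \<le> norm (pr (?D v))"
    using linear_inj_bounded_below_pos[OF lin inj] by (auto simp: mult.commute)
  obtain p r a b where "x (q z0) = fr p r a b" by (rule fr_surj)
  then have pr0: "pr (x (q z0)) = 0" using m(2) z0(2) by (simp add: pr_def zero_prod_def fr_mem_span_w fr_coords)
  obtain d where d: "d > 0" "\<And>z. norm (z - z0) < d \<Longrightarrow> norm (pr (?f z) - pr (?f z0) - pr (?D (z - z0))) \<le> B / 2 * norm (z - z0)"
    using F B(1) unfolding has_derivative_at_alt by (metis half_gt_zero)
  obtain \<rho> where \<rho>: "\<rho> > 0" "ball z0 \<rho> \<subseteq> U" using c(4) z0(1) open_contains_ball by blast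
  define S where "S = ball z0 (min d \<rho>)"
  have S: "open S" "z0 \<in> S" "S \<subseteq> U" using d(1) \<rho> by (auto simp: S_def)
  have nz: "pr (?f z) \<noteq> 0" if "z \<in> S - {z0}" for z
  proof
    assume "pr (?f z) = 0"
    then have "norm (pr (?D (z - z0))) \<le> B / 2 * norm (z - z0)"
      using d(2)[of z] that by (simp add: pr0 S_def dist_norm norm_minus_commute)
    moreover have "B * norm (z - z0) \<le> norm (pr (?D (z - z0)))" using B(2)[of "z - z0"] by (simp add: mult.commute)
    ultimately have "B * norm (z - z0) \<le> 0" by simp
    then show False using B(1) that by (simp add: mult_le_0_iff)
  qed
  have qi: "inj_on q U" using c(3) by (metis homeomorphism_def inj_on_inverseI)
  have qM: "q z \<in> M" if "z \<in> U" for z using that c(6) openin_subset by force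
  have eq: "q ` S - {m} = q ` (S - {z0})" using qi S z0 by (auto simp: inj_on_def)
  show ?thesis
  proof
    have "openin (top_of_set U) S" using S by (simp add: open_subset)
    then show "openin (top_of_set M) (q ` S)" using homeomorphism_imp_open_map[OF c(3)] c(6) openin_trans by blast
    show "m \<in> q ` S" using S z0 by blast
    show "q ` S - {m} \<subseteq> free_part"
      unfolding eq
    proof
      fix y assume "y \<in> q ` (S - {z0})"
      then obtain z where z: "y = q z" "z \<in> S - {z0}" by blast
      obtain p r a b where "x (q z) = fr p r a b" by (rule fr_surj)
      then show "y \<in> free_part" using nz[OF z(2)] qM[of z] S z by (auto simp: free_part_def pr_def fr_coords fr_mem_span_w zero_prod_def)
    qed
    have "connected (S - {z0})" unfolding S_def by (rule connected_open_delete) auto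
    moreover have "continuous_on (S - {z0}) q" using c(3) S by (auto simp: homeomorphism_def intro: continuous_on_subset)
    ultimately show "connected (q ` S - {m})" unfolding eq by (rule connected_continuous_image[rotated])
    have "S - {z0} \<noteq> {}"
    proof
      assume "S - {z0} = {}"
      then have "S = {z0}" using S(2) by blast
      then show False using S(1) by (simp add: not_open_singleton)
    qed
    then show "q ` S - {m} \<noteq> {}" unfolding eq by blast
  qed
qed

lemma axis_only_elliptic:
  assumes "m \<in> M" "x m \<in> span {w1, w2}"
  shows "k = 1"
proof (rule ccontr)
  assume "k \<noteq> 1"
  obtain p q a b where f: "x m = fr p q a b" by (rule fr_surj)
  then have "p > 0" using fr_hyp3(3)[of p q a b] x_hyp3[OF assms(1)] k \<open>k \<noteq> 1\<close> by simp
  then show False using assms(2) f by (simp add: fr_mem_span_w)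
qed

lemma free_part_nonempty: "free_part \<noteq> {}"
proof -
  obtain m where m: "m \<in> M" using M by (auto simp: immersed_surface_def)
  show ?thesis
  proof (cases "x m \<in> span {w1, w2}")
    case True
    obtain N where "N - {m} \<subseteq> free_part" "N - {m} \<noteq> {}"
      by (rule axis_point_isolated[OF axis_only_elliptic[OF m True] m True])
    then show ?thesis by blast
  qed (use m in \<open>auto simp: free_part_def\<close>)
qed

text \<open>A splitting of the free part extends to \<open>M\<close>: the punctured neighbourhood of
  an axis point is connected, lies on one side, and the point is assigned to that side. Both
  extended sides are open, contradicting connectedness of \<open>M\<close>.\<close>

lemma clopen_free_part:
  assumes N: "N \<subseteq> free_part" "openin (top_of_set M) N" "openin (top_of_set M) (free_part - N)" "N \<noteq> {}"
  shows "N = free_part"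
proof (rule ccontr)
  assume "N \<noteq> free_part"
  define N2 where "N2 = free_part - N"
  have N2: "openin (top_of_set M) N2" "N2 \<noteq> {}" "N \<inter> N2 = {}" "N \<union> N2 = free_part"
    using N \<open>N \<noteq> free_part\<close> by (auto simp: N2_def)
  define Z where "Z = M - free_part"
  have "\<exists>P. openin (top_of_set M) P \<and> m \<in> P \<and> P - {m} \<subseteq> free_part \<and> connected (P - {m}) \<and> P - {m} \<noteq> {}" if "m \<in> Z" for m
  proof -
    have m: "m \<in> M" "x m \<in> span {w1, w2}" using that by (auto simp: Z_def free_part_def)
    obtain P where "openin (top_of_set M) P" "m \<in> P" "P - {m} \<subseteq> free_part" "connected (P - {m})" "P - {m} \<noteq> {}"
      by (rule axis_point_isolated[OF axis_only_elliptic[OF m] m])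
    then show ?thesis by blast
  qed
  then have "\<exists>P. \<forall>m\<in>Z. openin (top_of_set M) (P m) \<and> m \<in> P m \<and> P m - {m} \<subseteq> free_part \<and> connected (P m - {m}) \<and> P m - {m} \<noteq> {}"
    by (intro bchoice) blast
  then obtain P where P: "\<And>m. m \<in> Z \<Longrightarrow> openin (top_of_set M) (P m) \<and> m \<in> P m \<and> P m - {m} \<subseteq> free_part \<and> connected (P m - {m}) \<and> P m - {m} \<noteq> {}"
    by blast
  have side: "P m - {m} \<subseteq> N \<or> P m - {m} \<subseteq> N2" if m: "m \<in> Z" for m
  proof (rule ccontr)
    assume c: "\<not> ?thesis"
    let ?S = "P m - {m}"
    have SM: "?S \<subseteq> M" using P[OF m] by (auto simp: free_part_def)
    obtain T T2 where T: "open T" "N = M \<inter> T" "open T2" "N2 = M \<inter> T2"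
      using N(2) N2(1) by (auto simp: openin_open)
    have "T \<inter> ?S = {} \<or> T2 \<inter> ?S = {}"
    proof (rule connectedD)
      show "connected ?S" using P[OF m] by blast
      show "T \<inter> T2 \<inter> ?S = {}" using N2(3) T SM by blast
      show "?S \<subseteq> T \<union> T2" using P[OF m] N2(4) T by blast
    qed (use T in auto)
    then show False using c P[OF m] N2(4) T SM by blast
  qed
  define A where "A = N \<union> {m \<in> Z. P m - {m} \<subseteq> N}"
  define B where "B = N2 \<union> {m \<in> Z. P m - {m} \<subseteq> N2}"
  have openAB: "openin (top_of_set M) (Y \<union> {m \<in> Z. P m - {m} \<subseteq> Y})" if Y: "openin (top_of_set M) Y" for Y
  proof (subst openin_subopen, intro ballI)
    fix m assume "m \<in> Y \<union> {m \<in> Z. P m - {m} \<subseteq> Y}"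
    then consider "m \<in> Y" | "m \<in> Z" "P m - {m} \<subseteq> Y" by blast
    then show "\<exists>T. openin (top_of_set M) T \<and> m \<in> T \<and> T \<subseteq> Y \<union> {m \<in> Z. P m - {m} \<subseteq> Y}"
    proof cases
      case 1
      then show ?thesis using Y by blast
    next
      case 2
      then show ?thesis using P[OF 2(1)] by (intro exI[of _ "P m"]) blast
    qed
  qed
  have "openin (top_of_set M) A" "openin (top_of_set M) B"
    unfolding A_def B_def using openAB N(2) N2(1) by blast+
  moreover have "A \<inter> B = {}"
  proof -
    have "Z \<inter> free_part = {}" by (auto simp: Z_def)
    then have "A \<inter> B \<subseteq> {m \<in> Z. P m - {m} \<subseteq> N \<and> P m - {m} \<subseteq> N2}"
      using N(1) N2(3,4) by (auto simp: A_def B_def)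
    moreover have False if "m \<in> Z" "P m - {m} \<subseteq> N" "P m - {m} \<subseteq> N2" for m
      using P[OF that(1)] that(2,3) N2(3) by blast
    ultimately show ?thesis by blast
  qed
  moreover have "M \<subseteq> A \<union> B" using side N2(4) by (auto simp: A_def B_def Z_def)
  moreover have "A \<noteq> {}" "B \<noteq> {}" using N(4) N2(2) by (auto simp: A_def B_def)
  moreover have "connected M" using M by (simp add: immersed_surface_def)
  ultimately show False unfolding connected_openin by blast
qed

text \<open>Equal data at one point make the local lift a lift of the globally defined profile. This
  starts the maximal continuation, whose sweep is open and has open complement in the free
  part.\<close>

lemma global_sweep:
  assumes P: "cmc_profile UNIV a a1 b b1"
    and \<delta>: "\<delta> > 0" and P': "cmc_profile {-\<delta><..<\<delta>} a' a1' b' b1'" and L': "lift_on {-\<delta><..<\<delta>} \<gamma>' a' b'"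
    and eq: "a t0 = a' 0" "a1 t0 = a1' 0" "b t0 = b' 0" "b1 t0 = b1' 0"
  obtains J \<gamma> where "open J" "is_interval J" "t0 \<in> J" "lift_on J \<gamma> a b" "sweep \<gamma> ` (UNIV \<times> J) = free_part"
proof -
  define J0 where "J0 = {t. t - t0 \<in> {-\<delta><..<\<delta>}}"
  have J0: "J0 = {t0 - \<delta><..<t0 + \<delta>}" by (auto simp: J0_def)
  have i: "open J0" "is_interval J0" "t0 \<in> J0" using \<delta> by (auto simp: J0 is_interval_oo)
  have PJ: "cmc_profile J a a1 b b1" for J using P by (auto simp: cmc_profile_def)
  have P2: "cmc_profile J0 (\<lambda>t. a' (t - t0)) (\<lambda>t. a1' (t - t0)) (\<lambda>t. b' (t - t0)) (\<lambda>t. b1' (t - t0))"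
    unfolding J0_def by (rule cmc_profile_shift[OF P'])
  have "a' (t - t0) = a t" "b' (t - t0) = b t" if "t \<in> J0" for t
    using cmc_profile_unique[OF P2 PJ i(2,3) _ _ _ _ that] eq by auto
  then have L0: "lift_on J0 (\<lambda>t. \<gamma>' (t - t0)) a b"
    by (intro lift_on_cong[OF lift_on_shift[OF L', of t0, folded J0_def]]) auto
  obtain J \<gamma> where J: "open J" "is_interval J" "t0 \<in> J" "lift_on J \<gamma> a b"
    "openin (top_of_set M) (free_part - sweep \<gamma> ` (UNIV \<times> J))"
    by (rule maximal_lift[OF P i L0])
  have "sweep \<gamma> ` (UNIV \<times> J) = free_part"
  proof (rule clopen_free_part)
    show "sweep \<gamma> ` (UNIV \<times> J) \<subseteq> free_part" using sweep_in_free_part[OF PJ J(4)] by blast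
    show "openin (top_of_set M) (sweep \<gamma> ` (UNIV \<times> J))" by (rule openin_sweep_image[OF J(1) PJ J(4)])
    show "sweep \<gamma> ` (UNIV \<times> J) \<noteq> {}" using J(3) by blast
  qed (rule J(5))
  then show ?thesis using that J by blast
qed

end

section \<open>The explicit profile curves\<close>

text \<open>The leading coefficient is positive, so a nonpositive value at \<open>u0\<close> makes
  the discriminant nonnegative and places \<open>u0\<close> between the roots. Their product is
  nonnegative and \<open>C1\<close> is positive, hence \<open>C2\<close> >= 0. The factorization
  counts a double root twice.\<close>

lemma cmc_poly_roots:
  fixes k H C u0 :: real
  assumes H: "H > 1" and u0: "u0 > 0" and le: "(H\<^sup>2 - 1) * u0\<^sup>2 - (k + 2 * H * C) * u0 + C\<^sup>2 \<le> 0"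
  obtains C1 C2 where "proots (cmc_poly k H C) = {#C1, C2#}" "C2 \<le> u0" "u0 \<le> C1" "0 \<le> C2" "C1 > 0"
    "(H\<^sup>2 - 1) * (C1 + C2) = k + 2 * H * C" "(H\<^sup>2 - 1) * (C1 * C2) = C\<^sup>2"
proof -
  define \<alpha> where "\<alpha> = H\<^sup>2 - 1"
  define \<beta> where "\<beta> = k + 2 * H * C"
  have \<alpha>: "\<alpha> > 0" using H by (simp add: \<alpha>_def one_less_power)
  have sq: "4 * \<alpha> * (\<alpha> * u0\<^sup>2 - \<beta> * u0 + C\<^sup>2) = (2 * \<alpha> * u0 - \<beta>)\<^sup>2 - (\<beta>\<^sup>2 - 4 * \<alpha> * C\<^sup>2)"
    by (simp add: power2_eq_square algebra_simps)
  have "4 * \<alpha> * (\<alpha> * u0\<^sup>2 - \<beta> * u0 + C\<^sup>2) \<le> 0"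
    using le \<alpha> unfolding \<alpha>_def[symmetric] \<beta>_def[symmetric] by (simp add: mult_nonneg_nonpos)
  then have disc: "(2 * \<alpha> * u0 - \<beta>)\<^sup>2 \<le> \<beta>\<^sup>2 - 4 * \<alpha> * C\<^sup>2" unfolding sq by simp
  define d where "d = sqrt (\<beta>\<^sup>2 - 4 * \<alpha> * C\<^sup>2)"
  have d0: "\<beta>\<^sup>2 - 4 * \<alpha> * C\<^sup>2 \<ge> 0" using disc zero_le_power2[of "2 * \<alpha> * u0 - \<beta>"] by linarith
  have d: "d \<ge> 0" "d\<^sup>2 = \<beta>\<^sup>2 - 4 * \<alpha> * C\<^sup>2" using d0 by (auto simp: d_def)
  have "\<bar>2 * \<alpha> * u0 - \<beta>\<bar> \<le> d" using disc d by (intro abs_le_square_iff[THEN iffD2, of _ d, simplified abs_of_nonneg[OF d(1)]]) simp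
  define C1 where "C1 = (\<beta> + d) / (2 * \<alpha>)"
  define C2 where "C2 = (\<beta> - d) / (2 * \<alpha>)"
  have le1: "u0 \<le> C1" and le2: "C2 \<le> u0"
    using \<open>\<bar>2 * \<alpha> * u0 - \<beta>\<bar> \<le> d\<close> \<alpha> by (auto simp: C1_def C2_def field_simps abs_le_iff)
  have sum: "\<alpha> * (C1 + C2) = \<beta>" using \<alpha> by (simp add: C1_def C2_def field_simps)
  have "4 * \<alpha> * (\<alpha> * (C1 * C2)) = (\<beta> + d) * (\<beta> - d)" using \<alpha> by (simp add: C1_def C2_def field_simps)
  also have "\<dots> = 4 * \<alpha> * C\<^sup>2" using d(2) by (simp add: power2_eq_square algebra_simps)
  finally have prod: "\<alpha> * (C1 * C2) = C\<^sup>2" using \<alpha> by simp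
  have C1: "C1 > 0" using le1 u0 by simp
  have "C1 * C2 \<ge> 0" using prod \<alpha> by (metis zero_le_mult_iff zero_le_power2 not_less)
  then have C2: "C2 \<ge> 0" using C1 by (simp add: zero_le_mult_iff)
  have "cmc_poly k H C = smult \<alpha> ([:- C1, 1:] * [:- C2, 1:])"
    using sum prod by (simp add: cmc_poly_def \<alpha>_def \<beta>_def algebra_simps)
  then have "proots (cmc_poly k H C) = {#C1, C2#}"
    using \<alpha> by (simp add: proots_mult proots_smult del: mult_pCons_left mult_pCons_right)
  then show ?thesis using that le1 le2 C1 C2 sum prod by (simp add: \<alpha>_def \<beta>_def)
qed

section \<open>The squared radius as a Jacobi elliptic function\<close>

locale cmc_elliptic =
  fixes \<alpha> C1 C2 p \<Xi> :: real
  assumes \<alpha>: "\<alpha> > 0" and C: "C1 > 0" "0 \<le> C2" "C2 \<le> C1" and p: "p \<ge> 0" "p\<^sup>2 = (C1 - C2) / C1"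
    and \<Xi>: "\<Xi> = sqrt (\<alpha> * C1)"
begin

definition y where "y t = jacobi_sn p (\<Xi> * t)"
definition z where "z t = jacobi_cn p (\<Xi> * t)"
definition d where "d t = jacobi_dn p (\<Xi> * t)"
definition u where "u t = C1 * (d t * d t)"
definition u' where "u' t = - 2 * (C1 - C2) * \<Xi> * (y t * z t * d t)"
text \<open>Half the derivative of - 4 \<alpha> u (u - C1) (u - C2) with respect to
  \<open>u\<close>, as the squared first-order equation suggests. Defining it as a polynomial in
  \<open>u\<close> includes points where u' vanishes.\<close>

definition u'' where "u'' t = - 2 * \<alpha> * ((u t - C1) * (u t - C2) + u t * (2 * u t - C1 - C2))"

lemma p1: "p \<le> 1"
proof -
  have "p\<^sup>2 \<le> 1\<^sup>2" using C p(2) by simp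
  then show ?thesis by (rule power2_le_imp_le) simp
qed

lemma \<Xi>_squared: "\<Xi> * \<Xi> = \<alpha> * C1" and \<Xi>_pos: "\<Xi> > 0"
  using \<alpha> C by (simp_all add: \<Xi>)

lemma pC: "p * p * C1 = C1 - C2"
  using p(2) C by (simp add: power2_eq_square)

lemma sq: "y t * y t + z t * z t = 1" "d t * d t = 1 - p * p * (y t * y t)" "d t > 0"
  using jacobi_sn_cn_squared[of p "\<Xi> * t"] jacobi_dn_squared[OF p(1) p1, of "\<Xi> * t"]
  by (simp_all add: y_def z_def d_def power2_eq_square)

lemma uy: "(C1 - C2) * (y t * y t) = C1 - u t"
proof -
  have "u t = C1 - (p * p * C1) * (y t * y t)" unfolding u_def sq(2) by (simp add: algebra_simps)
  then show ?thesis unfolding pC by simp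
qed

lemma uz: "(C1 - C2) * (z t * z t) = u t - C2"
proof -
  have "(C1 - C2) * (y t * y t) + (C1 - C2) * (z t * z t) = C1 - C2"
    using sq(1)[of t] by (simp flip: distrib_left)
  then show ?thesis using uy[of t] by simp
qed

lemma u_pos: "u t > 0"
  using sq(3)[of t] C by (simp add: u_def)

lemma u_ge: "C2 \<le> u t"
proof -
  have "(C1 - C2) * (z t * z t) \<ge> 0" using C by (intro mult_nonneg_nonneg[OF _ zero_le_square]) simp
  then show ?thesis using uz[of t] by linarith
qed

lemma derivs:
  "(y has_real_derivative \<Xi> * (z t * d t)) (at t)" "(z has_real_derivative - \<Xi> * (y t * d t)) (at t)"
  "(d has_real_derivative - \<Xi> * (p * p * (y t * z t))) (at t)"
proof -
  have m: "((\<lambda>t. \<Xi> * t) has_real_derivative \<Xi>) (at t)" by (auto intro!: derivative_eq_intros)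
  show "(y has_real_derivative \<Xi> * (z t * d t)) (at t)"
    using DERIV_chain2[OF jacobi_sn_deriv[OF p(1) p1] m] by (simp add: y_def[abs_def] z_def d_def algebra_simps)
  show "(z has_real_derivative - \<Xi> * (y t * d t)) (at t)"
    using DERIV_chain2[OF jacobi_cn_deriv[OF p(1) p1] m] by (simp add: y_def z_def[abs_def] d_def algebra_simps)
  show "(d has_real_derivative - \<Xi> * (p * p * (y t * z t))) (at t)"
    using DERIV_chain2[OF jacobi_dn_deriv[OF p(1) p1] m] by (simp add: y_def z_def d_def[abs_def] power2_eq_square algebra_simps)
qed

lemma u_deriv: "(u has_real_derivative u' t) (at t)"
proof -
  have "(u has_real_derivative - 2 * (p * p * C1) * \<Xi> * (y t * z t * d t)) (at t)"
    unfolding u_def[abs_def] by (rule derivative_eq_intros derivs refl)+ (simp add: algebra_simps)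
  then show ?thesis unfolding pC u'_def .
qed

lemma u'_deriv: "(u' has_real_derivative u'' t) (at t)"
proof -
  have "(u' has_real_derivative
      - 2 * (C1 - C2) * (\<Xi> * \<Xi>) * ((z t * z t) * (d t * d t) - (y t * y t) * (d t * d t) - p * p * ((y t * y t) * (z t * z t)))) (at t)"
    unfolding u'_def[abs_def] by (rule derivative_eq_intros derivs refl)+ (simp add: algebra_simps)
  moreover have "- 2 * (C1 - C2) * (\<Xi> * \<Xi>) * ((z t * z t) * (d t * d t) - (y t * y t) * (d t * d t) - p * p * ((y t * y t) * (z t * z t))) = u'' t"
  proof -
    have "- 2 * (C1 - C2) * (\<Xi> * \<Xi>) * ((z t * z t) * (d t * d t) - (y t * y t) * (d t * d t) - p * p * ((y t * y t) * (z t * z t)))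
      = - 2 * \<alpha> * (((C1 - C2) * (z t * z t)) * u t - ((C1 - C2) * (y t * y t)) * u t
          - ((p * p * C1) * (y t * y t)) * ((C1 - C2) * (z t * z t)))"
      unfolding \<Xi>_squared u_def by (simp add: algebra_simps)
    also have "\<dots> = u'' t" unfolding pC uy uz u''_def by (simp add: algebra_simps)
    finally show ?thesis .
  qed
  ultimately show ?thesis by simp
qed

lemma u'_squared: "u' t * u' t = 4 * \<alpha> * u t * (C1 - u t) * (u t - C2)"
proof -
  have "u' t * u' t = 4 * ((C1 - C2) * (y t * y t)) * ((C1 - C2) * (z t * z t)) * ((\<Xi> * \<Xi>) * (d t * d t))"
    unfolding u'_def by (simp add: algebra_simps)
  also have "(\<Xi> * \<Xi>) * (d t * d t) = \<alpha> * u t" unfolding \<Xi>_squared u_def by simp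
  finally show ?thesis unfolding uy uz by (simp add: algebra_simps)
qed

text \<open>The value of \<open>u\<close> fixes sn^2 and cn^2, and the remaining freedom of sign
  matches the sign of u'. The hypothesis on \<open>m\<close> is the squared first-order equation.
  For equal roots the solution is constant.\<close>

lemma initial_values:
  assumes u0: "u0 > 0" "C2 \<le> u0" "u0 \<le> C1" and m: "m * m = \<alpha> * u0 * (C1 - u0) * (u0 - C2)"
  obtains t where "u t = u0" "u' t = 2 * m"
proof (cases "C1 = C2")
  case True
  then have "u 0 = u0" using uy[of 0] u0 by simp
  moreover have "m = 0" using m u0 True by simp
  then have "u' 0 = 2 * m" unfolding u'_def using True by simp
  ultimately show ?thesis by (rule that)
next
  case False
  then have D: "C1 - C2 > 0" using C by simp
  \<comment> \<open>u' is - 2 (C1 - C2) \<Xi> sn cn dn. With cn >= 0 and dn > 0, a positive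
    \<open>m\<close> asks for sn <= 0.\<close>
  define Y where "Y = sqrt ((C1 - u0) / (C1 - C2)) * (if m > 0 then -1 else 1)"
  define Z where "Z = sqrt ((u0 - C2) / (C1 - C2))"
  have YZ: "Y\<^sup>2 = (C1 - u0) / (C1 - C2)" "Z\<^sup>2 = (u0 - C2) / (C1 - C2)"
    using D u0 by (auto simp: Y_def Z_def power_mult_distrib)
  have "Y\<^sup>2 + Z\<^sup>2 = 1" unfolding YZ using D by (simp flip: add_divide_distrib)
  moreover have "Z > 0" if "p = 1"
  proof -
    have "C2 = 0" using pC that by simp
    then show ?thesis using u0 D by (simp add: Z_def)
  qed
  ultimately obtain v where v: "jacobi_sn p v = Y" "jacobi_cn p v = Z"
    by (rule jacobi_sn_cn_surj[OF p(1) p1])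
  define t where "t = v / \<Xi>"
  have t: "\<Xi> * t = v" using \<Xi>_pos by (simp add: t_def)
  have ut: "u t = u0" using uy[of t] YZ(1) D by (simp add: y_def t v power2_eq_square)
  have "u' t * u' t = (2 * m) * (2 * m)" unfolding u'_squared ut using m by simp
  then have abs: "\<bar>u' t\<bar> = \<bar>2 * m\<bar>" by (metis abs_mult_self_eq abs_ge_zero abs_mult power2_eq_iff_nonneg power2_eq_square)
  have s: "u' t = - 2 * (C1 - C2) * \<Xi> * (Y * Z * d t)" unfolding u'_def y_def z_def t v ..
  have pos: "2 * (C1 - C2) * \<Xi> * (\<bar>Y\<bar> * Z * d t) \<ge> 0"
    using D \<Xi>_pos sq(3)[of t] u0 by (intro mult_nonneg_nonneg) (auto simp: Z_def)
  have "u' t = 2 * m"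
  proof (cases "m > 0")
    case True
    then have "\<bar>Y\<bar> = - Y" using D u0 by (simp add: Y_def)
    then have "u' t \<ge> 0" using pos s by (simp add: algebra_simps)
    then show ?thesis using abs True by simp
  next
    case False
    then have "\<bar>Y\<bar> = Y" using D u0 by (simp add: Y_def)
    then have "u' t \<le> 0" using pos s by (simp add: algebra_simps)
    then show ?thesis using abs False by simp
  qed
  then show ?thesis using that ut by blast
qed

end

context cmc_elliptic
begin

text \<open>The denominator of the integral of the third kind is (u + k) / (C1 + k), so the integral
  may be differentiated as long as u + k stays positive. When C + k H = 0 its coefficient vanishes
  and the formula is H t, which covers curves through the axis.\<close>

lemma psi_deriv:
  assumes H: "\<alpha> = H\<^sup>2 - 1" and nz: "C + k * H = 0 \<or> (\<forall>t. u t + k > 0)"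
  shows "(cmc_psi k H C C1 C2 p has_real_derivative (if C + k * H = 0 then H else H - (C + k * H) / (u t + k))) (at t)"
proof (cases "C + k * H = 0")
  case True
  then show ?thesis by (auto simp: cmc_psi_def[abs_def] intro!: derivative_eq_intros)
next
  case False
  then have pos: "u s + k > 0" for s using nz by blast
  have "(C1 - C2) * (y 0 * y 0) \<ge> 0" using C by (intro mult_nonneg_nonneg[OF _ zero_le_square]) simp
  then have Ck: "C1 + k > 0" using pos[of 0] uy[of 0] by linarith
  let ?k = "(C1 - C2) / (C1 + k)"
  have den: "1 - ?k * (jacobi_sn p v)\<^sup>2 = (u (v / \<Xi>) + k) / (C1 + k)" for v
  proof -
    have "1 - ?k * (jacobi_sn p v)\<^sup>2 = 1 - ((C1 - C2) * (y (v / \<Xi>) * y (v / \<Xi>))) / (C1 + k)"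
      using \<Xi>_pos by (simp add: y_def power2_eq_square)
    then show ?thesis unfolding uy using Ck by (simp add: field_simps)
  qed
  have X: "cmc_Xi H C1 = \<Xi>" by (simp add: cmc_Xi_def \<Xi> H)
  have "1 - ?k * (jacobi_sn p v)\<^sup>2 > 0" for v unfolding den using pos Ck by simp
  from ellint_Pi_deriv[OF p(1) p1 this, of "\<Xi> * t"]
  have Pi: "(ellint_Pi p ?k has_real_derivative 1 / ((u t + k) / (C1 + k))) (at (\<Xi> * t))"
    unfolding den using \<Xi>_pos by simp
  have m: "((\<lambda>t. \<Xi> * t) has_real_derivative \<Xi>) (at t)" by (auto intro!: derivative_eq_intros)
  have "((\<lambda>t. H * t - (C + k * H) / (C1 + k) * (1 / \<Xi>) * ellint_Pi p ?k (\<Xi> * t)) has_real_derivative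
      H - (C + k * H) / (C1 + k) * (1 / \<Xi>) * (1 / ((u t + k) / (C1 + k)) * \<Xi>)) (at t)"
    by (intro DERIV_diff DERIV_cmult DERIV_cmult_Id DERIV_chain2[OF Pi m])
  moreover have "Y / A * (1 / X) * (1 / (B / A) * X) = Y / B" if "A \<noteq> 0" "X \<noteq> 0" for A B X Y :: real
    using that by simp
  then have "(C + k * H) / (C1 + k) * (1 / \<Xi>) * (1 / ((u t + k) / (C1 + k)) * \<Xi>) = (C + k * H) / (u t + k)"
    using Ck \<Xi>_pos by (metis less_irrefl)
  ultimately have "((\<lambda>t. H * t - (C + k * H) / (C1 + k) * (1 / \<Xi>) * ellint_Pi p ?k (\<Xi> * t)) has_real_derivative
      H - (C + k * H) / (u t + k)) (at t)" by (simp only:)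
  then show ?thesis unfolding cmc_psi_def[abs_def] X using False by (simp only: if_False)
qed

lemma r_squared:
  assumes "\<alpha> = H\<^sup>2 - 1"
  shows "cmc_r H C1 p t = sqrt (u t)"
proof -
  have "sqrt (u t) = sqrt C1 * d t" unfolding u_def using sq(3)[of t] by (simp add: real_sqrt_mult)
  moreover have "cmc_Xi H C1 = \<Xi>" by (simp add: cmc_Xi_def \<Xi> assms)
  ultimately show ?thesis by (simp only: cmc_r_def d_def)
qed

end

section \<open>Polar coordinates in the plane of the profile angle\<close>

context rot_surface
begin

text \<open>\<open>e1\<close> and \<open>e2\<close> are the angular and radial components of the
  profile equation for (a, b) in polar form, and \<open>e3\<close> is conformality. The phase
  \<open>c\<close> is free because the equation is invariant under rotations of (a, b).\<close>

lemma polar_cmc_profile: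
  assumes d: "\<And>t. (\<rho> has_real_derivative \<rho>1 t) (at t)" "\<And>t. (\<rho>1 has_real_derivative \<rho>2 t) (at t)"
      "\<And>t. (\<psi> has_real_derivative \<psi>1 t) (at t)" "\<And>t. (\<psi>1 has_real_derivative \<psi>2 t) (at t)"
    and u: "\<And>t. \<rho> t * \<rho> t = u t + k" "\<And>t. u t > 0"
    and e1: "\<And>t. 2 * \<rho>1 t * \<psi>1 t + \<rho> t * \<psi>2 t = 2 * H * \<rho>1 t"
    and e2: "\<And>t. \<rho>2 t + k * \<rho> t * \<psi>1 t * \<psi>1 t = 2 * u t * \<rho> t - 2 * H * u t * \<rho> t * \<psi>1 t"
    and e3: "\<And>t. \<rho>1 t * \<rho>1 t = u t * u t - u t * (\<rho> t * \<rho> t) * \<psi>1 t * \<psi>1 t"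
  shows "cmc_profile UNIV (\<lambda>t. \<rho> t * gcos k (\<psi> t + c)) (\<lambda>t. \<rho>1 t * gcos k (\<psi> t + c) + k * \<rho> t * \<psi>1 t * gsin k (\<psi> t + c))
     (\<lambda>t. \<rho> t * gsin k (\<psi> t + c)) (\<lambda>t. \<rho>1 t * gsin k (\<psi> t + c) + \<rho> t * \<psi>1 t * gcos k (\<psi> t + c))"
    and "usq (\<rho> t * gcos k (\<psi> t + c)) (\<rho> t * gsin k (\<psi> t + c)) = u t"
proof -
  define g where "g t = gcos k (\<psi> t + c)" for t
  define s where "s t = gsin k (\<psi> t + c)" for t
  have dg: "(g has_real_derivative k * s t * \<psi>1 t) (at t)" for t
    unfolding g_def[abs_def] s_def
    by (rule DERIV_chain2[OF gcos_deriv[OF k]]) (auto intro!: derivative_eq_intros d(3))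
  have ds: "(s has_real_derivative g t * \<psi>1 t) (at t)" for t
    unfolding s_def[abs_def] g_def
    by (rule DERIV_chain2[OF gsin_deriv]) (auto intro!: derivative_eq_intros d(3))
  have gs: "g t * g t - k * s t * s t = 1" for t
    using gcos_gsin_squared[OF k, of "\<psi> t + c"] by (simp add: g_def s_def power2_eq_square)
  have us: "usq (\<rho> t * g t) (\<rho> t * s t) = u t" for t
  proof -
    have "usq (\<rho> t * g t) (\<rho> t * s t) = (\<rho> t * \<rho> t) * (g t * g t - k * s t * s t) - k" by (simp add: usq_def algebra_simps)
    then show ?thesis by (simp add: gs u(1))
  qed
  then show "usq (\<rho> t * gcos k (\<psi> t + c)) (\<rho> t * gsin k (\<psi> t + c)) = u t" by (simp add: g_def s_def)
  have m: "(\<rho> t * g t) * (\<rho>1 t * g t + k * \<rho> t * \<psi>1 t * s t) - k * (\<rho> t * s t) * (\<rho>1 t * s t + \<rho> t * \<psi>1 t * g t) = \<rho> t * \<rho>1 t" for t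
  proof -
    have "(\<rho> t * g t) * (\<rho>1 t * g t + k * \<rho> t * \<psi>1 t * s t) - k * (\<rho> t * s t) * (\<rho>1 t * s t + \<rho> t * \<psi>1 t * g t)
      = \<rho> t * \<rho>1 t * (g t * g t - k * s t * s t)" by (simp add: algebra_simps)
    then show ?thesis by (simp add: gs)
  qed
  have ur: "u t - \<rho> t * \<rho> t = - k" for t using u(1)[of t] by simp
  have "cmc_profile UNIV (\<lambda>t. \<rho> t * g t) (\<lambda>t. \<rho>1 t * g t + k * \<rho> t * \<psi>1 t * s t)
     (\<lambda>t. \<rho> t * s t) (\<lambda>t. \<rho>1 t * s t + \<rho> t * \<psi>1 t * g t)"
    unfolding cmc_profile_def acc_a_def acc_b_def us m
  proof (intro ballI conjI)
    fix t
    show "((\<lambda>t. \<rho> t * g t) has_real_derivative \<rho>1 t * g t + k * \<rho> t * \<psi>1 t * s t) (at t)"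
      by (rule derivative_eq_intros d dg refl)+ (simp add: algebra_simps)
    show "((\<lambda>t. \<rho> t * s t) has_real_derivative \<rho>1 t * s t + \<rho> t * \<psi>1 t * g t) (at t)"
      by (rule derivative_eq_intros d ds refl)+ (simp add: algebra_simps)
    show "u t > 0" by (rule u(2))
    have "((\<lambda>t. \<rho>1 t * g t + k * \<rho> t * \<psi>1 t * s t) has_real_derivative
        (\<rho>2 t + k * \<rho> t * \<psi>1 t * \<psi>1 t) * g t + k * s t * (2 * \<rho>1 t * \<psi>1 t + \<rho> t * \<psi>2 t)) (at t)"
      by (rule derivative_eq_intros d dg ds refl)+ (simp add: algebra_simps)
    moreover have "(\<rho>2 t + k * \<rho> t * \<psi>1 t * \<psi>1 t) * g t + k * s t * (2 * \<rho>1 t * \<psi>1 t + \<rho> t * \<psi>2 t) =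
        2 * u t * (\<rho> t * g t) - 2 * H * ((u t - \<rho> t * \<rho> t) * (\<rho>1 t * s t) + u t * \<rho> t * \<psi>1 t * g t)"
      unfolding e1 e2 ur by (simp add: algebra_simps)
    moreover have "(u t - \<rho> t * \<rho> t) * (\<rho>1 t * s t) + u t * \<rho> t * \<psi>1 t * g t = u t * (\<rho>1 t * s t + \<rho> t * \<psi>1 t * g t) - \<rho> t * \<rho>1 t * (\<rho> t * s t)"
      by (simp add: algebra_simps)
    ultimately show "((\<lambda>t. \<rho>1 t * g t + k * \<rho> t * \<psi>1 t * s t) has_real_derivative
       2 * u t * (\<rho> t * g t) - 2 * H * (u t * (\<rho>1 t * s t + \<rho> t * \<psi>1 t * g t) - \<rho> t * \<rho>1 t * (\<rho> t * s t))) (at t)"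
      by simp
    have "((\<lambda>t. \<rho>1 t * s t + \<rho> t * \<psi>1 t * g t) has_real_derivative
        (\<rho>2 t + k * \<rho> t * \<psi>1 t * \<psi>1 t) * s t + g t * (2 * \<rho>1 t * \<psi>1 t + \<rho> t * \<psi>2 t)) (at t)"
      by (rule derivative_eq_intros d dg ds refl)+ (simp add: algebra_simps)
    moreover have "(\<rho>2 t + k * \<rho> t * \<psi>1 t * \<psi>1 t) * s t + g t * (2 * \<rho>1 t * \<psi>1 t + \<rho> t * \<psi>2 t) =
        2 * u t * (\<rho> t * s t) - 2 * H * k * ((u t - \<rho> t * \<rho> t) * (\<rho>1 t * g t) + k * (u t * \<rho> t * \<psi>1 t * s t))"
      unfolding e1 e2 ur by (simp add: algebra_simps)
    moreover have "(u t - \<rho> t * \<rho> t) * (\<rho>1 t * g t) + k * (u t * \<rho> t * \<psi>1 t * s t) = u t * (\<rho>1 t * g t + k * \<rho> t * \<psi>1 t * s t) - \<rho> t * \<rho>1 t * (\<rho> t * g t)"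
      by (simp add: algebra_simps)
    ultimately show "((\<lambda>t. \<rho>1 t * s t + \<rho> t * \<psi>1 t * g t) has_real_derivative
       2 * u t * (\<rho> t * s t) - 2 * H * k * (u t * (\<rho>1 t * g t + k * \<rho> t * \<psi>1 t * s t) - \<rho> t * \<rho>1 t * (\<rho> t * g t))) (at t)"
      by simp
    let ?S = "(\<rho>1 t * s t + \<rho> t * \<psi>1 t * g t) * (\<rho>1 t * s t + \<rho> t * \<psi>1 t * g t)
         - k * (\<rho>1 t * g t + k * \<rho> t * \<psi>1 t * s t) * (\<rho>1 t * g t + k * \<rho> t * \<psi>1 t * s t)"
    have S: "?S = (\<rho> t * \<rho> t * \<psi>1 t * \<psi>1 t - k * (\<rho>1 t * \<rho>1 t)) * (g t * g t - k * s t * s t)"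
      by (simp add: algebra_simps)
    have "k * (\<rho> t * \<rho>1 t) * (\<rho> t * \<rho>1 t) + u t * ?S =
       k * (\<rho>1 t * \<rho>1 t) * (\<rho> t * \<rho> t - u t) + u t * (\<rho> t * \<rho> t) * \<psi>1 t * \<psi>1 t"
      unfolding S gs by (simp add: algebra_simps)
    also have "\<dots> = \<rho>1 t * \<rho>1 t + u t * (\<rho> t * \<rho> t) * \<psi>1 t * \<psi>1 t" using u(1)[of t] by (simp add: algebra_simps)
    also have "\<dots> = u t * u t" unfolding e3 by simp
    finally show "k * (\<rho> t * \<rho>1 t) * (\<rho> t * \<rho>1 t) + u t * ?S = u t * u t" .
  qed
  then show "cmc_profile UNIV (\<lambda>t. \<rho> t * gcos k (\<psi> t + c)) (\<lambda>t. \<rho>1 t * gcos k (\<psi> t + c) + k * \<rho> t * \<psi>1 t * gsin k (\<psi> t + c))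
     (\<lambda>t. \<rho> t * gsin k (\<psi> t + c)) (\<lambda>t. \<rho>1 t * gsin k (\<psi> t + c) + \<rho> t * \<psi>1 t * gcos k (\<psi> t + c))"
    by (simp add: g_def s_def)
qed

lemma polar_angle:
  assumes "a * a - k * b * b = 1" "k = 1 \<Longrightarrow> a > 0"
  obtains \<theta> where "a = gcos k \<theta>" "b = gsin k \<theta>"
proof (cases "k = 1")
  case True
  then have "a\<^sup>2 = b\<^sup>2 + 1" using assms(1) by (simp add: power2_eq_square)
  then have "sqrt (b\<^sup>2 + 1) = a" using assms(2)[OF True] by (intro real_sqrt_unique) auto
  then show ?thesis using that[of "arsinh b"] True by (simp add: gcos_def gsin_def cosh_arsinh_real)
next
  case False
  then have "a\<^sup>2 + b\<^sup>2 = 1" using assms(1) k by (auto simp: power2_eq_square)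
  then obtain \<theta> where "a = cos \<theta>" "b = sin \<theta>" using sincos_total_2pi by metis
  then show ?thesis using that False by (simp add: gcos_def gsin_def)
qed

text \<open>Away from the origin the position determines the polar angle. At the origin, which
  occurs only for \<open>k = -1\<close>, conformality makes the velocity a unit vector and the angle
  is taken from it; the sign of \<open>\<rho>1\<close> is then compensated by the angle.\<close>

lemma polar_initial_data:
  assumes \<rho>: "\<rho> * \<rho> = usq a b + k" and m: "\<rho> * \<rho>1 = a * a1 - k * b * b1" and D: "\<rho> * \<rho> * \<psi>1 = a * b1 - b * a1"
    and c: "k * (a * a1 - k * b * b1) * (a * a1 - k * b * b1) + usq a b * (b1 * b1 - k * a1 * a1) = usq a b * usq a b"
    and e3: "\<rho>1 * \<rho>1 = usq a b * usq a b - usq a b * (\<rho> * \<rho>) * \<psi>1 * \<psi>1"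
    and k1: "k = 1 \<Longrightarrow> \<rho> > 0 \<and> a > 0"
  obtains \<theta> where "a = \<rho> * gcos k \<theta>" "b = \<rho> * gsin k \<theta>" "a1 = \<rho>1 * gcos k \<theta> + k * \<rho> * \<psi>1 * gsin k \<theta>"
    "b1 = \<rho>1 * gsin k \<theta> + \<rho> * \<psi>1 * gcos k \<theta>"
proof (cases "\<rho> = 0")
  case True
  then have km: "k = -1" using k1 k by auto
  have ab: "a * a + b * b = 0" using \<rho> True unfolding usq_def using km by simp
  then have ab0: "a = 0" "b = 0" by (auto simp: sum_squares_eq_zero_iff)
  have us: "usq a b = 1" unfolding usq_def using ab0 km by simp
  have r1: "\<rho>1 * \<rho>1 = 1" using e3 True us by simp
  have a1: "b1 * b1 + a1 * a1 = 1" using c unfolding us using ab0 km by simp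
  have "(a1 / \<rho>1) * (a1 / \<rho>1) - k * (b1 / \<rho>1) * (b1 / \<rho>1) = (b1 * b1 + a1 * a1) / (\<rho>1 * \<rho>1)"
    using km by (simp add: add_divide_distrib)
  also have "\<dots> = 1" by (simp add: r1 a1)
  finally have E: "(a1 / \<rho>1) * (a1 / \<rho>1) - k * (b1 / \<rho>1) * (b1 / \<rho>1) = 1" .
  have pos: "k = 1 \<Longrightarrow> a1 / \<rho>1 > 0" using km by simp
  obtain \<theta> where \<theta>: "a1 / \<rho>1 = gcos k \<theta>" "b1 / \<rho>1 = gsin k \<theta>" by (rule polar_angle[OF E pos])
  have "\<rho>1 \<noteq> 0" using r1 by auto
  then have "a1 = \<rho>1 * gcos k \<theta>" "b1 = \<rho>1 * gsin k \<theta>" by (simp_all flip: \<theta>)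
  then show ?thesis using that[of \<theta>] True ab0 by simp
next
  case False
  have rr: "\<rho> * \<rho> = a * a - k * b * b" using \<rho> by (simp add: usq_def)
  have "(a / \<rho>) * (a / \<rho>) - k * (b / \<rho>) * (b / \<rho>) = (a * a - k * b * b) / (\<rho> * \<rho>)" by (simp add: diff_divide_distrib)
  also have "\<dots> = 1" using False by (simp flip: rr)
  finally have E: "(a / \<rho>) * (a / \<rho>) - k * (b / \<rho>) * (b / \<rho>) = 1" .
  have pos: "k = 1 \<Longrightarrow> a / \<rho> > 0" using k1 by simp
  obtain \<theta> where \<theta>: "a / \<rho> = gcos k \<theta>" "b / \<rho> = gsin k \<theta>" by (rule polar_angle[OF E pos])
  then have \<theta>: "a = \<rho> * gcos k \<theta>" "b = \<rho> * gsin k \<theta>" using False by (simp_all flip: \<theta>)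
  have "\<rho> * \<rho> * a1 = a * (\<rho> * \<rho>1) + k * b * (\<rho> * \<rho> * \<psi>1)" by (simp only: m D) (simp add: rr algebra_simps)
  also have "\<dots> = \<rho> * \<rho> * (\<rho>1 * gcos k \<theta> + k * \<rho> * \<psi>1 * gsin k \<theta>)" unfolding \<theta> by (simp add: algebra_simps)
  finally have a1: "a1 = \<rho>1 * gcos k \<theta> + k * \<rho> * \<psi>1 * gsin k \<theta>" using False by simp
  have "\<rho> * \<rho> * b1 = b * (\<rho> * \<rho>1) + a * (\<rho> * \<rho> * \<psi>1)" by (simp only: m D) (simp add: rr algebra_simps)
  also have "\<dots> = \<rho> * \<rho> * (\<rho>1 * gsin k \<theta> + \<rho> * \<psi>1 * gcos k \<theta>)" unfolding \<theta> by (simp add: algebra_simps)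
  finally have b1: "b1 = \<rho>1 * gsin k \<theta> + \<rho> * \<psi>1 * gcos k \<theta>" using False by simp
  show ?thesis by (rule that[OF \<theta> a1 b1])
qed

end

context cmc_elliptic
begin

text \<open>In the second case the profile curve passes through the axis, and \<open>\<rho>\<close> is the smooth
  function with \<open>\<bar>\<rho>\<bar> = sqrt (r\<^sup>2 - 1)\<close>.\<close>

lemma radial_data:
  assumes H: "\<alpha> = H\<^sup>2 - 1" and s: "\<alpha> * (C1 + C2) = k + 2 * H * C" and pr: "\<alpha> * (C1 * C2) = C\<^sup>2"
    and cases: "(k = 1 \<or> k = -1) \<and> C2 + k > 0 \<or> k = -1 \<and> C = H \<and> C2 = 1"
  obtains \<rho> \<rho>1 \<rho>2 \<psi>1 \<psi>2 where
    "\<And>t. (\<rho> has_real_derivative \<rho>1 t) (at t)" "\<And>t. (\<rho>1 has_real_derivative \<rho>2 t) (at t)"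
    "\<And>t. (cmc_psi k H C C1 C2 p has_real_derivative \<psi>1 t) (at t)" "\<And>t. (\<psi>1 has_real_derivative \<psi>2 t) (at t)"
    "\<And>t. \<rho> t * \<rho> t = u t + k" "\<And>t. 2 * \<rho>1 t * \<psi>1 t + \<rho> t * \<psi>2 t = 2 * H * \<rho>1 t"
    "\<And>t. \<rho>2 t + k * \<rho> t * \<psi>1 t * \<psi>1 t = 2 * u t * \<rho> t - 2 * H * u t * \<rho> t * \<psi>1 t"
    "\<And>t. \<rho>1 t * \<rho>1 t = u t * u t - u t * (\<rho> t * \<rho> t) * \<psi>1 t * \<psi>1 t"
    "\<And>t. \<rho> t * \<rho> t * \<psi>1 t = H * u t - C" "\<And>t. 2 * (\<rho> t * \<rho>1 t) = u' t" "\<And>t. k = 1 \<Longrightarrow> \<rho> t > 0"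
  using cases
proof (rule disjE)
  assume "(k = 1 \<or> k = -1) \<and> C2 + k > 0"
  then have C2k: "C2 + k > 0" and k: "k = 1 \<or> k = -1" by blast+
  have pos: "u t + k > 0" for t using u_ge[of t] C2k by simp
  define \<rho> where "\<rho> t = sqrt (u t + k)" for t
  define \<rho>1 where "\<rho>1 t = u' t / (2 * \<rho> t)" for t
  define \<rho>2 where "\<rho>2 t = (u'' t - 2 * (\<rho>1 t * \<rho>1 t)) / (2 * \<rho> t)" for t
  define \<psi>1 where "\<psi>1 t = H - (C + k * H) / (u t + k)" for t
  define \<psi>2 where "\<psi>2 t = (C + k * H) * u' t / ((u t + k) * (u t + k))" for t
  have rpos: "\<rho> t > 0" for t using pos[of t] by (simp add: \<rho>_def)
  have rr: "\<rho> t * \<rho> t = u t + k" for t using pos[of t] by (simp add: \<rho>_def)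
  have r1: "2 * (\<rho> t * \<rho>1 t) = u' t" for t using rpos[of t] by (simp add: \<rho>1_def)
  have r2: "2 * (\<rho> t * \<rho>2 t) = u'' t - 2 * (\<rho>1 t * \<rho>1 t)" for t using rpos[of t] by (simp add: \<rho>2_def)
  \<comment> \<open>The first integral in polar form: (u + k) \<psi>1 is the angular momentum of (a,
    b).\<close>
  have w: "(u t + k) * \<psi>1 t = H * u t - C" for t
  proof -
    have "A * (H - Y / A) = A * H - Y" if "A \<noteq> 0" for A Y :: real using that by (simp add: right_diff_distrib)
    then have "(u t + k) * \<psi>1 t = (u t + k) * H - (C + k * H)" unfolding \<psi>1_def using pos[of t] by (metis less_irrefl)
    then show ?thesis by (simp add: algebra_simps)
  qed
  have d\<rho>: "(\<rho> has_real_derivative \<rho>1 t) (at t)" for t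
  proof -
    have "((\<lambda>t. u t + k) has_real_derivative u' t) (at t)" by (auto intro!: derivative_eq_intros u_deriv)
    note DERIV_chain2[OF DERIV_real_sqrt[OF pos] this]
    moreover have "inverse (sqrt (u t + k)) / 2 * u' t = \<rho>1 t" unfolding \<rho>1_def \<rho>_def by (simp add: inverse_eq_divide)
    moreover have "\<rho> = (\<lambda>t. sqrt (u t + k))" by (simp add: fun_eq_iff \<rho>_def)
    ultimately show ?thesis by (simp only:)
  qed
  have d\<rho>1: "(\<rho>1 has_real_derivative \<rho>2 t) (at t)" for t
  proof -
    have "(\<rho>1 has_real_derivative (u'' t * (2 * \<rho> t) - u' t * (2 * \<rho>1 t)) / ((2 * \<rho> t) * (2 * \<rho> t))) (at t)"
      unfolding \<rho>1_def[abs_def]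
      by (rule DERIV_divide[OF u'_deriv DERIV_cmult[OF d\<rho>[unfolded \<rho>1_def]], unfolded \<rho>1_def]) (use rpos[of t] in simp)
    moreover have "(u'' t * (2 * \<rho> t) - u' t * (2 * \<rho>1 t)) / ((2 * \<rho> t) * (2 * \<rho> t)) = \<rho>2 t"
      unfolding r1[symmetric] \<rho>2_def using rpos[of t] by (simp add: field_simps)
    ultimately show ?thesis by simp
  qed
  have d\<psi>: "(cmc_psi k H C C1 C2 p has_real_derivative \<psi>1 t) (at t)" for t
    using psi_deriv[OF H, of C k t] pos by (simp add: \<psi>1_def split: if_splits)
  have d\<psi>1: "(\<psi>1 has_real_derivative \<psi>2 t) (at t)" for t
  proof -
    have "((\<lambda>t. u t + k) has_real_derivative u' t) (at t)" by (auto intro!: derivative_eq_intros u_deriv)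
    from DERIV_diff[OF DERIV_const DERIV_divide[OF DERIV_const this], of H "C + k * H"] pos[of t]
    have "((\<lambda>t. H - (C + k * H) / (u t + k)) has_real_derivative
        0 - (0 * (u t + k) - (C + k * H) * u' t) / ((u t + k) * (u t + k))) (at t)" by simp
    moreover have "0 - (0 * (u t + k) - (C + k * H) * u' t) / ((u t + k) * (u t + k)) = \<psi>2 t" by (simp add: \<psi>2_def)
    ultimately show ?thesis unfolding \<psi>1_def[abs_def] by simp
  qed
  have usq: "u' t * u' t = 4 * u t * (- \<alpha> * u t * u t + (k + 2 * H * C) * u t - C\<^sup>2)" for t
    unfolding u'_squared s[symmetric] pr[symmetric] by (simp add: algebra_simps)
  have u2: "u'' t = - 6 * \<alpha> * u t * u t + 4 * (k + 2 * H * C) * u t - 2 * C\<^sup>2" for t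
    unfolding u''_def s[symmetric] pr[symmetric] by (simp add: algebra_simps)
  have e3: "\<rho>1 t * \<rho>1 t = u t * u t - u t * (\<rho> t * \<rho> t) * \<psi>1 t * \<psi>1 t" for t
  proof -
    have "4 * (\<rho> t * \<rho> t) * (\<rho>1 t * \<rho>1 t) = u' t * u' t" unfolding r1[symmetric] by (simp add: algebra_simps)
    also have "\<dots> = 4 * (u t * u t * (u t + k) - u t * ((H * u t - C) * (H * u t - C)))"
      unfolding usq unfolding H by (simp add: algebra_simps power2_eq_square)
    also have "\<dots> = 4 * (\<rho> t * \<rho> t) * (u t * u t - u t * (\<rho> t * \<rho> t) * \<psi>1 t * \<psi>1 t)"
      unfolding w[symmetric] rr by (simp add: algebra_simps)
    finally show ?thesis using rpos[of t] by simp
  qed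
  have e1: "2 * \<rho>1 t * \<psi>1 t + \<rho> t * \<psi>2 t = 2 * H * \<rho>1 t" for t
  proof -
    have p2: "(u t + k) * \<psi>2 t = u' t * (H - \<psi>1 t)" using pos[of t] by (simp add: \<psi>1_def \<psi>2_def)
    have "\<rho> t * (2 * \<rho>1 t * \<psi>1 t + \<rho> t * \<psi>2 t) = 2 * (\<rho> t * \<rho>1 t) * \<psi>1 t + (\<rho> t * \<rho> t) * \<psi>2 t" by (simp add: algebra_simps)
    also have "\<dots> = u' t * H" unfolding r1 rr p2 by (simp add: algebra_simps)
    also have "\<dots> = \<rho> t * (2 * H * \<rho>1 t)" unfolding r1[symmetric] by (simp add: algebra_simps)
    finally show ?thesis using rpos[of t] by simp
  qed
  have e2: "\<rho>2 t + k * \<rho> t * \<psi>1 t * \<psi>1 t = 2 * u t * \<rho> t - 2 * H * u t * \<rho> t * \<psi>1 t" for t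
  proof -
    have "2 * \<rho> t * (\<rho>2 t + k * \<rho> t * \<psi>1 t * \<psi>1 t) = 2 * (\<rho> t * \<rho>2 t) + 2 * k * (\<rho> t * \<rho> t) * \<psi>1 t * \<psi>1 t" by (simp add: algebra_simps)
    also have "\<dots> = u'' t - 2 * (u t * u t) + 2 * ((u t + k) * \<psi>1 t) * ((u t + k) * \<psi>1 t)"
      unfolding r2 e3 rr by (simp add: algebra_simps)
    also have "\<dots> = 4 * u t * (u t + k) - 4 * H * u t * ((u t + k) * \<psi>1 t)"
      unfolding w u2 unfolding H by (simp add: algebra_simps power2_eq_square)
    also have "\<dots> = 2 * \<rho> t * (2 * u t * \<rho> t - 2 * H * u t * \<rho> t * \<psi>1 t)"
      unfolding rr[symmetric] by (simp add: algebra_simps)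
    finally show ?thesis using rpos[of t] by simp
  qed
  show ?thesis by (rule that[OF d\<rho> d\<rho>1 d\<psi> d\<psi>1 rr e1 e2 e3 _ r1]) (use rpos w rr in auto)
next
  assume "k = -1 \<and> C = H \<and> C2 = 1"
  then have k: "k = -1" and CH: "C = H" and C2: "C2 = 1" by blast+
  \<comment> \<open>For C2 = 1 one has u - 1 = (C1 - 1) cn^2, so \<open>q\<close> times cn is a
    smooth square root of r^2 - 1.\<close>
  define q where "q = sqrt (C1 - 1)"
  have q: "q * q = C1 - C2" using C C2 by (simp add: q_def)
  have aC: "\<alpha> * C1 = H\<^sup>2" using pr CH C2 by simp
  define \<rho> where "\<rho> t = q * z t" for t
  define \<rho>1 where "\<rho>1 t = - q * \<Xi> * (y t * d t)" for t
  define \<rho>2 where "\<rho>2 t = \<rho> t * (H\<^sup>2 - 2 * \<alpha> * u t)" for t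
  have d\<rho>: "(\<rho> has_real_derivative \<rho>1 t) (at t)" for t
    unfolding \<rho>_def[abs_def] \<rho>1_def by (rule derivative_eq_intros derivs refl)+ simp
  have d\<rho>1: "(\<rho>1 has_real_derivative \<rho>2 t) (at t)" for t
  proof -
    have "(\<rho>1 has_real_derivative - q * (\<Xi> * \<Xi>) * z t * (d t * d t - p * p * (y t * y t))) (at t)"
      unfolding \<rho>1_def[abs_def] by (rule derivative_eq_intros derivs refl)+ (simp add: algebra_simps)
    moreover have pp: "p * p * (y t * y t) = 1 - d t * d t" using sq(2)[of t] by simp
    have "- q * (\<Xi> * \<Xi>) * z t * (d t * d t - p * p * (y t * y t)) = \<rho>2 t"
      unfolding \<Xi>_squared pp \<rho>2_def \<rho>_def u_def aC[symmetric] by (simp add: algebra_simps)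
    ultimately show ?thesis by simp
  qed
  have d\<psi>: "(cmc_psi k H C C1 C2 p has_real_derivative (\<lambda>_. H) t) (at t)" for t
    using psi_deriv[OF H, of C k t] k CH by simp
  have rr: "\<rho> t * \<rho> t = u t + k" for t
  proof -
    have "\<rho> t * \<rho> t = (q * q) * (z t * z t)" by (simp add: \<rho>_def algebra_simps)
    then show ?thesis unfolding q uz using C2 k by simp
  qed
  have e3: "\<rho>1 t * \<rho>1 t = u t * u t - u t * (\<rho> t * \<rho> t) * (\<lambda>_. H) t * (\<lambda>_. H) t" for t
  proof -
    have "\<rho>1 t * \<rho>1 t = ((q * q) * (y t * y t)) * ((\<Xi> * \<Xi>) * (d t * d t))" by (simp add: \<rho>1_def algebra_simps)
    also have "\<dots> = (C1 - u t) * (\<alpha> * u t)" unfolding q uy \<Xi>_squared by (simp add: u_def)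
    also have "\<dots> = (\<alpha> * C1) * u t - \<alpha> * u t * u t" by (simp add: algebra_simps)
    also have "\<dots> = u t * u t - u t * (u t + k) * H * H" unfolding aC unfolding H using k by (simp add: algebra_simps power2_eq_square)
    finally show ?thesis unfolding rr by simp
  qed
  have r1: "2 * (\<rho> t * \<rho>1 t) = u' t" for t
  proof -
    have "2 * (\<rho> t * \<rho>1 t) = - 2 * (q * q) * \<Xi> * (y t * z t * d t)" by (simp add: \<rho>_def \<rho>1_def algebra_simps)
    then show ?thesis unfolding q u'_def .
  qed
  show ?thesis
  proof (rule that[OF d\<rho> d\<rho>1 d\<psi> _ rr _ _ e3 _ r1])
    show "((\<lambda>_. H) has_real_derivative (\<lambda>_. 0) t) (at t)" for t by simp
    show "\<rho>2 t + k * \<rho> t * H * H = 2 * u t * \<rho> t - 2 * H * u t * \<rho> t * H" for t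
      unfolding \<rho>2_def unfolding H using k by (simp add: algebra_simps power2_eq_square)
    show "\<rho> t * \<rho> t * H = H * u t - C" for t unfolding rr using k CH by (simp add: algebra_simps)
  qed (use k in auto)
qed

end

section \<open>Matching the explicit solutions to initial data\<close>

context rot_surface
begin

lemma explicit_profile:
  assumes H1: "H > 1" and u0: "usq a0 b0 > 0" and k1: "k = 1 \<Longrightarrow> a0 > 0"
    and cp: "k * (a0 * a1 - k * b0 * b1) * (a0 * a1 - k * b0 * b1) + usq a0 b0 * (b1 * b1 - k * a1 * a1) = usq a0 b0 * usq a0 b0"
  obtains C C1 C2 p t0 c \<rho> a aa b bb where
    "proots (cmc_poly k H C) = {#C1, C2#}" "C2 \<le> C1" "0 \<le> C2" "0 \<le> p" "p\<^sup>2 = (C1 - C2) / C1" "(C1 - C2) / C1 \<in> {0..1}"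
    "cmc_profile UNIV a aa b bb" "a t0 = a0" "aa t0 = a1" "b t0 = b0" "bb t0 = b1"
    "\<forall>t. rad a b t = cmc_r H C1 p t" "\<forall>t. cmc_r H C1 p t > 0"
    "\<forall>t. a t = \<rho> t * gcos k (cmc_psi k H C C1 C2 p t + c)" "\<forall>t. b t = \<rho> t * gsin k (cmc_psi k H C C1 C2 p t + c)"
    "continuous_on UNIV \<rho>" "\<forall>t. \<rho> t * \<rho> t = (cmc_r H C1 p t)\<^sup>2 + k" "\<forall>t. k = 1 \<longrightarrow> \<rho> t > 0"
proof -
  \<comment> \<open>\<open>v\<close> is r^2, \<open>m\<close> is half its derivative and
    \<open>D\<close> the angular momentum of (a, b). With \<open>C\<close> as the first integral,
    the conformality relation becomes m^2 = - v p_C(v).\<close>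
  define v where "v = usq a0 b0"
  define m where "m = a0 * a1 - k * b0 * b1"
  define D where "D = a0 * b1 - b0 * a1"
  define C where "C = H * v - D"
  define \<alpha> where "\<alpha> = H\<^sup>2 - 1"
  have v: "v > 0" using u0 by (simp add: v_def)
  have vk: "a0 * a0 - k * b0 * b0 = v + k" by (simp add: v_def usq_def)
  have \<alpha>: "\<alpha> > 0" using H1 by (simp add: \<alpha>_def one_less_power)
  have tang: "v * (a1 * a1 - k * b1 * b1) = m * m - k * v * v"
  proof -
    have "k * (k * m * m + v * (b1 * b1 - k * a1 * a1)) = k * (v * v)" using cp by (simp add: m_def v_def)
    then show ?thesis by (simp add: algebra_simps)
  qed
  have mD: "m * m = v * v * v + k * v * v - v * D * D"
  proof -
    have eq: "(v + k) * (a1 * a1 - k * b1 * b1) = m * m - k * D * D"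
      unfolding vk[symmetric] m_def D_def by (simp add: algebra_simps)
    have "(v + k) * (v * (a1 * a1 - k * b1 * b1)) = v * ((v + k) * (a1 * a1 - k * b1 * b1))" by (rule mult.left_commute)
    then have "(v + k) * (v * (a1 * a1 - k * b1 * b1)) = v * (m * m - k * D * D)" by (simp only: eq)
    then have "(v + k) * (m * m - k * v * v) = v * (m * m - k * D * D)" by (simp only: tang)
    then have "k * (m * m) = k * (v * v * v + k * v * v - v * D * D)" by (simp add: algebra_simps)
    then show ?thesis by simp
  qed
  have mp: "m * m = - v * (\<alpha> * v\<^sup>2 - (k + 2 * H * C) * v + C\<^sup>2)"
    unfolding mD \<alpha>_def C_def by (simp add: algebra_simps power2_eq_square)
  have "v * (\<alpha> * v\<^sup>2 - (k + 2 * H * C) * v + C\<^sup>2) \<le> 0" using mp zero_le_square[of m] by linarith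
  then have "(H\<^sup>2 - 1) * v\<^sup>2 - (k + 2 * H * C) * v + C\<^sup>2 \<le> 0" using v by (simp add: mult_le_0_iff \<alpha>_def)
  then obtain C1 C2 where roots: "proots (cmc_poly k H C) = {#C1, C2#}" and C12: "C2 \<le> v" "v \<le> C1" "0 \<le> C2" "C1 > 0"
    and sp: "\<alpha> * (C1 + C2) = k + 2 * H * C" "\<alpha> * (C1 * C2) = C\<^sup>2"
    using cmc_poly_roots[OF H1 v, of k C] unfolding \<alpha>_def by metis
  define p where "p = sqrt ((C1 - C2) / C1)"
  have le: "C2 \<le> C1" using C12 by simp
  have I: "(C1 - C2) / C1 \<in> {0..1}" using C12 le by (simp add: field_simps)
  have p: "p \<ge> 0" "p\<^sup>2 = (C1 - C2) / C1" using I by (auto simp: p_def)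
  interpret E: cmc_elliptic \<alpha> C1 C2 p "sqrt (\<alpha> * C1)"
    by unfold_locales (use \<alpha> C12 le p in auto)
  \<comment> \<open>For \<open>k = -1\<close> one has v >= 1, hence C1 >= 1, and the value (H - C)^2
    of the polynomial at 1 equals \<alpha> (1 - C1) (1 - C2). If C differs from H, both factors are
    negative. If C = H, one root is 1, and it cannot be C1: then C2 would be H^2 / \<alpha> >
    1.\<close>
  have cases: "(k = 1 \<or> k = -1) \<and> C2 + k > 0 \<or> k = -1 \<and> C = H \<and> C2 = 1"
  proof (cases "k = 1")
    case True
    then show ?thesis using C12 by simp
  next
    case False
    then have km: "k = -1" using k by simp
    have "a0 * a0 + b0 * b0 = v - 1" using vk km by simp
    then have v1: "v \<ge> 1" using sum_squares_ge_zero[of a0 b0] by simp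
    have q1: "\<alpha> * ((1 - C1) * (1 - C2)) = (H - C)\<^sup>2"
    proof -
      have "\<alpha> * ((1 - C1) * (1 - C2)) = \<alpha> - \<alpha> * (C1 + C2) + \<alpha> * (C1 * C2)" by (simp add: algebra_simps)
      then show ?thesis unfolding sp unfolding \<alpha>_def using km by (simp add: algebra_simps power2_eq_square)
    qed
    show ?thesis
    proof (cases "C = H")
      case True
      then have "C1 = 1 \<or> C2 = 1" using q1 \<alpha> by auto
      moreover have "C1 \<noteq> 1"
      proof
        assume "C1 = 1"
        then have "\<alpha> * C2 = H\<^sup>2" "C2 \<le> 1" using sp(2) True C12 v1 by auto
        then have "H\<^sup>2 \<le> \<alpha>" using \<alpha> mult_left_le[of C2 \<alpha>] by simp
        then show False by (simp add: \<alpha>_def)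
      qed
      ultimately show ?thesis using True km by simp
    next
      case False
      then have "\<alpha> * ((1 - C1) * (1 - C2)) > 0" unfolding q1 by simp
      then have "(1 - C1) * (1 - C2) > 0" using \<alpha> by (simp add: zero_less_mult_iff)
      moreover have "1 - C1 \<le> 0" using v1 C12 by simp
      ultimately have "C2 > 1" by (simp add: zero_less_mult_iff)
      then show ?thesis using km by simp
    qed
  qed
  obtain \<rho> \<rho>1 \<rho>2 \<psi>1 \<psi>2 where R:
    "\<And>t. (\<rho> has_real_derivative \<rho>1 t) (at t)" "\<And>t. (\<rho>1 has_real_derivative \<rho>2 t) (at t)"
    "\<And>t. (cmc_psi k H C C1 C2 p has_real_derivative \<psi>1 t) (at t)" "\<And>t. (\<psi>1 has_real_derivative \<psi>2 t) (at t)"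
    "\<And>t. \<rho> t * \<rho> t = E.u t + k" "\<And>t. 2 * \<rho>1 t * \<psi>1 t + \<rho> t * \<psi>2 t = 2 * H * \<rho>1 t"
    "\<And>t. \<rho>2 t + k * \<rho> t * \<psi>1 t * \<psi>1 t = 2 * E.u t * \<rho> t - 2 * H * E.u t * \<rho> t * \<psi>1 t"
    "\<And>t. \<rho>1 t * \<rho>1 t = E.u t * E.u t - E.u t * (\<rho> t * \<rho> t) * \<psi>1 t * \<psi>1 t"
    "\<And>t. \<rho> t * \<rho> t * \<psi>1 t = H * E.u t - C" "\<And>t. 2 * (\<rho> t * \<rho>1 t) = E.u' t" "\<And>t. k = 1 \<Longrightarrow> \<rho> t > 0"
    using E.radial_data[OF \<alpha>_def sp cases] by blast
  have "m * m = \<alpha> * v * (C1 - v) * (v - C2)"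
    unfolding mp sp[symmetric] by (simp add: algebra_simps power2_eq_square)
  then obtain t0 where t0: "E.u t0 = v" "E.u' t0 = 2 * m"
    using E.initial_values[OF v C12(1,2)] by blast
  have i1: "\<rho> t0 * \<rho> t0 = usq a0 b0 + k" using R(5)[of t0] by (simp add: t0 v_def)
  have i2: "\<rho> t0 * \<rho>1 t0 = a0 * a1 - k * b0 * b1" using R(10)[of t0] by (simp add: t0 m_def)
  have i3: "\<rho> t0 * \<rho> t0 * \<psi>1 t0 = a0 * b1 - b0 * a1" using R(9)[of t0] by (simp add: t0 C_def D_def)
  have i4: "\<rho>1 t0 * \<rho>1 t0 = usq a0 b0 * usq a0 b0 - usq a0 b0 * (\<rho> t0 * \<rho> t0) * \<psi>1 t0 * \<psi>1 t0"
    using R(8)[of t0] by (simp add: t0 v_def)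
  have i5: "k = 1 \<Longrightarrow> \<rho> t0 > 0 \<and> a0 > 0" using R(11) k1 by blast
  obtain \<theta> where \<theta>: "a0 = \<rho> t0 * gcos k \<theta>" "b0 = \<rho> t0 * gsin k \<theta>" "a1 = \<rho>1 t0 * gcos k \<theta> + k * \<rho> t0 * \<psi>1 t0 * gsin k \<theta>"
    "b1 = \<rho>1 t0 * gsin k \<theta> + \<rho> t0 * \<psi>1 t0 * gcos k \<theta>"
    by (rule polar_initial_data[OF i1 i2 i3 cp i4 i5])
  let ?\<psi> = "cmc_psi k H C C1 C2 p"
  \<comment> \<open>The phase by which the explicit angle must be turned to meet the initial
    data.\<close>
  define c where "c = \<theta> - ?\<psi> t0"
  have c\<theta>: "?\<psi> t0 + c = \<theta>" by (simp add: c_def)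
  note P = polar_cmc_profile[OF R(1-5) E.u_pos R(6-8), where c = c]
  have r: "cmc_r H C1 p t = sqrt (E.u t)" for t by (rule E.r_squared[OF \<alpha>_def])
  show ?thesis
  proof (rule that[OF roots le C12(3) p I P(1)])
    show "\<forall>t. rad (\<lambda>t. \<rho> t * gcos k (?\<psi> t + c)) (\<lambda>t. \<rho> t * gsin k (?\<psi> t + c)) t = cmc_r H C1 p t"
      by (simp add: rad_def P(2) r)
    show "\<forall>t. cmc_r H C1 p t > 0" using E.u_pos by (simp add: r)
    show "\<forall>t. \<rho> t * \<rho> t = (cmc_r H C1 p t)\<^sup>2 + k" using E.u_pos by (simp add: r R(5) less_imp_le)
    show "continuous_on UNIV \<rho>" using DERIV_isCont[OF R(1)] by (simp add: continuous_at_imp_continuous_on)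
    show "\<forall>t. k = 1 \<longrightarrow> \<rho> t > 0" using R(11) by simp
    show "\<rho> t0 * gcos k (?\<psi> t0 + c) = a0" "\<rho> t0 * gsin k (?\<psi> t0 + c) = b0"
      "\<rho>1 t0 * gcos k (?\<psi> t0 + c) + k * \<rho> t0 * \<psi>1 t0 * gsin k (?\<psi> t0 + c) = a1"
      "\<rho>1 t0 * gsin k (?\<psi> t0 + c) + \<rho> t0 * \<psi>1 t0 * gcos k (?\<psi> t0 + c) = b1"
      unfolding c\<theta> using \<theta> by simp_all
    show "\<forall>t. \<rho> t * gcos k (?\<psi> t + c) = \<rho> t * gcos k (?\<psi> t + c)"
      "\<forall>t. \<rho> t * gsin k (?\<psi> t + c) = \<rho> t * gsin k (?\<psi> t + c)" by simp_all
  qed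
qed

end

section \<open>Rotational surfaces of constant mean curvature\<close>

definition tuple4 :: "'a \<Rightarrow> 'a \<Rightarrow> 'a \<Rightarrow> 'a \<Rightarrow> nat \<Rightarrow> 'a" where
  "tuple4 v0 v1 v2 v3 i = (if i = 0 then v0 else if i = 1 then v1 else if i = 2 then v2 else v3)"

lemma tuple4_simps [simp]:
  "tuple4 v0 v1 v2 v3 0 = v0" "tuple4 v0 v1 v2 v3 (Suc 0) = v1" "tuple4 v0 v1 v2 v3 2 = v2" "tuple4 v0 v1 v2 v3 3 = v3"
  by (simp_all add: tuple4_def)

lemma orthonormal_basis_tuple4:
  assumes "mink v0 v0 = -1" "mink v1 v1 = 1" "mink v2 v2 = 1" "mink v3 v3 = 1"
    "mink v0 v1 = 0" "mink v0 v2 = 0" "mink v0 v3 = 0" "mink v1 v2 = 0" "mink v1 v3 = 0" "mink v2 v3 = 0"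
  shows "orthonormal_basis (tuple4 v0 v1 v2 v3)"
proof -
  have s: "mink v1 v0 = 0" "mink v2 v0 = 0" "mink v3 v0 = 0" "mink v2 v1 = 0" "mink v3 v1 = 0" "mink v3 v2 = 0"
    using assms by (simp_all add: mink_commute)
  have c: "i = 0 \<or> i = 1 \<or> i = 2 \<or> i = 3" if "i < 4" for i :: nat using that by auto
  show ?thesis
    unfolding orthonormal_basis_def
  proof (intro allI impI)
    fix i j :: nat assume "i < 4" "j < 4"
    then have "i = 0 \<or> i = 1 \<or> i = 2 \<or> i = 3" "j = 0 \<or> j = 1 \<or> j = 2 \<or> j = 3" by (auto intro: c)
    then show "mink (tuple4 v0 v1 v2 v3 i) (tuple4 v0 v1 v2 v3 j) = (if i \<noteq> j then 0 else if i = 0 then -1 else 1)"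
      by (elim disjE) (simp_all add: assms s)
  qed
qed

section \<open>Choice of the orthonormal basis\<close>

context rot_surface
begin

lemma cmc_representation:
  assumes H1: "H > 1"
  shows "\<exists>C C1 C2 p. proots (cmc_poly k H C) = {#C1, C2#} \<and> C1 \<ge> C2 \<and> C2 \<ge> 0 \<and>
     p \<ge> 0 \<and> p\<^sup>2 = (C1 - C2) / C1 \<and> (C1 - C2) / C1 \<in> {0..1} \<and>
     (k = 1 \<longrightarrow> elliptic_representation (span {u1, u2}) M x (cmc_r H C1 p) (cmc_psi k H C C1 C2 p)) \<and>
     (k = -1 \<longrightarrow> hyperbolic_representation (span {u1, u2}) M x (cmc_r H C1 p) (cmc_psi k H C C1 C2 p))"
proof -
  obtain m where m: "m \<in> free_part" using free_part_nonempty by blast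
  obtain \<theta> \<delta> \<gamma>' a' a1' b' b1' where \<delta>: "\<delta> > 0" and P': "cmc_profile {-\<delta><..<\<delta>} a' a1' b' b1'"
    and L': "lift_on {-\<delta><..<\<delta>} \<gamma>' a' b'"
    by (rule exists_cmc_lift_free[OF m])
  have z: "0 \<in> {-\<delta><..<\<delta>}" using \<delta> by simp
  have u0: "usq (a' 0) (b' 0) > 0" and cp: "k * (a' 0 * a1' 0 - k * b' 0 * b1' 0) * (a' 0 * a1' 0 - k * b' 0 * b1' 0)
      + usq (a' 0) (b' 0) * (b1' 0 * b1' 0 - k * a1' 0 * a1' 0) = usq (a' 0) (b' 0) * usq (a' 0) (b' 0)"
    using P' z unfolding cmc_profile_def by blast+
  have "\<gamma>' 0 \<in> M" "x (\<gamma>' 0) = fr (rad a' b' 0) 0 (a' 0) (b' 0)" using L' z unfolding lift_on_def by blast+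
  then have a0: "k = 1 \<Longrightarrow> a' 0 > 0" using fr_hyp3(2) x_hyp3 by metis
  obtain C C1 C2 p t0 c \<rho> a aa b bb where
    roots: "proots (cmc_poly k H C) = {#C1, C2#}" "C2 \<le> C1" "0 \<le> C2" "0 \<le> p" "p\<^sup>2 = (C1 - C2) / C1" "(C1 - C2) / C1 \<in> {0..1}"
    and P: "cmc_profile UNIV a aa b bb" and ini: "a t0 = a' 0" "aa t0 = a1' 0" "b t0 = b' 0" "bb t0 = b1' 0"
    and r': "\<forall>t. rad a b t = cmc_r H C1 p t" "\<forall>t. cmc_r H C1 p t > 0"
    and ab': "\<forall>t. a t = \<rho> t * gcos k (cmc_psi k H C C1 C2 p t + c)" "\<forall>t. b t = \<rho> t * gsin k (cmc_psi k H C C1 C2 p t + c)"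
    and \<rho>': "continuous_on UNIV \<rho>" "\<forall>t. \<rho> t * \<rho> t = (cmc_r H C1 p t)\<^sup>2 + k" "\<forall>t. k = 1 \<longrightarrow> \<rho> t > 0"
    by (rule explicit_profile[OF H1 u0 a0 cp])
  note r = r'[rule_format] and ab = ab'[rule_format] and \<rho> = \<rho>'[rule_format]
  obtain J \<gamma> where J: "open J" "is_interval J" "t0 \<in> J" and L: "lift_on J \<gamma> a b" and N: "sweep \<gamma> ` (UNIV \<times> J) = free_part"
    by (rule global_sweep[OF P \<delta> P' L' ini])
  let ?r = "cmc_r H C1 p" and ?\<psi> = "cmc_psi k H C C1 C2 p"
  have PJ: "cmc_profile J a aa b bb" using P by (auto simp: cmc_profile_def)
  have lp: "\<exists>U. z \<in> U \<and> U \<subseteq> UNIV \<times> J \<and> local_param M x U (sweep \<gamma>)" if "z \<in> UNIV \<times> J" for z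
    by (rule sweep_local_param[OF J(1) cmc_profile_regular[OF PJ] L that]) blast
  \<comment> \<open>When the surface stays off the axis of a hyperbolic rotation, \<rho> has
    constant sign. If that sign is negative, \<sigma> reverses the complementary basis vectors once
    and for all, so that the representation needs no further sign.\<close>
  define \<sigma> :: real where "\<sigma> = (if (\<forall>t\<in>J. ?r t \<noteq> 1) \<and> \<rho> t0 < 0 then -1 else 1)"
  have \<sigma>: "\<sigma> * \<sigma> = 1" "\<sigma> * (\<sigma> * y) = y" for y by (auto simp: \<sigma>_def)
  \<comment> \<open>The complementary basis is turned by the phase \<open>c\<close>, so that the
    angle becomes exactly \<open>cmc_psi\<close>.\<close>
  define w1' where "w1' = \<sigma> *\<^sub>R (gcos k c *\<^sub>R w1 + gsin k c *\<^sub>R w2)"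
  define w2' where "w2' = \<sigma> *\<^sub>R ((k * gsin k c) *\<^sub>R w1 + gcos k c *\<^sub>R w2)"
  have cs: "gcos k c * gcos k c - k * (gsin k c * gsin k c) = 1"
    using gcos_gsin_squared[OF k, of c] by (simp add: power2_eq_square)
  have w'_fr: "w1' = fr 0 0 (\<sigma> * gcos k c) (\<sigma> * gsin k c)" "w2' = fr 0 0 (\<sigma> * (k * gsin k c)) (\<sigma> * gcos k c)"
    by (simp_all add: w1'_def w2'_def fr_def scaleR_add_right)
  have gr: "mink w1' w1' = - k" "mink w2' w2' = 1" "mink w1' w2' = 0" "mink u1 w1' = 0" "mink u1 w2' = 0" "mink u2 w1' = 0" "mink u2 w2' = 0"
  proof -
    have "mink w1' w1' = - k * (gcos k c * gcos k c - k * (gsin k c * gsin k c))"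
      by (simp add: w'_fr mink_fr algebra_simps \<sigma>)
    then show "mink w1' w1' = - k" by (simp add: cs)
    have "mink w2' w2' = gcos k c * gcos k c - k * (gsin k c * gsin k c)"
      by (simp add: w'_fr mink_fr algebra_simps \<sigma>)
    then show "mink w2' w2' = 1" by (simp add: cs)
    show "mink w1' w2' = 0" by (simp add: w'_fr mink_fr algebra_simps)
    have "mink w1' u1 = 0" "mink w2' u1 = 0" "mink w1' u2 = 0" "mink w2' u2 = 0" by (simp_all only: w'_fr fr_coords)
    then show "mink u1 w1' = 0" "mink u1 w2' = 0" "mink u2 w1' = 0" "mink u2 w2' = 0" by (simp_all only: mink_commute)
  qed
  have wspan: "span {w1', w2'} = span {w1, w2}"
  proof -
    have "w1 = fr 0 0 1 0" "w2 = fr 0 0 0 1" by (simp_all add: fr_def)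
    moreover have "(\<sigma> * gcos k c) *\<^sub>R w1' - (\<sigma> * gsin k c) *\<^sub>R w2' = fr 0 0 (gcos k c * gcos k c - k * (gsin k c * gsin k c)) 0"
      "(\<sigma> * gcos k c) *\<^sub>R w2' - (\<sigma> * (k * gsin k c)) *\<^sub>R w1' = fr 0 0 0 (gcos k c * gcos k c - k * (gsin k c * gsin k c))"
      by (simp_all add: w'_fr fr_ops fr_eq_iff algebra_simps \<sigma>)
    ultimately have w: "w1 = (\<sigma> * gcos k c) *\<^sub>R w1' - (\<sigma> * gsin k c) *\<^sub>R w2'" "w2 = (\<sigma> * gcos k c) *\<^sub>R w2' - (\<sigma> * (k * gsin k c)) *\<^sub>R w1'"
      by (simp_all only: cs)
    have "w1 \<in> span {w1', w2'}" "w2 \<in> span {w1', w2'}"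
      by (subst w(1), intro span_diff span_scale span_base; simp)
        (subst w(2), intro span_diff span_scale span_base; simp)
    moreover have "w1' \<in> span {w1, w2}" "w2' \<in> span {w1, w2}"
      by (simp_all add: w'_fr fr_mem_span_w)
    ultimately show ?thesis by (simp add: span_eq)
  qed
  have xq: "x (sweep \<gamma> (\<theta>, t)) = (gcos (-k) \<theta> * ?r t) *\<^sub>R u1 + (gsin (-k) \<theta> * ?r t) *\<^sub>R u2
      + (\<sigma> * \<rho> t * gcos k (?\<psi> t)) *\<^sub>R w1' + (\<sigma> * \<rho> t * gsin k (?\<psi> t)) *\<^sub>R w2'" if "t \<in> J" for \<theta> t
  proof -
    have "x (sweep \<gamma> (\<theta>, t)) = patch a b (\<theta>, t)" by (rule x_sweep(1)[OF L]) (use that in simp)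
    also have "\<dots> = fr (gcos (-k) \<theta> * ?r t) (gsin (-k) \<theta> * ?r t) (a t) (b t)" by (simp add: patch_def r)
    also have "\<dots> = (gcos (-k) \<theta> * ?r t) *\<^sub>R u1 + (gsin (-k) \<theta> * ?r t) *\<^sub>R u2
      + (\<sigma> * \<rho> t * gcos k (?\<psi> t)) *\<^sub>R w1' + (\<sigma> * \<rho> t * gsin k (?\<psi> t)) *\<^sub>R w2'"
    proof -
      have "p *\<^sub>R u1 + q *\<^sub>R u2 + A *\<^sub>R w1' + B *\<^sub>R w2' = fr p q (A * (\<sigma> * gcos k c) + B * (\<sigma> * (k * gsin k c))) (A * (\<sigma> * gsin k c) + B * (\<sigma> * gcos k c))"
        for p q A B unfolding w'_fr by (simp add: fr_def algebra_simps)
      then show ?thesis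
        by (simp only: fr_eq_iff) (simp add: ab gcos_add[OF k] gsin_add algebra_simps \<sigma>)
    qed
    finally show ?thesis .
  qed
  have abs\<rho>: "\<bar>\<rho> t\<bar> = sqrt ((?r t)\<^sup>2 + k)" for t
    unfolding \<rho>(2)[symmetric] by simp
  have ell: "elliptic_representation (span {u1, u2}) M x ?r ?\<psi>" if k1: "k = 1"
    unfolding elliptic_representation_def
  proof (intro exI conjI)
    let ?e = "tuple4 w1' w2' u1 u2"
    show "orthonormal_basis ?e"
      by (rule orthonormal_basis_tuple4) (use gr gram k1 in \<open>auto simp: mink_commute\<close>)
    show "span {u1, u2} = span {?e 2, ?e 3}" by simp
    show "open J" "is_interval J" "J \<noteq> {}" using J by auto
    have \<sigma>1: "\<sigma> = 1" using \<rho>(3)[OF k1, of t0] by (simp add: \<sigma>_def)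
    have N': "{m \<in> M. x m \<notin> span {?e 0, ?e 1}} = free_part" by (simp add: free_part_def wspan)
    show "parametrized_by M x {m \<in> M. x m \<notin> span {?e 0, ?e 1}} J (elliptic_rot ?e ?r ?\<psi>)"
      unfolding N' parametrized_by_def
    proof (intro exI[of _ "sweep \<gamma>"] conjI allI ballI)
      show "sweep \<gamma> ` (UNIV \<times> J) = free_part" by (rule N)
      show "\<exists>U. z \<in> U \<and> U \<subseteq> UNIV \<times> J \<and> local_param M x U (sweep \<gamma>)" if "z \<in> UNIV \<times> J" for z by (rule lp[OF that])
      show "x (sweep \<gamma> (\<theta>, t)) = elliptic_rot ?e ?r ?\<psi> \<theta> t" if t: "t \<in> J" for \<theta> t
      proof -
        have "\<rho> t = sqrt (1 + (?r t)\<^sup>2)" using abs\<rho>[of t] \<rho>(3)[OF k1, of t] k1 by (simp add: add.commute)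
        then show ?thesis
          unfolding xq[OF t] elliptic_rot_def using k1
          by (simp add: \<sigma>1 gcos_def gsin_def algebra_simps)
      qed
    qed
  qed
  have hyp: "hyperbolic_representation (span {u1, u2}) M x ?r ?\<psi>" if km: "k = -1"
    unfolding hyperbolic_representation_def
  proof (intro exI conjI)
    let ?e = "tuple4 u1 u2 w1' w2'"
    \<comment> \<open>The sign of the smooth radial function relative to its absolute value sqrt(r^2
      - 1). At points of the axis either value would do.\<close>
    define \<epsilon> :: "real \<Rightarrow> real" where "\<epsilon> t = (if \<sigma> * \<rho> t < 0 then -1 else 1)" for t
    show "orthonormal_basis ?e"
      by (rule orthonormal_basis_tuple4) (use gr gram km in \<open>auto simp: mink_commute\<close>)
    show "span {u1, u2} = span {?e 0, ?e 1}" by simp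
    show "open J" "is_interval J" "J \<noteq> {}" using J by auto
    show "\<forall>t. \<epsilon> t = 1 \<or> \<epsilon> t = -1" by (simp add: \<epsilon>_def)
    show "(\<forall>t\<in>J. ?r t \<noteq> 1) \<longrightarrow> (\<forall>t\<in>J. \<epsilon> t = 1)"
    proof (intro impI ballI)
      fix t assume r1: "\<forall>t\<in>J. ?r t \<noteq> 1" and t: "t \<in> J"
      have nz: "\<rho> s \<noteq> 0" if "s \<in> J" for s
      proof
        assume "\<rho> s = 0"
        then have "(?r s)\<^sup>2 = 1" using \<rho>(2)[of s] km by simp
        then have "?r s = 1" using r(2)[of s] by (simp add: power2_eq_1_iff)
        then show False using r1 that by simp
      qed
      have "\<rho> t / \<bar>\<rho> t\<bar> = \<rho> t0 / \<bar>\<rho> t0\<bar>"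
      proof (rule continuous_sign_constant[of J "\<lambda>s. \<rho> s / \<bar>\<rho> s\<bar>"])
        show "continuous_on J (\<lambda>s. \<rho> s / \<bar>\<rho> s\<bar>)"
          by (intro continuous_intros continuous_on_subset[OF \<rho>(1)]) (use nz in auto)
        show "\<rho> s / \<bar>\<rho> s\<bar> = 1 \<or> \<rho> s / \<bar>\<rho> s\<bar> = -1" if "s \<in> J" for s using nz[OF that] by (simp add: abs_if)
      qed (use J t in auto)
      then have "\<rho> t < 0 \<longleftrightarrow> \<rho> t0 < 0" using nz[OF t] nz[OF J(3)] by (auto simp: abs_if split: if_splits)
      then show "\<epsilon> t = 1" using r1 nz[OF t] by (auto simp: \<epsilon>_def \<sigma>_def)
    qed
    have NM: "free_part = M" using axis_only_elliptic km by (force simp: free_part_def)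
    show "parametrized_by M x M J (\<lambda>\<theta> t. hyperbolic_rot (flip23 (\<epsilon> t) ?e) ?r ?\<psi> \<theta> t)"
      unfolding parametrized_by_def
    proof (intro exI[of _ "sweep \<gamma>"] conjI allI ballI)
      show "sweep \<gamma> ` (UNIV \<times> J) = M" using N NM by simp
      show "\<exists>U. z \<in> U \<and> U \<subseteq> UNIV \<times> J \<and> local_param M x U (sweep \<gamma>)" if "z \<in> UNIV \<times> J" for z by (rule lp[OF that])
      show "x (sweep \<gamma> (\<theta>, t)) = hyperbolic_rot (flip23 (\<epsilon> t) ?e) ?r ?\<psi> \<theta> t" if t: "t \<in> J" for \<theta> t
      proof -
        have "sqrt ((?r t)\<^sup>2 - 1) * \<epsilon> t = \<sigma> * \<rho> t"
          using abs\<rho>[of t] km by (auto simp: \<epsilon>_def \<sigma>_def split: if_splits)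
        then have e: "sqrt ((?r t)\<^sup>2 - 1) * g * \<epsilon> t = \<sigma> * \<rho> t * g" for g by (metis mult.assoc mult.commute)
        show ?thesis
          unfolding xq[OF t] hyperbolic_rot_def flip23_def using km
          by (simp add: gcos_def gsin_def e mult.commute[of "?r t"])
      qed
    qed
  qed
  show ?thesis using roots ell hyp by blast
qed

end

theorem theorem4p7:
  fixes M :: "'m::t2_space set" and x :: "'m \<Rightarrow> mink_space"
    and V :: "mink_space set" and H :: real
  assumes "immersed_surface M x"
    and "rotational_surface V M x"
    and "\<not> parabolic_plane V"
    and "cmc_surface M x H"
    and "H \<ge> 0"
    and "H\<^sup>2 > 1"
  shows "\<exists>\<kappa> C C1 C2 p.
           proots (cmc_poly \<kappa> H C) = {#C1, C2#} \<and> C1 \<ge> C2 \<and> C2 \<ge> 0 \<and>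
           p \<ge> 0 \<and> p\<^sup>2 = (C1 - C2) / C1 \<and> (C1 - C2) / C1 \<in> {0..1} \<and>
           ((\<kappa> = 1 \<and> elliptic_plane V \<and>
             elliptic_representation V M x (cmc_r H C1 p) (cmc_psi \<kappa> H C C1 C2 p)) \<or>
            (\<kappa> = -1 \<and> hyperbolic_plane V \<and>
             hyperbolic_representation V M x (cmc_r H C1 p) (cmc_psi \<kappa> H C C1 C2 p)))"
proof -
  have H1: "H > 1" using assms(5,6) by (intro power2_less_imp_less[of 1 H]) simp_all
  obtain R \<phi>0 where V: "subspace V" "dim V = 2" and R: "rotation_group V R"
    and eqv: "\<forall>s. \<forall>m\<in>M. \<phi>0 s m \<in> M \<and> x (\<phi>0 s m) = R s (x m)" and \<phi>00: "\<forall>m\<in>M. \<phi>0 0 m = m"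
    and \<phi>0add: "\<forall>s t. \<forall>m\<in>M. \<phi>0 (s + t) m = \<phi>0 s (\<phi>0 t m)"
    and \<phi>0cont: "continuous_on (UNIV \<times> M) (\<lambda>(s, m). \<phi>0 s m)"
    using assms(2) unfolding rotational_surface_def by blast
  obtain k u1 u2 w1 w2 where fr: "mink_frame k u1 u2 w1 w2" and Vs: "V = span {u1, u2}"
    and sig: "k = 1 \<Longrightarrow> elliptic_plane V" "k = -1 \<Longrightarrow> hyperbolic_plane V"
    by (rule nonparabolic_plane_frame[OF V assms(3)]) blast
  interpret F: mink_frame k u1 u2 w1 w2 by (rule fr)
  obtain \<omega> where \<omega>: "\<omega> \<noteq> 0" and Rf: "\<And>s p q a b. R s (F.fr p q a b) =
      F.fr (gcos (-k) (\<omega> * s) * p - k * gsin (-k) (\<omega> * s) * q) (gsin (-k) (\<omega> * s) * p + gcos (-k) (\<omega> * s) * q) a b"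
    by (rule F.rotation_group_in_frame[OF R[unfolded Vs]]) blast
  \<comment> \<open>Time is rescaled so that the parameter of the action is the rotation angle, as
    \<open>rot_surface\<close> assumes.\<close>
  define \<phi> where "\<phi> s m = \<phi>0 (s / \<omega>) m" for s m
  interpret rot_surface k u1 u2 w1 w2 M x \<phi> H
  proof unfold_locales
    show "immersed_surface M x" "cmc_surface M x H" "H > 0" using assms(1,4) H1 by simp_all
    show "\<phi> s m \<in> M" if "m \<in> M" for s m using eqv that by (simp add: \<phi>_def)
    show "\<phi> 0 m = m" if "m \<in> M" for m using \<phi>00 that by (simp add: \<phi>_def)
    show "\<phi> (s + t) m = \<phi> s (\<phi> t m)" if "m \<in> M" for s t m
      using \<phi>0add that by (simp add: \<phi>_def add_divide_distrib)
    show "x (\<phi> s m) = F.fr (gcos (-k) s * p - k * gsin (-k) s * q) (gsin (-k) s * p + gcos (-k) s * q) a b"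
      if "m \<in> M" "x m = F.fr p q a b" for s m p q a b
      using eqv that Rf[of "s / \<omega>" p q a b] \<omega> by (simp add: \<phi>_def)
    have "continuous_on (UNIV \<times> M) (\<lambda>z. (fst z / \<omega>, snd z))"
      using \<omega> by (intro continuous_intros) auto
    then have "continuous_on (UNIV \<times> M) (\<lambda>z. (\<lambda>(s, m). \<phi>0 s m) (fst z / \<omega>, snd z))"
      by (rule continuous_on_compose2[OF \<phi>0cont]) auto
    then show "continuous_on (UNIV \<times> M) (\<lambda>(s, m). \<phi> s m)" by (simp add: \<phi>_def case_prod_beta)
  qed
  obtain C C1 C2 p where rep: "proots (cmc_poly k H C) = {#C1, C2#} \<and> C1 \<ge> C2 \<and> C2 \<ge> 0 \<and>
     p \<ge> 0 \<and> p\<^sup>2 = (C1 - C2) / C1 \<and> (C1 - C2) / C1 \<in> {0..1}"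
     "k = 1 \<Longrightarrow> elliptic_representation V M x (cmc_r H C1 p) (cmc_psi k H C C1 C2 p)"
     "k = -1 \<Longrightarrow> hyperbolic_representation V M x (cmc_r H C1 p) (cmc_psi k H C C1 C2 p)"
    using cmc_representation[OF H1] unfolding Vs by blast
  show ?thesis
  proof (intro exI)
    show "proots (cmc_poly k H C) = {#C1, C2#} \<and> C1 \<ge> C2 \<and> C2 \<ge> 0 \<and>
       p \<ge> 0 \<and> p\<^sup>2 = (C1 - C2) / C1 \<and> (C1 - C2) / C1 \<in> {0..1} \<and>
       ((k = 1 \<and> elliptic_plane V \<and>
         elliptic_representation V M x (cmc_r H C1 p) (cmc_psi k H C C1 C2 p)) \<or>
        (k = -1 \<and> hyperbolic_plane V \<and>
         hyperbolic_representation V M x (cmc_r H C1 p) (cmc_psi k H C C1 C2 p)))"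
      using rep sig F.k by blast
  qed
qed

end
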